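(* There exist universal constants $\alpha_1,\alpha_2,\alpha_3>0$ such that the following holds for every $n\ge 2$. Let $A\subseteq S^{n-1}$ be a measurable subset that depends only on at most $\alpha_1\sqrt{n}$ directions and satisfies $\sigma_{n-1}(A)\geq e^{-\alpha_2\sqrt{n}}$. Then $$\mathbb{P}_H\left(\sqrt{\sigma_H(A\cap H)\,\sigma_{H^{\perp}}(A\cap H^{\perp})}\geq 0.9\,\sigma_{n-1}(A)\right)\geq 1-\alpha_3e^{-\sqrt{n}}.$$
   Context: $S^{n-1}\subseteq\mathbb{R}^n$ is the Euclidean unit sphere and $\sigma_{n-1}$ is the uniform probability measure on it. For a linear subspace $H\subseteq\mathbb{R}^n$, $\sigma_H$ is the rotation-invariant (Haar) probability measure on $S^{n-1}\cap H$; $H^\perp$ is the orthogonal complement. $\mathbb{P}_H$ denotes probability with respect to a random subspace $H\subseteq\mathbb{R}^n$ of dimension $\lfloor n/2\rfloor$ distributed according to the orthogonally invariant Haar probability measure on the Grassmannian. A set $A\subseteq S^{n-1}$ depends only on $k$ directions if there are vectors $v_1,\ldots,v_k\in\mathbb{R}^n$ and a Borel set $I\subseteq\mathbb{R}^k$ such that $A=\{x\in S^{n-1}: (\langle x,v_1\rangle,\ldots,\langle x,v_k\rangle)\in I\}$. Universal constants do not depend on $n$ or $A$. *)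

theory Defs
  imports "HOL-Probability.Probability"
begin

text \<open>
  The universal constants of the theorem must be chosen before the dimension \<open>n\<close>, so \<open>n\<close> cannot be
  the cardinality of an index type. Instead, all spaces \<open>\<real>\<^sup>n\<close> live inside one inner product
  space, the finitely supported real sequences; \<open>\<real>\<^sup>n\<close> is the subspace \<open>Euclid n\<close> of sequences
  that vanish from index \<open>n\<close> on. The induced inner product and topology on \<open>Euclid n\<close> are the
  Euclidean ones, and \<^const>\<open>subspace\<close>, \<^const>\<open>dim\<close>, \<^const>\<open>orthogonal_comp\<close>,
  \<^const>\<open>orthogonal_transformation\<close>, \<^const>\<open>sphere\<close> and \<^const>\<open>borel\<close> of the library apply.
\<close>

typedef fseq = "{x :: nat \<Rightarrow> real. finite {i. x i \<noteq> 0}}"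
  morphisms coord Abs_fseq
  by (rule exI[of _ "\<lambda>_. 0"]) simp

setup_lifting type_definition_fseq

lemma finite_coord: "finite {i. coord x i \<noteq> 0}"
  using coord by blast

lemma fseq_eqI: "(\<And>i. coord x i = coord y i) \<Longrightarrow> x = y"
  by (metis coord_inject ext)

instantiation fseq :: real_vector
begin

lift_definition zero_fseq :: fseq is "\<lambda>_. 0" by simp

lift_definition plus_fseq :: "fseq \<Rightarrow> fseq \<Rightarrow> fseq" is "\<lambda>x y i. x i + y i"
proof -
  fix x y :: "nat \<Rightarrow> real"
  assume "finite {i. x i \<noteq> 0}" "finite {i. y i \<noteq> 0}"
  then show "finite {i. x i + y i \<noteq> 0}"
    by (rule rev_finite_subset[OF finite_UnI]) auto
qed

lift_definition minus_fseq :: "fseq \<Rightarrow> fseq \<Rightarrow> fseq" is "\<lambda>x y i. x i - y i"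
proof -
  fix x y :: "nat \<Rightarrow> real"
  assume "finite {i. x i \<noteq> 0}" "finite {i. y i \<noteq> 0}"
  then show "finite {i. x i - y i \<noteq> 0}"
    by (rule rev_finite_subset[OF finite_UnI]) auto
qed

lift_definition uminus_fseq :: "fseq \<Rightarrow> fseq" is "\<lambda>x i. - x i" by simp

lift_definition scaleR_fseq :: "real \<Rightarrow> fseq \<Rightarrow> fseq" is "\<lambda>c x i. c * x i"
  by (rule rev_finite_subset) auto

instance
  by standard (transfer, simp add: algebra_simps fun_eq_iff)+

end

lemma coord_simps [simp]:
  "coord 0 i = 0" "coord (x + y) i = coord x i + coord y i"
  "coord (x - y) i = coord x i - coord y i" "coord (- x) i = - coord x i"
  "coord (c *\<^sub>R x) i = c * coord x i"
  by (transfer, simp)+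

lemma coord_sum [simp]: "coord (\<Sum>j\<in>J. f j) i = (\<Sum>j\<in>J. coord (f j) i)"
  by (induction J rule: infinite_finite_induct) auto

instantiation fseq :: real_inner
begin

definition inner_fseq :: "fseq \<Rightarrow> fseq \<Rightarrow> real" where
  "inner_fseq x y = (\<Sum>i | coord x i \<noteq> 0. coord x i * coord y i)"

definition norm_fseq :: "fseq \<Rightarrow> real" where
  "norm_fseq x = sqrt (inner x x)"

definition sgn_fseq :: "fseq \<Rightarrow> fseq" where
  "sgn_fseq x = x /\<^sub>R norm x"

definition dist_fseq :: "fseq \<Rightarrow> fseq \<Rightarrow> real" where
  "dist_fseq x y = norm (x - y)"

definition uniformity_fseq :: "(fseq \<times> fseq) filter" where
  "uniformity_fseq = (INF e\<in>{0<..}. principal {(x, y). dist x y < e})"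

definition open_fseq :: "fseq set \<Rightarrow> bool" where
  "open_fseq U \<longleftrightarrow> (\<forall>x\<in>U. \<forall>\<^sub>F (x', y) in uniformity. x' = x \<longrightarrow> y \<in> U)"

lemma inner_fseq_superset:
  assumes "finite S" "{i. coord x i \<noteq> 0} \<subseteq> S"
  shows "inner x y = (\<Sum>i\<in>S. coord x i * coord y i)"
  unfolding inner_fseq_def using assms by (intro sum.mono_neutral_left) auto

instance
proof
  fix x y z :: fseq and r :: real
  let ?S = "{i. coord x i \<noteq> 0} \<union> {i. coord y i \<noteq> 0}"
  have S: "finite ?S" by (simp add: finite_coord)
  show "inner x y = inner y x"
    using inner_fseq_superset[OF S, of x y] inner_fseq_superset[OF S, of y x]
    by (simp add: mult.commute)
  have "{i. coord (x + y) i \<noteq> 0} \<subseteq> ?S" by auto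
  then show "inner (x + y) z = inner x z + inner y z"
    using inner_fseq_superset[OF S, of x z] inner_fseq_superset[OF S, of y z]
      inner_fseq_superset[OF S, of "x + y" z]
    by (simp add: sum.distrib algebra_simps)
  have "{i. coord (r *\<^sub>R x) i \<noteq> 0} \<subseteq> ?S" by auto
  then show "inner (r *\<^sub>R x) y = r * inner x y"
    using inner_fseq_superset[OF S, of x y] inner_fseq_superset[OF S, of "r *\<^sub>R x" y]
    by (simp add: sum_distrib_left algebra_simps)
  show "0 \<le> inner x x"
    unfolding inner_fseq_def by (intro sum_nonneg) simp
  show "inner x x = 0 \<longleftrightarrow> x = 0"
  proof
    assume "inner x x = 0"
    then have "\<forall>i\<in>{i. coord x i \<noteq> 0}. coord x i * coord x i = 0"
      unfolding inner_fseq_def by (subst (asm) sum_nonneg_eq_0_iff) (auto simp: finite_coord)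
    then show "x = 0" by (intro fseq_eqI) auto
  qed (simp add: inner_fseq_def)
qed (simp_all add: norm_fseq_def sgn_fseq_def dist_fseq_def uniformity_fseq_def open_fseq_def)

end

lift_definition unit_fseq :: "nat \<Rightarrow> fseq" is "\<lambda>i j. if j = i then 1 else 0" by simp

lemma coord_unit_fseq: "coord (unit_fseq i) j = (if j = i then 1 else 0)"
  by transfer simp

definition Euclid :: "nat \<Rightarrow> fseq set" where
  "Euclid n = {x. \<forall>i\<ge>n. coord x i = 0}"

lemma inner_Euclid:
  assumes "x \<in> Euclid n"
  shows "inner x y = (\<Sum>i<n. coord x i * coord y i)"
  using assms by (intro inner_fseq_superset) (auto simp: Euclid_def not_le[symmetric])

lemma subspace_Euclid: "subspace (Euclid n)"
  by (auto simp: subspace_def Euclid_def)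

lemma Euclid_eq_span: "Euclid n = span (unit_fseq ` {..<n})"
proof
  show "Euclid n \<subseteq> span (unit_fseq ` {..<n})"
  proof
    fix x assume x: "x \<in> Euclid n"
    have "x = (\<Sum>j<n. coord x j *\<^sub>R unit_fseq j)"
    proof (rule fseq_eqI)
      fix i
      show "coord x i = coord (\<Sum>j<n. coord x j *\<^sub>R unit_fseq j) i"
        using x by (auto simp: coord_unit_fseq Euclid_def if_distrib cong: if_cong)
    qed
    also have "\<dots> \<in> span (unit_fseq ` {..<n})"
      by (intro span_sum span_scale span_base) auto
    finally show "x \<in> span (unit_fseq ` {..<n})" .
  qed
  show "span (unit_fseq ` {..<n}) \<subseteq> Euclid n"
    by (intro span_minimal subspace_Euclid) (auto simp: Euclid_def coord_unit_fseq)
qed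

lemma dim_Euclid: "dim (Euclid n) = n"
proof -
  have inj: "inj unit_fseq"
    by (metis (mono_tags) coord_unit_fseq injI zero_neq_one)
  have "pairwise orthogonal (range unit_fseq)" "0 \<notin> range unit_fseq"
    using inj by (auto simp: pairwise_def orthogonal_def inner_fseq_def coord_unit_fseq)
      (metis coord_simps(1) coord_unit_fseq zero_neq_one)
  then have "independent (unit_fseq ` {..<n})"
    by (intro pairwise_orthogonal_independent) (auto simp: pairwise_def)
  then show ?thesis
    using inj by (simp add: Euclid_eq_span dim_eq_card_independent card_image inj_on_subset)
qed

text \<open>
  \<open>sphere_borel H\<close> carries the Borel sets of the unit sphere of \<open>H\<close>. A linear isometry of \<open>H\<close> extends
  to the ambient space (by the identity on the orthogonal complement of \<open>H\<close>), so the maps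
  \<open>g\<close> in \<open>haar_sphere\<close> restrict to exactly the orthogonal group of \<open>H\<close>. For finite-dimensional
  \<open>H \<noteq> {0}\<close> there is exactly one invariant probability measure. Invariance is under the full
  orthogonal group, which matters for \<open>dim H = 1\<close>: there it forces weight 1/2 on both points.
\<close>

definition sphere_borel :: "fseq set \<Rightarrow> fseq measure" where
  "sphere_borel H = restrict_space borel (sphere 0 1 \<inter> H)"

definition haar_sphere :: "fseq set \<Rightarrow> fseq measure" where
  "haar_sphere H = (THE M. sets M = sets (sphere_borel H) \<and> prob_space M \<and>
     (\<forall>g. orthogonal_transformation g \<and> g ` H = H \<longrightarrow> distr M M g = M))"

definition orth_proj :: "fseq set \<Rightarrow> fseq \<Rightarrow> fseq" where
  "orth_proj H x = (THE y. y \<in> H \<and> x - y \<in> orthogonal_comp H)"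

definition grassmannian :: "nat \<Rightarrow> nat \<Rightarrow> fseq set set" where
  "grassmannian n k = {H. subspace H \<and> H \<subseteq> Euclid n \<and> dim H = k}"

text \<open>
  The Borel sets of the Grassmannian come from its usual topology, in which \<open>H\<close> is identified with
  the matrix of the orthogonal projection onto \<open>H\<close>, here the sequence of its columns (those with
  index at least \<open>n\<close> are zero).
\<close>

definition grassmannian_borel :: "nat \<Rightarrow> nat \<Rightarrow> fseq set measure" where
  "grassmannian_borel n k =
     vimage_algebra (grassmannian n k) (\<lambda>H i. orth_proj H (unit_fseq i)) borel"

definition haar_grassmannian :: "nat \<Rightarrow> nat \<Rightarrow> fseq set measure" where
  "haar_grassmannian n k = (THE M. sets M = sets (grassmannian_borel n k) \<and> prob_space M \<and>
     (\<forall>g. orthogonal_transformation g \<and> g ` Euclid n = Euclid n \<longrightarrow> distr M M ((`) g) = M))"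

definition depends_on_directions :: "nat \<Rightarrow> nat \<Rightarrow> fseq set \<Rightarrow> bool" where
  "depends_on_directions n k A \<longleftrightarrow>
     (\<exists>v I. (\<forall>j<k. v j \<in> Euclid n) \<and> I \<in> sets (restrict_space borel (Euclid k)) \<and>
        A = {x \<in> sphere 0 1 \<inter> Euclid n. (\<Sum>j<k. inner x (v j) *\<^sub>R unit_fseq j) \<in> I})"

end

(*
  For a subspace H in general position the projection of a uniform point of the sphere of H to the
  span F of the given directions has the density const * det(M)^(-1/2) * (1 - <M^(-1) z, z>)^p, where
  M is the compression of the orthogonal projection onto H to F; for the orthogonal complement of H
  the matrix M is replaced by 1 - M. With M = 1/2 + E the first-order terms in E cancel in the
  geometric mean of the two densities, and the determinants contribute a factor at least 1, since
  mu (1 - mu) <= 1/4. A net argument gives ||E|| <= C n^(-1/4) outside an event of probability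
  O(exp(-sqrt n)), so that on |z|^2 <= eps / sqrt n the geometric mean is at least 0.95 times the
  density for the full sphere. The remaining z carry mass at most exp(-c sqrt n), which the lower
  bound on the measure of A absorbs, and the Cauchy-Schwarz inequality concludes.
*)
theory Submission
  imports Defs
begin

subsection \<open>Borel structure of the sequence space\<close>

text \<open>The scale sqrt n balances competing demands. A net of the unit sphere of an
  l-dimensional F has exp (O(l)) points, each failing with probability O(exp (- t^2 n / 2)), so l =
  O(sqrt n) together with a failure probability exp (- sqrt n) puts the tolerance t at order
  n^(-1/4). With E of that order and s = |z|^2, the second-order term left in the exponent is n s
  t^2, bounded when s = O(1 / sqrt n). The normalising constants lose l^2 / n, harmless for l a
  small multiple of sqrt n.

  Both Haar measures are specified by \<open>THE\<close>, so nothing can be computed before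
  existence and uniqueness are known. Uniqueness rests on metric balls: a transitive isometry group
  gives balls of equal radius equal mass, and this determines a probability measure. Existence comes
  from Gaussian vectors, normalised for spheres and adjoined one by one for subspaces.

  The span F of the directions is fixed, but the basis of F that diagonalises M varies with H. Hence
  A is rewritten in coordinates for each H separately, and only the net estimate, which needs no
  diagonal basis, is carried out under the probability over H.\<close>

lemma coord_eq_inner: "coord x i = x \<bullet> unit_fseq i"
  by (subst inner_commute) (simp add: inner_fseq_def coord_unit_fseq if_distrib cong: if_cong)

lemma norm_unit_fseq [simp]: "norm (unit_fseq i) = 1"
  by (simp add: norm_eq_sqrt_inner flip: coord_eq_inner) (simp add: coord_unit_fseq)

lemma fseq_expand: "x \<in> Euclid n \<Longrightarrow> x = (\<Sum>i<n. coord x i *\<^sub>R unit_fseq i)"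
  by (rule fseq_eqI) (auto simp: coord_unit_fseq Euclid_def if_distrib cong: if_cong)

lemma ex_Euclid: "\<exists>n. x \<in> Euclid n"
proof -
  obtain n where "\<forall>i\<in>{i. coord x i \<noteq> 0}. i < n"
    using finite_nat_set_iff_bounded finite_coord by blast
  then show ?thesis by (auto simp: Euclid_def intro!: exI[of _ n] leD)
qed

text \<open>Finite combinations of the unit vectors with rational coefficients are dense, and the
  balls of radius \<open>1 / Suc k\<close> around them form a countable basis. Second countability
  makes the Borel sets of a product the product of the Borel sets and provides the Lindelof covers
  used below.\<close>

instance fseq :: second_countable_topology
proof
  define c :: "rat list \<Rightarrow> fseq" where
    "c l = (\<Sum>i<length l. of_rat (l ! i) *\<^sub>R unit_fseq i)" for l
  have dense: "\<exists>l. dist x (c l) < e" if e: "e > 0" for x :: fseq and e :: real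
  proof -
    obtain n where n: "x \<in> Euclid n" using ex_Euclid by blast
    \<comment> \<open>Dividing by n + 1 makes n errors add up to strictly less than
      \<open>e\<close>, also for n = 0.\<close>
    have "\<exists>q. \<bar>coord x i - of_rat q\<bar> < e / (n + 1)" for i
    proof -
      obtain q where "of_rat q \<in> {coord x i - e/(n+1)<..<coord x i + e/(n+1)}"
        using of_rat_dense[of "coord x i - e/(n+1)" "coord x i + e/(n+1)"] divide_pos_pos[OF e, of "real (n+1)"]
        by force
      then show ?thesis by (intro exI[of _ q]) (auto simp: abs_less_iff)
    qed
    then obtain q where q: "\<And>i. \<bar>coord x i - of_rat (q i)\<bar> < e / (n + 1)" by metis
    have "x - c (map q [0..<n]) = (\<Sum>i<n. (coord x i - of_rat (q i)) *\<^sub>R unit_fseq i)"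
      by (subst fseq_expand[OF n]) (simp add: c_def scaleR_diff_left sum_subtractf)
    also have "norm \<dots> \<le> (\<Sum>i<n. \<bar>coord x i - of_rat (q i)\<bar>)"
      by (rule order_trans[OF norm_sum]) simp
    also have "\<dots> \<le> (\<Sum>i<n. e / (n + 1))" using q by (intro sum_mono) (simp add: less_imp_le)
    also have "\<dots> < e" using that by (simp add: field_simps)
    finally show ?thesis by (auto simp: dist_norm)
  qed
  define B where "B = (\<lambda>(l, k). ball (c l) (1 / Suc k)) ` UNIV"
  have "topological_basis B"
  proof (rule topological_basisI)
    fix U :: "fseq set" and x assume "open U" "x \<in> U"
    then obtain e where e: "e > 0" "ball x e \<subseteq> U" using open_contains_ball by blast
    obtain k where k: "1 / Suc k < e / 2" by (rule nat_approx_posE[of "e/2"]) (use e(1) in auto)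
    obtain l where l: "dist x (c l) < 1 / Suc k" using dense[of "1 / Suc k"] by auto
    have "ball (c l) (1 / Suc k) \<subseteq> U"
    proof
      fix y assume "y \<in> ball (c l) (1 / Suc k)"
      then have "dist x y < e"
        using l k dist_triangle[of x y "c l"] by (auto simp: dist_commute)
      then show "y \<in> U" using e by auto
    qed
    then show "\<exists>B'\<in>B. x \<in> B' \<and> B' \<subseteq> U"
      using l by (auto simp: B_def dist_commute intro!: bexI[of _ "ball (c l) (1 / Suc k)"])
  qed (auto simp: B_def)
  moreover have "countable B" by (simp add: B_def)
  ultimately show "\<exists>B::fseq set set. countable B \<and> open = generate_topology B"
    using topological_basis_imp_subbasis by blast
qed

lemma ennreal_inverse_mult_self: "a \<noteq> 0 \<Longrightarrow> a \<noteq> \<infinity> \<Longrightarrow> inverse a * a = (1::ennreal)"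
  using ennreal_divide_self[of a] by (simp add: divide_ennreal_def mult.commute less_top)

subsection \<open>Measures with uniform balls\<close>

text \<open>Christensen's argument: integrating \<open>N (ball x r \<inter> U) / h r\<close> over \<open>U\<close> with respect to \<open>M\<close>, Fatou's
  lemma for \<open>r \<rightarrow> 0\<close> gives at least \<open>M U\<close>, while exchanging the integrals gives at most \<open>N U\<close>.\<close>

lemma uniform_balls_open_le:
  fixes M N :: "'a::{metric_space, second_countable_topology} measure" and h :: "real \<Rightarrow> ennreal"
  assumes sM: "sets M = sets borel" and sN: "sets N = sets borel"
    and sfM: "sigma_finite_measure M" and sfN: "sigma_finite_measure N"
    and M: "\<And>x r. x \<in> S \<Longrightarrow> r \<in> \<rat> \<Longrightarrow> r > 0 \<Longrightarrow> emeasure M (ball x r) = h r"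
    and N: "\<And>x r. x \<in> S \<Longrightarrow> r \<in> \<rat> \<Longrightarrow> r > 0 \<Longrightarrow> emeasure N (ball x r) = h r"
    and AM: "AE x in M. x \<in> S" and AN: "AE x in N. x \<in> S"
    and h: "\<And>r. r \<in> \<rat> \<Longrightarrow> r > 0 \<Longrightarrow> h r \<noteq> 0" "\<And>r. r \<in> \<rat> \<Longrightarrow> r > 0 \<Longrightarrow> h r \<noteq> \<infinity>"
    and U: "open U"
  shows "emeasure M U \<le> emeasure N U"
proof -
  interpret M: sigma_finite_measure M by fact
  interpret N: sigma_finite_measure N by fact
  interpret P: pair_sigma_finite M N by standard
  have [measurable_cong]: "sets M = sets borel" "sets N = sets borel" by fact+
  have [measurable]: "U \<in> sets borel" using U by auto
  have D: "(\<lambda>p. indicator {p. dist (fst p) (snd p) < r} p :: ennreal) \<in> borel_measurable (M \<Otimes>\<^sub>M N)" for r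
  proof -
    have "open {p::'a\<times>'a. dist (fst p) (snd p) < r}"
      by (intro open_Collect_less continuous_intros)
    then have "(indicator {p::'a\<times>'a. dist (fst p) (snd p) < r} :: _ \<Rightarrow> ennreal) \<in> borel_measurable borel"
      by (intro borel_measurable_indicator) auto
    then show ?thesis
      by (simp add: borel_prod[symmetric] cong: measurable_cong_sets)
  qed
  define F where "F r x y = (indicator U x * indicator U y * indicator {p. dist (fst p) (snd p) < r} (x, y) :: ennreal)"
    for r :: real and x y :: 'a
  have Fm: "(\<lambda>p. F r (fst p) (snd p)) \<in> borel_measurable (M \<Otimes>\<^sub>M N)" for r
    unfolding F_def using D[of r] by simp
  have Fm2 [measurable]: "(\<lambda>x. \<integral>\<^sup>+y. F r x y \<partial>N) \<in> borel_measurable M" for r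
    using N.borel_measurable_nn_integral[of "\<lambda>x y. F r x y" M] Fm[of r] by (simp add: case_prod_beta')
  \<comment> \<open>Rational radii tending to 0: the hypotheses on balls speak of rational radii
    only.\<close>
  define e where "e k = 1 / real (Suc k)" for k
  have e: "e k \<in> \<rat>" "e k > 0" for k by (simp_all add: e_def)
  have inn: "(\<integral>\<^sup>+y. F r x y \<partial>N) = indicator U x * emeasure N (ball x r \<inter> U)" for r x
  proof -
    have "(\<integral>\<^sup>+y. F r x y \<partial>N) = (\<integral>\<^sup>+y. indicator U x * indicator (ball x r \<inter> U) y \<partial>N)"
      by (intro nn_integral_cong) (auto simp: F_def split: split_indicator)
    then show ?thesis by (subst (asm) nn_integral_cmult_indicator) simp_all
  qed
  have inn': "(\<integral>\<^sup>+x. F r x y \<partial>M) = indicator U y * emeasure M (ball y r \<inter> U)" for r y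
  proof -
    have "(\<integral>\<^sup>+x. F r x y \<partial>M) = (\<integral>\<^sup>+x. indicator U y * indicator (ball y r \<inter> U) x \<partial>M)"
      by (intro nn_integral_cong) (auto simp: F_def dist_commute split: split_indicator)
    then show ?thesis by (subst (asm) nn_integral_cmult_indicator) simp_all
  qed
  have "emeasure M U = (\<integral>\<^sup>+x. indicator U x \<partial>M)" by simp
  also have "\<dots> \<le> (\<integral>\<^sup>+x. liminf (\<lambda>k. inverse (h (e k)) * (\<integral>\<^sup>+y. F (e k) x y \<partial>N)) \<partial>M)"
  proof (rule nn_integral_mono_AE, use AM in eventually_elim)
    fix x assume x: "x \<in> S"
    show "indicator U x \<le> liminf (\<lambda>k. inverse (h (e k)) * (\<integral>\<^sup>+y. F (e k) x y \<partial>N))"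
    proof (cases "x \<in> U")
      case True
      then obtain d where d: "d > 0" "ball x d \<subseteq> U" using U open_contains_ball by blast
      have "eventually (\<lambda>k. e k < d) sequentially"
        using LIMSEQ_Suc[OF lim_1_over_n] d(1) unfolding e_def by (rule order_tendstoD(2))
      then have "eventually (\<lambda>k. 1 \<le> inverse (h (e k)) * (\<integral>\<^sup>+y. F (e k) x y \<partial>N)) sequentially"
      proof eventually_elim
        fix k assume "e k < d"
        then have "ball x (e k) \<inter> U = ball x (e k)" using d by auto
        then have "inverse (h (e k)) * (\<integral>\<^sup>+y. F (e k) x y \<partial>N) = inverse (h (e k)) * h (e k)"
          using True N[OF x e[of k]] by (simp add: inn)
        also have "\<dots> = 1"
          by (rule ennreal_inverse_mult_self[OF h[OF e[of k]]])
        finally show "1 \<le> inverse (h (e k)) * (\<integral>\<^sup>+y. F (e k) x y \<partial>N)" by simp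
      qed
      then show ?thesis using True by (simp add: Liminf_bounded)
    qed simp
  qed
  also have "\<dots> \<le> liminf (\<lambda>k. \<integral>\<^sup>+x. inverse (h (e k)) * (\<integral>\<^sup>+y. F (e k) x y \<partial>N) \<partial>M)"
    by (rule nn_integral_liminf) measurable
  also have "\<dots> \<le> liminf (\<lambda>k. emeasure N U)"
  proof (rule Liminf_mono, rule always_eventually, rule allI)
    fix k
    have "(\<integral>\<^sup>+x. inverse (h (e k)) * (\<integral>\<^sup>+y. F (e k) x y \<partial>N) \<partial>M)
        = inverse (h (e k)) * (\<integral>\<^sup>+x. (\<integral>\<^sup>+y. F (e k) x y \<partial>N) \<partial>M)"
      by (rule nn_integral_cmult) measurable
    also have "(\<integral>\<^sup>+x. (\<integral>\<^sup>+y. F (e k) x y \<partial>N) \<partial>M) = (\<integral>\<^sup>+y. (\<integral>\<^sup>+x. F (e k) x y \<partial>M) \<partial>N)"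
      using P.Fubini'[of "\<lambda>x y. F (e k) x y"] Fm[of "e k"] by (simp add: case_prod_beta')
    also have "\<dots> \<le> (\<integral>\<^sup>+y. h (e k) * indicator U y \<partial>N)"
    proof (rule nn_integral_mono_AE, use AN in eventually_elim)
      fix y assume "y \<in> S"
      have "emeasure M (ball y (e k) \<inter> U) \<le> emeasure M (ball y (e k))"
        by (intro emeasure_mono) (auto simp: sM)
      then show "(\<integral>\<^sup>+x. F (e k) x y \<partial>M) \<le> h (e k) * indicator U y"
        using M[OF \<open>y \<in> S\<close> e[of k]] by (auto simp: inn' split: split_indicator)
    qed
    also have "\<dots> = h (e k) * emeasure N U" by (simp add: nn_integral_cmult)
    finally have "(\<integral>\<^sup>+x. inverse (h (e k)) * (\<integral>\<^sup>+y. F (e k) x y \<partial>N) \<partial>M)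
        \<le> inverse (h (e k)) * (h (e k) * emeasure N U)" by (simp add: mult_left_mono)
    also have "\<dots> = emeasure N U"
      using ennreal_inverse_mult_self[OF h[OF e[of k]]] by (simp flip: mult.assoc)
    finally show "(\<integral>\<^sup>+x. inverse (h (e k)) * (\<integral>\<^sup>+y. F (e k) x y \<partial>N) \<partial>M) \<le> emeasure N U" .
  qed
  also have "\<dots> = emeasure N U" by (simp add: Liminf_const)
  finally show ?thesis .
qed

text \<open>The inequality for open sets applies in both directions, and the open sets are an
  intersection-stable generator. If some radius has \<open>h r = 0\<close>, dividing by
  \<open>h r\<close> is impossible; then Lindelof covers \<open>S\<close> by countably many null
  balls, and both measures vanish. Asking for rational radii only lets a set of admissible centres
  be cut out by countably many conditions later.\<close>

lemma uniform_balls_unique: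
  fixes M N :: "'a::{metric_space, second_countable_topology} measure" and h :: "real \<Rightarrow> ennreal"
  assumes sM: "sets M = sets borel" and sN: "sets N = sets borel"
    and M: "\<And>x r. x \<in> S \<Longrightarrow> r \<in> \<rat> \<Longrightarrow> r > 0 \<Longrightarrow> emeasure M (ball x r) = h r"
    and N: "\<And>x r. x \<in> S \<Longrightarrow> r \<in> \<rat> \<Longrightarrow> r > 0 \<Longrightarrow> emeasure N (ball x r) = h r"
    and AM: "AE x in M. x \<in> S" and AN: "AE x in N. x \<in> S"
    and h: "\<And>r. r \<in> \<rat> \<Longrightarrow> r > 0 \<Longrightarrow> h r \<noteq> \<infinity>"
    and S: "x0 \<in> S"
  shows "M = N"
proof -
  have [measurable_cong]: "sets M = sets borel" "sets N = sets borel" by fact+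
  have cov: "\<exists>n. dist x0 x < real (Suc n)" for x
  proof -
    obtain n where "dist x0 x < real n" using reals_Archimedean2 by blast
    then show ?thesis by (intro exI[of _ n]) simp
  qed
  have sf: "sigma_finite_measure K" if "sets K = sets borel" "\<And>x r. x \<in> S \<Longrightarrow> r \<in> \<rat> \<Longrightarrow> r > 0 \<Longrightarrow> emeasure K (ball x r) = h r" for K
  proof
    show "\<exists>A. countable A \<and> A \<subseteq> sets K \<and> \<Union>A = space K \<and> (\<forall>a\<in>A. emeasure K a \<noteq> \<infinity>)"
      using that h S cov sets_eq_imp_space_eq[OF that(1)]
      by (intro exI[of _ "range (\<lambda>n. ball x0 (real (Suc n)))"]) (auto simp: ball_def)
  qed
  show ?thesis
  proof (cases "\<forall>r\<in>\<rat>. r > 0 \<longrightarrow> h r \<noteq> 0")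
    case True
    have eq: "emeasure M U = emeasure N U" if "open U" for U
      using uniform_balls_open_le[OF sM sN sf[OF sM M] sf[OF sN N] M N AM AN _ h that]
        uniform_balls_open_le[OF sN sM sf[OF sN N] sf[OF sM M] N M AN AM _ h that] True by force
    show ?thesis
    proof (rule measure_eqI_generator_eq[where E="{U. open U}" and \<Omega>=UNIV and A="\<lambda>n. ball x0 (real (Suc n))"])
      show "Int_stable {U::'a set. open U}" by (auto simp: Int_stable_def)
      show "sets M = sigma_sets UNIV {U. open U}" "sets N = sigma_sets UNIV {U. open U}"
        using sM sN by (simp_all add: borel_def)
      show "(\<Union>n. ball x0 (real (Suc n))) = UNIV" using cov by auto
    qed (use eq M[OF S] h in auto)
  next
    case False
    then obtain r where r: "r \<in> \<rat>" "r > 0" "h r = 0" by auto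
    have null: "emeasure K UNIV = 0" if K: "sets K = sets borel" "\<And>x r. x \<in> S \<Longrightarrow> r \<in> \<rat> \<Longrightarrow> r > 0 \<Longrightarrow> emeasure K (ball x r) = h r"
      "AE x in K. x \<in> S" for K
    proof -
      obtain F' where F': "F' \<subseteq> (\<lambda>x. ball x r) ` S" "countable F'" "\<Union>F' = \<Union>((\<lambda>x. ball x r) ` S)"
        using Lindelof[of "(\<lambda>x. ball x r) ` S"] by auto
      have "\<Union>F' \<in> null_sets K"
        using F' K r by (intro null_sets_UN'[where N="\<lambda>x. x", simplified]) (auto simp: null_sets_def)
      then have "AE x in K. x \<notin> \<Union>F'" by (rule AE_not_in)
      then have "AE x in K. False" using K(3)
        by eventually_elim (use r F' in auto)
      then show ?thesis
        using K(1) sets_eq_imp_space_eq[OF K(1)] by (simp add: AE_iff_measurable[where N=UNIV])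
    qed
    show ?thesis
    proof (rule measure_eqI)
      fix A assume "A \<in> sets M"
      have "emeasure M A \<le> emeasure M UNIV" "emeasure N A \<le> emeasure N UNIV"
        by (auto intro!: emeasure_mono simp: sM sN)
      then show "emeasure M A = emeasure N A"
        using null[OF sM M AM] null[OF sN N AN] by simp
    qed (simp add: sM sN)
  qed
qed

text \<open>Two probability measures need not share the radius function in advance: integrating the
  indicator of \<open>dist x y < r\<close> over the product of M and N in the two orders yields the
  N-mass and the M-mass of a ball of radius r.\<close>

lemma uniform_balls_unique_prob:
  fixes M N :: "'a::{metric_space, second_countable_topology} measure"
  assumes sM: "sets M = sets borel" and sN: "sets N = sets borel"
    and pM: "prob_space M" and pN: "prob_space N"
    and M: "\<And>x y r. x \<in> S \<Longrightarrow> y \<in> S \<Longrightarrow> r \<in> \<rat> \<Longrightarrow> emeasure M (ball x r) = emeasure M (ball y r)"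
    and N: "\<And>x y r. x \<in> S \<Longrightarrow> y \<in> S \<Longrightarrow> r \<in> \<rat> \<Longrightarrow> emeasure N (ball x r) = emeasure N (ball y r)"
    and AM: "AE x in M. x \<in> S" and AN: "AE x in N. x \<in> S"
  shows "M = N"
proof -
  interpret M: prob_space M by fact
  interpret N: prob_space N by fact
  interpret P: pair_sigma_finite M N by standard
  have [measurable_cong]: "sets M = sets borel" "sets N = sets borel" by fact+
  have "S \<noteq> {}" using AM M.AE_False by auto
  then obtain x0 where x0: "x0 \<in> S" by auto
  have eq: "emeasure M (ball x0 r) = emeasure N (ball x0 r)" if r: "r \<in> \<rat>" for r
  proof -
    define F where "F x y = (indicator {p. dist (fst p) (snd p) < r} (x, y) :: ennreal)" for x y :: 'a
    have "open {p::'a\<times>'a. dist (fst p) (snd p) < r}"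
      by (intro open_Collect_less continuous_intros)
    then have "(indicator {p::'a\<times>'a. dist (fst p) (snd p) < r} :: _ \<Rightarrow> ennreal) \<in> borel_measurable borel"
      by (intro borel_measurable_indicator) auto
    then have Fm: "(\<lambda>(x,y). F x y) \<in> borel_measurable (M \<Otimes>\<^sub>M N)"
      unfolding F_def by (simp add: borel_prod[symmetric] cong: measurable_cong_sets)
    have "emeasure N (ball x0 r) = (\<integral>\<^sup>+x. emeasure N (ball x0 r) \<partial>M)"
      by (simp add: M.emeasure_space_1)
    also have "\<dots> = (\<integral>\<^sup>+x. (\<integral>\<^sup>+y. F x y \<partial>N) \<partial>M)"
    proof (rule nn_integral_cong_AE, use AM in eventually_elim)
      fix x assume "x \<in> S"
      have "(\<integral>\<^sup>+y. F x y \<partial>N) = (\<integral>\<^sup>+y. indicator (ball x r) y \<partial>N)"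
        by (intro nn_integral_cong) (auto simp: F_def split: split_indicator)
      then show "emeasure N (ball x0 r) = (\<integral>\<^sup>+y. F x y \<partial>N)" using N[OF x0 \<open>x \<in> S\<close> r] by simp
    qed
    also have "\<dots> = (\<integral>\<^sup>+y. (\<integral>\<^sup>+x. F x y \<partial>M) \<partial>N)" using P.Fubini'[OF Fm] by simp
    also have "\<dots> = (\<integral>\<^sup>+y. emeasure M (ball x0 r) \<partial>N)"
    proof (rule nn_integral_cong_AE, use AN in eventually_elim)
      fix y assume "y \<in> S"
      have "(\<integral>\<^sup>+x. F x y \<partial>M) = (\<integral>\<^sup>+x. indicator (ball y r) x \<partial>M)"
        by (intro nn_integral_cong) (auto simp: F_def dist_commute split: split_indicator)
      then show "(\<integral>\<^sup>+x. F x y \<partial>M) = emeasure M (ball x0 r)" using M[OF x0 \<open>y \<in> S\<close> r] by simp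
    qed
    also have "\<dots> = emeasure M (ball x0 r)" by (simp add: N.emeasure_space_1)
    finally show ?thesis by simp
  qed
  show ?thesis
  proof (rule uniform_balls_unique[where S=S and h="\<lambda>r. emeasure M (ball x0 r)"])
    show "emeasure M (ball x r) = emeasure M (ball x0 r)" if "x \<in> S" "r \<in> \<rat>" for x r
      by (rule M[OF that(1) x0 that(2)])
    show "emeasure N (ball x r) = emeasure M (ball x0 r)" if "x \<in> S" "r \<in> \<rat>" for x r
      unfolding eq[OF that(2)] by (rule N[OF that(1) x0 that(2)])
  qed (use x0 AM AN sM sN in auto)
qed

subsection \<open>Orthonormal families\<close>

text \<open>Sequences of which only the first d members count: coordinates then live in products
  over \<open>{..<d}\<close>, and a basis of a subspace can be an initial segment of a basis of the
  whole space.\<close>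

definition orthonormal_family :: "nat \<Rightarrow> (nat \<Rightarrow> fseq) \<Rightarrow> bool" where
  "orthonormal_family d b \<longleftrightarrow> (\<forall>i<d. \<forall>j<d. b i \<bullet> b j = (if i = j then 1 else 0))"

definition orthonormal_basis :: "fseq set \<Rightarrow> nat \<Rightarrow> (nat \<Rightarrow> fseq) \<Rightarrow> bool" where
  "orthonormal_basis V d b \<longleftrightarrow> orthonormal_family d b \<and> span (b ` {..<d}) = V"

definition lincomb :: "nat \<Rightarrow> (nat \<Rightarrow> fseq) \<Rightarrow> (nat \<Rightarrow> real) \<Rightarrow> fseq" where
  "lincomb d b x = (\<Sum>i<d. x i *\<^sub>R b i)"

abbreviation proj_family :: "nat \<Rightarrow> (nat \<Rightarrow> fseq) \<Rightarrow> fseq \<Rightarrow> fseq" where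
  "proj_family d b x \<equiv> lincomb d b (\<lambda>i. x \<bullet> b i)"

lemma orthonormal_familyD:
  "orthonormal_family d b \<Longrightarrow> i < d \<Longrightarrow> j < d \<Longrightarrow> b i \<bullet> b j = (if i = j then 1 else 0)"
  by (simp add: orthonormal_family_def)

lemma orthonormal_family_mono: "orthonormal_family d b \<Longrightarrow> k \<le> d \<Longrightarrow> orthonormal_family k b"
  by (simp add: orthonormal_family_def)

lemma orthonormal_basis_family: "orthonormal_basis V d b \<Longrightarrow> orthonormal_family d b"
  by (simp add: orthonormal_basis_def)

lemma orthonormal_basis_subspace: "orthonormal_basis V d b \<Longrightarrow> subspace V"
  by (auto simp: orthonormal_basis_def)

lemma orthonormal_basis_mem: "orthonormal_basis V d b \<Longrightarrow> i < d \<Longrightarrow> b i \<in> V"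
  by (auto simp: orthonormal_basis_def intro: span_base)

lemma lincomb_in_span: "lincomb d b x \<in> span (b ` {..<d})"
  unfolding lincomb_def by (intro span_sum span_scale span_base) auto

lemma lincomb_mem: "orthonormal_basis V d b \<Longrightarrow> lincomb d b x \<in> V"
  using lincomb_in_span by (auto simp: orthonormal_basis_def)

lemma lincomb_cong: "(\<And>i. i < d \<Longrightarrow> b i = b' i) \<Longrightarrow> (\<And>i. i < d \<Longrightarrow> x i = x' i) \<Longrightarrow> lincomb d b x = lincomb d b' x'"
  by (simp add: lincomb_def)

lemma inner_lincomb_left: "lincomb d b x \<bullet> y = (\<Sum>i<d. x i * (b i \<bullet> y))"
  by (simp add: lincomb_def inner_sum_left)

lemma inner_lincomb:
  assumes "orthonormal_family d b" "j < d"
  shows "lincomb d b x \<bullet> b j = x j"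
proof -
  have "lincomb d b x \<bullet> b j = (\<Sum>i<d. if i = j then x i else 0)"
    unfolding inner_lincomb_left by (intro sum.cong) (auto simp: orthonormal_familyD[OF assms(1) _ assms(2)])
  then show ?thesis using assms(2) by simp
qed

lemma inner_lincomb_lincomb:
  assumes "orthonormal_family d b"
  shows "lincomb d b x \<bullet> lincomb d b y = (\<Sum>i<d. x i * y i)"
  unfolding inner_lincomb_left
  by (intro sum.cong) (simp_all add: inner_commute[of _ "lincomb d b y"] inner_lincomb[OF assms])

lemma norm_lincomb_sq:
  assumes "orthonormal_family d b"
  shows "(norm (lincomb d b x))\<^sup>2 = (\<Sum>i<d. (x i)\<^sup>2)"
  by (simp add: power2_norm_eq_inner inner_lincomb_lincomb[OF assms]) (simp add: power2_eq_square)

lemma norm_lincomb: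
  "orthonormal_family d b \<Longrightarrow> norm (lincomb d b x) = sqrt (\<Sum>i<d. (x i)\<^sup>2)"
  by (simp flip: norm_lincomb_sq)

lemma lincomb_add: "lincomb d b (\<lambda>i. x i + y i) = lincomb d b x + lincomb d b y"
  by (simp add: lincomb_def scaleR_add_left sum.distrib)

lemma lincomb_diff: "lincomb d b (\<lambda>i. x i - y i) = lincomb d b x - lincomb d b y"
  by (simp add: lincomb_def scaleR_diff_left sum_subtractf)

lemma lincomb_scale: "lincomb d b (\<lambda>i. c * x i) = c *\<^sub>R lincomb d b x"
  by (simp add: lincomb_def scaleR_sum_right)

lemma linear_proj_family: "linear (proj_family d b)"
  by (rule linearI) (simp_all add: inner_add_left lincomb_add lincomb_scale)

lemma proj_family_orthogonal:
  assumes "orthonormal_basis V d b" "y \<in> V"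
  shows "(x - proj_family d b x) \<bullet> y = 0"
proof -
  have "y \<in> span (b ` {..<d})" using assms by (simp add: orthonormal_basis_def)
  then show ?thesis
  proof (rule span_induct)
    show "subspace {y. (x - proj_family d b x) \<bullet> y = 0}"
      by (auto simp: subspace_def inner_add_right)
  qed (use assms in \<open>auto simp: inner_diff_left inner_lincomb orthonormal_basis_def\<close>)
qed

lemma orthonormal_basis_expand:
  assumes "orthonormal_basis V d b" "x \<in> V"
  shows "proj_family d b x = x"
proof -
  have "x - proj_family d b x \<in> V"
    using assms by (intro subspace_diff orthonormal_basis_subspace lincomb_mem)
  then have "(x - proj_family d b x) \<bullet> (x - proj_family d b x) = 0"
    by (rule proj_family_orthogonal[OF assms(1)])
  then show ?thesis by simp
qed

lemma orthonormal_basis_parseval: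
  assumes "orthonormal_basis V d b" "x \<in> V"
  shows "x \<bullet> y = (\<Sum>i<d. (x \<bullet> b i) * (b i \<bullet> y))"
  by (subst orthonormal_basis_expand[OF assms, symmetric]) (rule inner_lincomb_left)

lemma norm_proj_family_sq:
  assumes "orthonormal_family d b"
  shows "(norm (proj_family d b x))\<^sup>2 = (\<Sum>i<d. (x \<bullet> b i)\<^sup>2)"
  by (rule norm_lincomb_sq[OF assms])

lemma norm_proj_pythagoras:
  assumes "orthonormal_basis V d b"
  shows "(norm x)\<^sup>2 = (norm (proj_family d b x))\<^sup>2 + (norm (x - proj_family d b x))\<^sup>2"
proof -
  have "(x - proj_family d b x) \<bullet> proj_family d b x = 0"
    by (rule proj_family_orthogonal[OF assms lincomb_mem[OF assms]])
  then show ?thesis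
    by (simp add: power2_norm_eq_inner inner_diff_left inner_diff_right inner_commute)
qed

lemma orth_proj_eqI:
  assumes "subspace V" "y \<in> V" "\<And>v. v \<in> V \<Longrightarrow> (x - y) \<bullet> v = 0"
  shows "orth_proj V x = y"
  unfolding orth_proj_def
proof (rule the_equality)
  show "y \<in> V \<and> x - y \<in> orthogonal_comp V"
    using assms by (auto simp: orthogonal_comp_def orthogonal_def inner_commute)
next
  fix z assume z: "z \<in> V \<and> x - z \<in> orthogonal_comp V"
  then have "z - y \<in> V" using assms by (auto intro: subspace_diff)
  then have "(x - y) \<bullet> (z - y) = 0" "(x - z) \<bullet> (z - y) = 0"
    using z assms(3)[of "z - y"] by (auto simp: orthogonal_comp_def orthogonal_def inner_commute[of _ "x - z"])
  then have "(z - y) \<bullet> (z - y) = 0" by (simp add: inner_diff_left)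
  then show "z = y" by simp
qed

lemma orth_proj_eq:
  assumes "orthonormal_basis V d b"
  shows "orth_proj V x = proj_family d b x"
  using assms by (intro orth_proj_eqI orthonormal_basis_subspace lincomb_mem proj_family_orthogonal)

lemma orthonormal_family_independent:
  assumes "orthonormal_family d b"
  shows "inj_on b {..<d}" "independent (b ` {..<d})"
proof -
  show "inj_on b {..<d}"
    using assms by (intro inj_onI) (metis lessThan_iff orthonormal_familyD zero_neq_one)
  have "0 \<notin> b ` {..<d}" using orthonormal_familyD[OF assms] by fastforce
  moreover have "pairwise orthogonal (b ` {..<d})"
    using orthonormal_familyD[OF assms] by (auto simp: pairwise_def orthogonal_def)
  ultimately show "independent (b ` {..<d})" by (intro pairwise_orthogonal_independent)
qed

lemma orthonormal_basis_dim: "orthonormal_basis V d b \<Longrightarrow> dim V = d"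
  using orthonormal_family_independent[of d b]
  by (auto simp: orthonormal_basis_def dim_eq_card_independent card_image)

lemma orthonormal_family_le:
  assumes "orthonormal_family k b" "b ` {..<k} \<subseteq> Euclid n"
  shows "k \<le> n"
proof -
  have "card (b ` {..<k}) \<le> card (unit_fseq ` {..<n})"
    using independent_span_bound[OF _ orthonormal_family_independent(2)[OF assms(1)], of "unit_fseq ` {..<n}"]
      assms(2) by (simp add: Euclid_eq_span)
  also have "\<dots> \<le> n" using card_image_le[of "{..<n}" unit_fseq] by simp
  finally show ?thesis
    using orthonormal_family_independent(1)[OF assms(1)] by (simp add: card_image)
qed

lemma orthonormal_family_extend_step:
  assumes W: "subspace W" and b: "orthonormal_family k b" "b ` {..<k} \<subseteq> W"
    and ne: "span (b ` {..<k}) \<noteq> W"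
  shows "\<exists>u\<in>W. orthonormal_family (Suc k) (b(k := u))"
proof -
  have "span (b ` {..<k}) \<subseteq> W" using b W by (intro span_minimal)
  then obtain v where v: "v \<in> W" "v \<notin> span (b ` {..<k})" using ne by blast
  define w where "w = v - proj_family k b v"
  have w: "w \<in> W" "w \<noteq> 0" "\<And>i. i < k \<Longrightarrow> w \<bullet> b i = 0"
    using v lincomb_in_span[of k b "\<lambda>i. v \<bullet> b i"] \<open>span (b ` {..<k}) \<subseteq> W\<close> W b(1)
    by (auto simp: w_def subspace_diff inner_diff_left inner_lincomb)
  have "orthonormal_family (Suc k) (b(k := w /\<^sub>R norm w))"
    using b(1) w by (auto simp: orthonormal_family_def less_Suc_eq inner_commute[of "b _" w]
      divide_simps power2_eq_square simp flip: power2_norm_eq_inner)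
  then show ?thesis using w W by (intro bexI[of _ "w /\<^sub>R norm w"]) (auto simp: subspace_scale)
qed

text \<open>Iterated Gram-Schmidt. The ambient space has infinite dimension, so termination rests on
  W lying in \<open>Euclid n\<close>: by \<open>orthonormal_family_le\<close> no family there is
  longer than n, and n - k decreases. Keeping the given first vectors is the point; it yields bases
  adapted to a vector, to a subspace or to projected directions.\<close>

lemma orthonormal_family_extend:
  assumes "subspace W" "W \<subseteq> Euclid n" "orthonormal_family k b" "b ` {..<k} \<subseteq> W"
  shows "\<exists>d b'. k \<le> d \<and> orthonormal_basis W d b' \<and> (\<forall>i<k. b' i = b i)"
  using assms(3,4)
proof (induction "n - k" arbitrary: k b rule: less_induct)
  case less
  show ?case
  proof (cases "span (b ` {..<k}) = W")
    case True
    then show ?thesis using less.prems by (intro exI[of _ k] exI[of _ b]) (simp add: orthonormal_basis_def)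
  next
    case False
    obtain u where u: "u \<in> W" "orthonormal_family (Suc k) (b(k := u))"
      using orthonormal_family_extend_step[OF assms(1) less.prems False] by blast
    have sub: "(b(k := u)) ` {..<Suc k} \<subseteq> W" using u less.prems by (auto simp: less_Suc_eq)
    have "Suc k \<le> n" using orthonormal_family_le[OF u(2)] sub assms(2) by blast
    then obtain d b' where "Suc k \<le> d" "orthonormal_basis W d b'" "\<forall>i<Suc k. b' i = (b(k := u)) i"
      using less.hyps[OF _ u(2) sub] by (metis Suc_le_eq diff_less_mono2 lessI)
    then show ?thesis by (intro exI[of _ d] exI[of _ b']) auto
  qed
qed

lemma orthonormal_basis_exists:
  assumes "subspace W" "W \<subseteq> Euclid n"
  shows "\<exists>b. orthonormal_basis W (dim W) b"
  using orthonormal_family_extend[OF assms, of 0 undefined] orthonormal_basis_dim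
  by (force simp: orthonormal_family_def)

lemma orthonormal_basis_unit: "orthonormal_basis (Euclid n) n unit_fseq"
  by (auto simp: orthonormal_basis_def orthonormal_family_def Euclid_eq_span
      simp flip: coord_eq_inner) (auto simp: coord_unit_fseq)

text \<open>One sequence serves both spaces: its first m members span V and, by
  \<open>orthonormal_basis_complement\<close>, the others span the complement. Projecting onto V
  then means discarding coordinates.\<close>

lemma orthonormal_basis_extend_Euclid:
  assumes "orthonormal_basis V m b" "V \<subseteq> Euclid n"
  shows "\<exists>b'. orthonormal_basis (Euclid n) n b' \<and> orthonormal_basis V m b' \<and> (\<forall>i<m. b' i = b i) \<and> m \<le> n"
proof -
  have sub: "b ` {..<m} \<subseteq> Euclid n" using assms orthonormal_basis_mem by blast
  obtain d b' where *: "m \<le> d" "orthonormal_basis (Euclid n) d b'" "\<forall>i<m. b' i = b i"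
    using orthonormal_family_extend[OF subspace_Euclid subset_refl orthonormal_basis_family[OF assms(1)] sub]
    by blast
  have "d = n" using orthonormal_basis_dim[OF *(2)] by (simp add: dim_Euclid)
  moreover have "b' ` {..<m} = b ` {..<m}" using * by auto
  then have "orthonormal_basis V m b'"
    using *(1) orthonormal_family_mono[OF orthonormal_basis_family[OF *(2)], of m] assms(1)
    by (auto simp: orthonormal_basis_def)
  ultimately show ?thesis using * by auto
qed

lemma orthonormal_basis_complement:
  assumes b: "orthonormal_basis (Euclid n) n b" "orthonormal_basis H m b" "m \<le> n"
  shows "orthonormal_basis (orthogonal_comp H \<inter> Euclid n) (n - m) (\<lambda>i. b (m + i))"
proof -
  note F = orthonormal_basis_family[OF b(1)]
  have "(\<lambda>i. b (m + i)) ` {..<n - m} \<subseteq> orthogonal_comp H \<inter> Euclid n"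
  proof safe
    fix i assume i: "i < n - m"
    then show "b (m + i) \<in> Euclid n" by (intro orthonormal_basis_mem[OF b(1)]) simp
    show "b (m + i) \<in> orthogonal_comp H"
      unfolding orthogonal_comp_def orthogonal_def
    proof safe
      fix y assume "y \<in> H"
      then have "y \<in> span (b ` {..<m})" using b(2) by (simp add: orthonormal_basis_def)
      then show "y \<bullet> b (m + i) = 0"
        by (rule span_induct) (use i orthonormal_familyD[OF F] in \<open>auto simp: subspace_def inner_add_left\<close>)
    qed
  qed
  moreover have "subspace (orthogonal_comp H \<inter> Euclid n)"
    by (intro subspace_inter subspace_orthogonal_comp subspace_Euclid)
  ultimately have "span ((\<lambda>i. b (m + i)) ` {..<n - m}) \<subseteq> orthogonal_comp H \<inter> Euclid n"
    by (intro span_minimal)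
  moreover have "x \<in> span ((\<lambda>i. b (m + i)) ` {..<n - m})" if x: "x \<in> orthogonal_comp H" "x \<in> Euclid n" for x
  proof -
    have "x \<bullet> b i = 0" if "i < m" for i
      using x(1) orthonormal_basis_mem[OF b(2) that]
      by (auto simp: orthogonal_comp_def orthogonal_def inner_commute)
    then have "(\<Sum>i<n. (x \<bullet> b i) *\<^sub>R b i) = (\<Sum>i\<in>{m..<n}. (x \<bullet> b i) *\<^sub>R b i)"
      by (intro sum.mono_neutral_right) (auto simp: not_less)
    also have "\<dots> = (\<Sum>i<n-m. (x \<bullet> b (m+i)) *\<^sub>R b (m+i))"
      using b(3) by (intro sum.reindex_bij_witness[of _ "\<lambda>i. m + i" "\<lambda>i. i - m"]) auto
    finally have "x = (\<Sum>i<n-m. (x \<bullet> b (m+i)) *\<^sub>R b (m+i))"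
      using orthonormal_basis_expand[OF b(1) x(2)] by (simp add: lincomb_def)
    also have "\<dots> \<in> span ((\<lambda>i. b (m + i)) ` {..<n - m})"
      by (intro span_sum span_scale span_base) auto
    finally show ?thesis .
  qed
  moreover have "orthonormal_family (n - m) (\<lambda>i. b (m + i))"
    using F by (auto simp: orthonormal_family_def)
  ultimately show ?thesis by (auto simp: orthonormal_basis_def)
qed

lemma orth_proj_complement:
  assumes b: "orthonormal_basis (Euclid n) n b" "orthonormal_basis H m b" "m \<le> n" and x: "x \<in> Euclid n"
  shows "orth_proj (orthogonal_comp H \<inter> Euclid n) x = x - orth_proj H x"
proof (rule orth_proj_eqI)
  show "subspace (orthogonal_comp H \<inter> Euclid n)"
    by (intro subspace_inter subspace_orthogonal_comp subspace_Euclid)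
  have sub: "H \<subseteq> Euclid n"
  proof -
    have "b ` {..<m} \<subseteq> Euclid n" using orthonormal_basis_mem[OF b(1)] b(3) by auto
    then have "span (b ` {..<m}) \<subseteq> Euclid n" by (rule span_minimal[OF _ subspace_Euclid])
    then show ?thesis using b(2) by (simp add: orthonormal_basis_def)
  qed
  then show "x - orth_proj H x \<in> orthogonal_comp H \<inter> Euclid n"
    using x lincomb_mem[OF b(2)] proj_family_orthogonal[OF b(2)]
    by (auto simp: orth_proj_eq[OF b(2)] orthogonal_comp_def orthogonal_def inner_commute
        intro!: subspace_diff[OF subspace_Euclid])
  show "(x - (x - orth_proj H x)) \<bullet> v = 0" if "v \<in> orthogonal_comp H \<inter> Euclid n" for v
    using that lincomb_mem[OF b(2)] by (auto simp: orth_proj_eq[OF b(2)] orthogonal_comp_def orthogonal_def)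
qed

section \<open>Orthogonal transformations acting on bases and projections\<close>

lemma linear_lincomb_image: "linear g \<Longrightarrow> g (lincomb d b x) = lincomb d (\<lambda>i. g (b i)) x"
  by (simp add: lincomb_def linear_sum linear_scale)

lemma orthogonal_transformation_family:
  "orthogonal_transformation g \<Longrightarrow> orthonormal_family d b \<Longrightarrow> orthonormal_family d (\<lambda>i. g (b i))"
  by (simp add: orthogonal_transformation_def orthonormal_family_def)

lemma orthogonal_transformation_basis:
  assumes "orthogonal_transformation g" "orthonormal_basis V d b"
  shows "orthonormal_basis (g ` V) d (\<lambda>i. g (b i))"
  using assms linear_span_image[of g "b ` {..<d}"] orthogonal_transformation_family[OF assms(1)]
  by (auto simp: orthonormal_basis_def image_image orthogonal_transformation_linear)

lemma orth_proj_image: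
  assumes "orthogonal_transformation g" "orthonormal_basis V d b"
  shows "orth_proj (g ` V) (g x) = g (orth_proj V x)"
  using assms
  by (simp add: orth_proj_eq[OF assms(2)] orth_proj_eq[OF orthogonal_transformation_basis[OF assms]]
      linear_lincomb_image orthogonal_transformation_linear) (simp add: orthogonal_transformation_def)

text \<open>The map keeps the residual of x, which is orthogonal to V, and transfers the coordinates
  of x from b to b'. It is therefore an isometry of the whole sequence space, as the definitions of
  invariance require, and not merely one of V.\<close>

lemma orthogonal_transformation_exists:
  assumes b: "orthonormal_basis V d b" and b': "orthonormal_basis V d b'"
  shows "\<exists>g. orthogonal_transformation g \<and> (\<forall>i<d. g (b i) = b' i) \<and> g ` V = V"
proof -
  note F = orthonormal_basis_family[OF b] and F' = orthonormal_basis_family[OF b']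
  define g where "g x = (x - proj_family d b x) + lincomb d b' (\<lambda>i. x \<bullet> b i)" for x
  have lin: "linear g"
    by (rule linearI)
      (simp_all add: g_def inner_add_left lincomb_add lincomb_scale algebra_simps)
  have inn: "g x \<bullet> g y = x \<bullet> y" for x y
  proof -
    let ?p = "proj_family d b" and ?q = "\<lambda>x. lincomb d b' (\<lambda>i. x \<bullet> b i)"
    have "?q x \<in> V" "?q y \<in> V" "?p x \<in> V" "?p y \<in> V"
      using lincomb_mem[OF b] lincomb_mem[OF b'] by auto
    then have o: "(x - ?p x) \<bullet> ?q y = 0" "(y - ?p y) \<bullet> ?q x = 0" "(x - ?p x) \<bullet> ?p y = 0" "(y - ?p y) \<bullet> ?p x = 0"
      using proj_family_orthogonal[OF b] by auto
    have "?q x \<bullet> ?q y = ?p x \<bullet> ?p y"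
      by (simp add: inner_lincomb_lincomb[OF F] inner_lincomb_lincomb[OF F'])
    moreover have "g x \<bullet> g y = (x - ?p x) \<bullet> (y - ?p y) + ?q x \<bullet> ?q y"
      using o by (simp add: g_def inner_add_left inner_add_right inner_commute)
    ultimately show ?thesis using o by (simp add: inner_diff_left inner_diff_right inner_commute)
  qed
  have gb: "g (b i) = b' i" if "i < d" for i
  proof -
    have "proj_family d b (b i) = b i"
      by (rule orthonormal_basis_expand[OF b orthonormal_basis_mem[OF b that]])
    moreover have "lincomb d b' (\<lambda>j. b i \<bullet> b j) = (\<Sum>j<d. if i = j then b' j else 0)"
      unfolding lincomb_def using that by (intro sum.cong) (auto simp: orthonormal_familyD[OF F])
    ultimately show ?thesis using that by (simp add: g_def)
  qed
  have "g ` V = span (g ` (b ` {..<d}))"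
    using linear_span_image[OF lin, of "b ` {..<d}"] b by (simp add: orthonormal_basis_def)
  also have "g ` (b ` {..<d}) = b' ` {..<d}" using gb by force
  finally show ?thesis using lin inn gb b'
    by (intro exI[of _ g]) (auto simp: orthogonal_transformation_def orthonormal_basis_def)
qed

subsection \<open>Gaussian measures\<close>

abbreviation lebesgue_prod :: "nat set \<Rightarrow> (nat \<Rightarrow> real) measure" where
  "lebesgue_prod I \<equiv> PiM I (\<lambda>_. lborel)"

abbreviation gaussian_prod :: "nat set \<Rightarrow> (nat \<Rightarrow> real) measure" where
  "gaussian_prod I \<equiv> PiM I (\<lambda>_. density lborel (\<lambda>x. ennreal (std_normal_density x)))"

interpretation lebesgue_prod: product_sigma_finite "\<lambda>_::nat. lborel :: real measure" by standard

interpretation std_normal: prob_space "density lborel (\<lambda>x. ennreal (std_normal_density x))"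
  by (rule prob_space_normal_density) simp

interpretation gaussian_prod: product_prob_space "\<lambda>_::nat. density lborel (\<lambda>x. ennreal (std_normal_density x))" UNIV
  by (unfold_locales)

lemma prob_space_gaussian_prod: "prob_space (gaussian_prod I)"
  by (rule prob_space_PiM) unfold_locales

text \<open>The rescaled image measure agrees with Lebesgue measure on boxes, where the
  one-dimensional substitution acts in each coordinate. Diagonal maps are enough for the
  translations and scalings below, and for the compressions once they are diagonalised.\<close>

lemma nn_integral_lebesgue_prod_affine:
  assumes I: "finite I" and c: "\<And>i. i \<in> I \<Longrightarrow> c i \<noteq> 0"
    and f [measurable]: "f \<in> borel_measurable (lebesgue_prod I)"
  shows "(\<integral>\<^sup>+x. f x \<partial>lebesgue_prod I)
    = (\<Prod>i\<in>I. ennreal \<bar>c i\<bar>) * (\<integral>\<^sup>+x. f (\<lambda>i\<in>I. t i + c i * x i) \<partial>lebesgue_prod I)"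
proof -
  define A where "A x = (\<lambda>i\<in>I. t i + c i * x i)" for x :: "nat \<Rightarrow> real"
  have A [measurable]: "A \<in> measurable (lebesgue_prod I) (lebesgue_prod I)"
    unfolding A_def by measurable
  have "density (distr (lebesgue_prod I) (lebesgue_prod I) A) (\<lambda>_. \<Prod>i\<in>I. ennreal \<bar>c i\<bar>) = lebesgue_prod I"
  proof (rule lebesgue_prod.PiM_eqI[OF I])
    fix B :: "nat \<Rightarrow> real set" assume B: "\<And>i. i \<in> I \<Longrightarrow> B i \<in> sets lborel"
    let ?C = "\<lambda>i. (\<lambda>x. t i + c i * x) -` B i"
    have C: "?C i \<in> sets borel" if "i \<in> I" for i
      using measurable_sets[of "\<lambda>x. t i + c i * x" borel borel "B i"] B[OF that] by simp
    have "A -` Pi\<^sub>E I B \<inter> space (lebesgue_prod I) = Pi\<^sub>E I ?C"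
      by (auto simp: A_def space_PiM PiE_iff)
    then have "emeasure (density (distr (lebesgue_prod I) (lebesgue_prod I) A) (\<lambda>_. \<Prod>i\<in>I. ennreal \<bar>c i\<bar>)) (Pi\<^sub>E I B)
       = (\<Prod>i\<in>I. ennreal \<bar>c i\<bar>) * emeasure (lebesgue_prod I) (Pi\<^sub>E I ?C)"
      using B I by (subst emeasure_density) (simp_all add: nn_integral_cmult_indicator emeasure_distr sets_PiM_I_finite)
    also have "\<dots> = (\<Prod>i\<in>I. ennreal \<bar>c i\<bar> * emeasure lborel (?C i))"
      using C I by (subst lebesgue_prod.emeasure_PiM) (auto simp: prod.distrib)
    also have "\<dots> = (\<Prod>i\<in>I. emeasure lborel (B i))"
    proof (rule prod.cong)
      fix i assume i: "i \<in> I"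
      have "emeasure lborel (B i) = (\<integral>\<^sup>+x. indicator (B i) x \<partial>lborel)" using B[OF i] by simp
      also have "\<dots> = ennreal \<bar>c i\<bar> * (\<integral>\<^sup>+x. indicator (B i) (t i + c i * x) \<partial>lborel)"
        using B[OF i] c[OF i] by (intro nn_integral_real_affine) auto
      also have "(\<integral>\<^sup>+x. indicator (B i) (t i + c i * x) \<partial>lborel) = (\<integral>\<^sup>+x. indicator (?C i) x \<partial>lborel)"
        by (intro nn_integral_cong) (auto split: split_indicator)
      also have "\<dots> = emeasure lborel (?C i)" using C[OF i] by simp
      finally show "ennreal \<bar>c i\<bar> * emeasure lborel (?C i) = emeasure lborel (B i)" ..
    qed simp
    finally show "emeasure (density (distr (lebesgue_prod I) (lebesgue_prod I) A) (\<lambda>_. \<Prod>i\<in>I. ennreal \<bar>c i\<bar>)) (Pi\<^sub>E I B)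
      = (\<Prod>i\<in>I. emeasure lborel (B i))" .
  qed simp
  then have "(\<integral>\<^sup>+x. f x \<partial>lebesgue_prod I)
    = (\<integral>\<^sup>+x. f x \<partial>density (distr (lebesgue_prod I) (lebesgue_prod I) A) (\<lambda>_. \<Prod>i\<in>I. ennreal \<bar>c i\<bar>))"
    by simp
  also have "\<dots> = (\<Prod>i\<in>I. ennreal \<bar>c i\<bar>) * (\<integral>\<^sup>+x. f (A x) \<partial>lebesgue_prod I)"
    by (subst nn_integral_density) (auto simp: nn_integral_distr nn_integral_cmult)
  finally show ?thesis by (simp add: A_def)
qed

lemma gaussian_prod_density:
  assumes I: "finite I"
  shows "gaussian_prod I = density (lebesgue_prod I)
    (\<lambda>x. ennreal ((1 / sqrt (2 * pi)) ^ card I * exp (- (\<Sum>i\<in>I. (x i)\<^sup>2) / 2)))"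
proof -
  have eq: "ennreal ((1 / sqrt (2 * pi)) ^ card I * exp (- (\<Sum>i\<in>I. (x i)\<^sup>2) / 2))
    = (\<Prod>i\<in>I. ennreal (std_normal_density (x i)))" for x :: "nat \<Rightarrow> real"
    using I by (simp add: std_normal_density_def prod_ennreal prod_dividef exp_sum[symmetric]
        sum_divide_distrib sum_negf power_divide)
  show ?thesis unfolding eq
  proof (rule gaussian_prod.PiM_eqI[OF I, symmetric])
    fix A :: "nat \<Rightarrow> real set" assume A: "\<And>i. i \<in> I \<Longrightarrow> A i \<in> sets (density lborel (\<lambda>x. ennreal (std_normal_density x)))"
    then have A': "Pi\<^sub>E I A \<in> sets (lebesgue_prod I)" using I by (intro sets_PiM_I_finite) auto
    have "emeasure (density (lebesgue_prod I) (\<lambda>x. \<Prod>i\<in>I. ennreal (std_normal_density (x i)))) (Pi\<^sub>E I A)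
      = (\<integral>\<^sup>+x. (\<Prod>i\<in>I. ennreal (std_normal_density (x i))) * indicator (Pi\<^sub>E I A) x \<partial>lebesgue_prod I)"
      using A' by (intro emeasure_density) auto
    also have "\<dots> = (\<integral>\<^sup>+x. (\<Prod>i\<in>I. ennreal (std_normal_density (x i)) * indicator (A i) (x i)) \<partial>lebesgue_prod I)"
      using I by (intro nn_integral_cong)
        (auto simp: prod.distrib space_PiM PiE_iff extensional_def split: split_indicator)
    also have "\<dots> = (\<Prod>i\<in>I. \<integral>\<^sup>+x. ennreal (std_normal_density x) * indicator (A i) x \<partial>lborel)"
      using I A by (intro lebesgue_prod.product_nn_integral_prod) auto
    also have "\<dots> = (\<Prod>i\<in>I. emeasure (density lborel (\<lambda>x. ennreal (std_normal_density x))) (A i))"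
      using A by (intro prod.cong refl) (subst emeasure_density, auto)
    finally show "emeasure (density (lebesgue_prod I) (\<lambda>x. \<Prod>i\<in>I. ennreal (std_normal_density (x i)))) (Pi\<^sub>E I A)
      = (\<Prod>i\<in>I. emeasure (density lborel (\<lambda>x. ennreal (std_normal_density x))) (A i))" .
  qed (simp cong: sets_PiM_cong)
qed

section \<open>Lebesgue and Gaussian measures on finite-dimensional subspaces\<close>

lemma measurable_lincomb_lebesgue [measurable]: "lincomb d b \<in> borel_measurable (lebesgue_prod {..<d})"
  unfolding lincomb_def by measurable

lemma measurable_lincomb_gaussian [measurable]: "lincomb d b \<in> borel_measurable (gaussian_prod {..<d})"
  unfolding lincomb_def by measurable

lemma borel_orthonormal_basis:
  assumes b: "orthonormal_basis V d b"
  shows "closed V" "V \<in> sets borel"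
proof -
  have "V = {x. proj_family d b x = x}"
    using orthonormal_basis_expand[OF b] lincomb_mem[OF b] by auto metis
  also have "closed \<dots>" unfolding lincomb_def by (intro closed_Collect_eq continuous_intros)
  finally show "closed V" .
  then show "V \<in> sets borel" by auto
qed

text \<open>Translating by the coordinates of x moves the centre to the origin. What matters is that
  the right-hand side mentions neither x nor the basis.\<close>

lemma distr_lebesgue_lincomb_ball:
  assumes b: "orthonormal_basis V d b" and x: "x \<in> V"
  shows "emeasure (distr (lebesgue_prod {..<d}) borel (lincomb d b)) (ball x r)
    = (\<integral>\<^sup>+u. indicator {u. sqrt (\<Sum>i<d. (u i)\<^sup>2) < r} u \<partial>lebesgue_prod {..<d})"
proof -
  note F = orthonormal_basis_family[OF b]
  let ?J = "\<lambda>u. indicator {u. sqrt (\<Sum>i<d. (u i)\<^sup>2) < r} u :: ennreal"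
  have J [measurable]: "?J \<in> borel_measurable (lebesgue_prod {..<d})" by measurable
  have "emeasure (distr (lebesgue_prod {..<d}) borel (lincomb d b)) (ball x r)
    = (\<integral>\<^sup>+u. indicator (ball x r) (lincomb d b u) \<partial>lebesgue_prod {..<d})"
    by (subst nn_integral_indicator[symmetric], simp, subst nn_integral_distr) (simp_all add: borel_measurable_indicator)
  also have "\<dots> = (\<integral>\<^sup>+u. ?J (\<lambda>i\<in>{..<d}. - (x \<bullet> b i) + 1 * u i) \<partial>lebesgue_prod {..<d})"
  proof (rule nn_integral_cong)
    fix u :: "nat \<Rightarrow> real"
    have "dist x (lincomb d b u) = norm (lincomb d b (\<lambda>i. u i - x \<bullet> b i))"
      by (simp add: lincomb_diff dist_norm norm_minus_commute orthonormal_basis_expand[OF b x])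
    then show "indicator (ball x r) (lincomb d b u) = ?J (\<lambda>i\<in>{..<d}. - (x \<bullet> b i) + 1 * u i)"
      by (auto simp: norm_lincomb[OF F] split: split_indicator)
  qed
  also have "\<dots> = (\<integral>\<^sup>+u. ?J u \<partial>lebesgue_prod {..<d})"
    using nn_integral_lebesgue_prod_affine[of "{..<d}" "\<lambda>_. 1" ?J "\<lambda>i. - (x \<bullet> b i)"] by simp
  finally show ?thesis .
qed

text \<open>Rotation invariance of Lebesgue measure without determinants: for either basis a ball
  centred in V has a mass that depends on d and the radius alone, so uniqueness for uniform balls
  identifies the two image measures.\<close>

lemma distr_lebesgue_lincomb_unique:
  assumes b: "orthonormal_basis V d b" and b': "orthonormal_basis V d b'"
  shows "distr (lebesgue_prod {..<d}) borel (lincomb d b) = distr (lebesgue_prod {..<d}) borel (lincomb d b')"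
proof (rule uniform_balls_unique[where S=V])
  show "0 \<in> V" using orthonormal_basis_subspace[OF b] by (rule subspace_0)
  show "emeasure (distr (lebesgue_prod {..<d}) borel (lincomb d b)) (ball x r)
    = (\<integral>\<^sup>+u. indicator {u. sqrt (\<Sum>i<d. (u i)\<^sup>2) < r} u \<partial>lebesgue_prod {..<d})" if "x \<in> V" for x r
    using distr_lebesgue_lincomb_ball[OF b that] .
  show "emeasure (distr (lebesgue_prod {..<d}) borel (lincomb d b')) (ball x r)
    = (\<integral>\<^sup>+u. indicator {u. sqrt (\<Sum>i<d. (u i)\<^sup>2) < r} u \<partial>lebesgue_prod {..<d})" if "x \<in> V" for x r
    using distr_lebesgue_lincomb_ball[OF b' that] .
  show "AE x in distr (lebesgue_prod {..<d}) borel (lincomb d b). x \<in> V"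
    "AE x in distr (lebesgue_prod {..<d}) borel (lincomb d b'). x \<in> V"
    using lincomb_mem[OF b] lincomb_mem[OF b'] borel_orthonormal_basis(2)[OF b] by (subst AE_distr_iff; simp)+
  fix r :: real assume r: "r > 0"
  have "(\<integral>\<^sup>+u. indicator {u. sqrt (\<Sum>i<d. (u i)\<^sup>2) < r} u \<partial>lebesgue_prod {..<d})
     \<le> (\<integral>\<^sup>+u. indicator (\<Pi>\<^sub>E i\<in>{..<d}. {-r..r}) u \<partial>lebesgue_prod {..<d})"
  proof (rule nn_integral_mono)
    fix u assume u: "u \<in> space (lebesgue_prod {..<d})"
    have "u i \<in> {-r..r}" if "sqrt (\<Sum>i<d. (u i)\<^sup>2) < r" "i < d" for i
    proof -
      have "\<bar>u i\<bar> = sqrt ((u i)\<^sup>2)" by simp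
      also have "\<dots> \<le> sqrt (\<Sum>i<d. (u i)\<^sup>2)"
        using that(2) by (intro real_sqrt_le_mono member_le_sum) auto
      finally show ?thesis using that by auto
    qed
    then show "indicator {u. sqrt (\<Sum>i<d. (u i)\<^sup>2) < r} u \<le> (indicator (\<Pi>\<^sub>E i\<in>{..<d}. {-r..r}) u :: ennreal)"
      using u by (auto simp: space_PiM PiE_iff split: split_indicator)
  qed
  also have "\<dots> = emeasure (lebesgue_prod {..<d}) (\<Pi>\<^sub>E i\<in>{..<d}. {-r..r})"
    by (intro nn_integral_indicator sets_PiM_I_finite) auto
  also have "\<dots> < \<infinity>"
    using r by (subst lebesgue_prod.emeasure_PiM) (auto simp: ennreal_power less_top[symmetric])
  finally show "(\<integral>\<^sup>+u. indicator {u. sqrt (\<Sum>i<d. (u i)\<^sup>2) < r} u \<partial>lebesgue_prod {..<d}) \<noteq> \<infinity>" by simp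
qed simp_all

text \<open>The standard Gaussian measure of V, carried by the Borel sets of the whole sequence
  space so that Gaussians of different subspaces can be compared and mapped to each other. The basis
  chosen by \<open>SOME\<close> is immaterial by \<open>gauss_on_eq\<close>.\<close>

definition gauss_on :: "fseq set \<Rightarrow> fseq measure" where
  "gauss_on V = distr (gaussian_prod {..<dim V}) borel
     (lincomb (dim V) (SOME b. orthonormal_basis V (dim V) b))"

lemma sets_gauss_on [simp, measurable_cong]: "sets (gauss_on V) = sets borel"
  and space_gauss_on [simp]: "space (gauss_on V) = UNIV"
  by (simp_all add: gauss_on_def)

lemma prob_space_gauss_on: "prob_space (gauss_on V)"
  unfolding gauss_on_def by (intro prob_space.prob_space_distr prob_space_gaussian_prod) simp

text \<open>Rotation invariance of Lebesgue measure carries over, as the Gaussian density is a function of the norm.\<close>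

lemma gauss_on_eq:
  assumes b: "orthonormal_basis V d b"
  shows "gauss_on V = distr (gaussian_prod {..<d}) borel (lincomb d b)"
proof -
  define D where "D y = ennreal ((1 / sqrt (2 * pi)) ^ d * exp (- (norm y)\<^sup>2 / 2))" for y :: fseq
  have D [measurable]: "D \<in> borel_measurable borel" unfolding D_def by measurable
  have *: "distr (gaussian_prod {..<d}) borel (lincomb d b)
      = density (distr (lebesgue_prod {..<d}) borel (lincomb d b)) D"
    if b: "orthonormal_basis V d b" for b
    by (simp add: density_distr gaussian_prod_density D_def norm_lincomb_sq[OF orthonormal_basis_family[OF b]])
  have "orthonormal_basis V d (SOME b. orthonormal_basis V d b)" using someI_ex[of "orthonormal_basis V d"] b by blast
  from *[OF this] *[OF b] distr_lebesgue_lincomb_unique[OF this b] show ?thesis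
    by (simp add: gauss_on_def orthonormal_basis_dim[OF b])
qed

lemma borel_measurable_orthogonal_transformation:
  assumes "orthogonal_transformation (g :: fseq \<Rightarrow> fseq)"
  shows "g \<in> borel_measurable borel"
proof -
  have "bounded_linear g"
    using assms by (intro bounded_linear_intro[of g 1])
      (auto simp: linear_add linear_scale orthogonal_transformation_linear orthogonal_transformation_norm)
  then show ?thesis by (intro borel_measurable_continuous_onI linear_continuous_on)
qed

lemma distr_gauss_on_orthogonal:
  assumes b: "orthonormal_basis V d b" and g: "orthogonal_transformation g"
  shows "distr (gauss_on V) borel g = gauss_on (g ` V)"
proof -
  note [measurable] = borel_measurable_orthogonal_transformation[OF g]
  have "distr (gauss_on V) borel g = distr (gaussian_prod {..<d}) borel (g \<circ> lincomb d b)"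
    by (simp add: gauss_on_eq[OF b] distr_distr)
  also have "g \<circ> lincomb d b = lincomb d (\<lambda>i. g (b i))"
    by (auto simp: linear_lincomb_image[OF orthogonal_transformation_linear[OF g]])
  finally show ?thesis by (simp add: gauss_on_eq[OF orthogonal_transformation_basis[OF g b]])
qed

lemma AE_gaussian_prod_component:
  assumes "finite I" "i \<in> I"
  shows "AE x in gaussian_prod I. x i \<noteq> (0::real)"
proof (rule AE_I)
  let ?A = "\<lambda>j. if j = i then {0} else (UNIV::real set)"
  show "{x \<in> space (gaussian_prod I). \<not> x i \<noteq> 0} \<subseteq> Pi\<^sub>E I ?A"
    by (auto simp: space_PiM PiE_iff extensional_def)
  show "Pi\<^sub>E I ?A \<in> sets (gaussian_prod I)" using assms by (intro sets_PiM_I_finite) auto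
  have "emeasure (density lborel (\<lambda>x. ennreal (std_normal_density x))) {0} = 0"
    by (subst emeasure_density) (auto simp: nn_integral_0_iff_AE intro!: AE_I[where N="{0}"] split: split_indicator)
  then show "emeasure (gaussian_prod I) (Pi\<^sub>E I ?A) = 0"
    using assms by (subst gaussian_prod.emeasure_PiM) (auto intro!: bexI[of _ i])
qed

lemma AE_gauss_on_inner:
  assumes "orthonormal_basis V d b" "i < d"
  shows "AE x in gauss_on V. x \<bullet> b i \<noteq> 0"
  unfolding gauss_on_eq[OF assms(1)] using AE_gaussian_prod_component[of "{..<d}" i] assms(2)
  by (subst AE_distr_iff) (auto simp: inner_lincomb[OF orthonormal_basis_family[OF assms(1)]])

lemma sphere_Int_borel:
  assumes "orthonormal_basis V d b"
  shows "sphere 0 1 \<inter> V \<in> sets borel"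
proof -
  have "closed {x::fseq. norm x = 1}" by (intro closed_Collect_eq continuous_intros)
  also have "{x::fseq. norm x = 1} = sphere 0 1" by auto
  finally have "closed (sphere 0 1 \<inter> V)" by (intro closed_Int borel_orthonormal_basis(1)[OF assms])
  then show ?thesis by simp
qed

lemma AE_gauss_on_mem:
  assumes b: "orthonormal_basis V d b"
  shows "AE x in gauss_on V. x \<in> V"
  unfolding gauss_on_eq[OF b] using lincomb_mem[OF b] borel_orthonormal_basis[OF b]
  by (subst AE_distr_iff) auto

lemma AE_gauss_on_nonzero:
  assumes "orthonormal_basis V d b" "d > 0"
  shows "AE x in gauss_on V. x \<noteq> 0"
  using AE_gauss_on_inner[OF assms] by eventually_elim auto

lemma orth_proj_borel_measurable:
  assumes b: "orthonormal_basis V d b"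
  shows "orth_proj V \<in> borel_measurable borel"
  unfolding orth_proj_eq[OF b, abs_def] lincomb_def by measurable

lemma Euclid_borel [measurable]: "Euclid n \<in> sets borel"
  by (rule borel_orthonormal_basis(2)[OF orthonormal_basis_unit])

text \<open>In a basis adapted to H the projection forgets the coordinates from m on, and a marginal
  of a product is the product of the remaining factors. One Gaussian vector in
  \<open>Euclid n\<close> thus serves all subspaces H at once, which is how dependence on H becomes
  measurable.\<close>

lemma gauss_on_proj:
  assumes b: "orthonormal_basis (Euclid n) n b" "orthonormal_basis H m b" "m \<le> n"
  shows "distr (gauss_on (Euclid n)) borel (orth_proj H) = gauss_on H"
proof -
  note [measurable] = orth_proj_borel_measurable[OF b(2)]
  have "distr (gauss_on (Euclid n)) borel (orth_proj H) = distr (gaussian_prod {..<n}) borel (orth_proj H \<circ> lincomb n b)"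
    by (simp add: gauss_on_eq[OF b(1)] distr_distr)
  also have "orth_proj H \<circ> lincomb n b = lincomb m b \<circ> (\<lambda>x. restrict x {..<m})"
  proof
    fix x
    show "(orth_proj H \<circ> lincomb n b) x = (lincomb m b \<circ> (\<lambda>x. restrict x {..<m})) x"
      using inner_lincomb[OF orthonormal_basis_family[OF b(1)]] b(3)
      by (auto simp: orth_proj_eq[OF b(2)] intro!: lincomb_cong)
  qed
  also have "distr (gaussian_prod {..<n}) borel \<dots>
      = distr (distr (gaussian_prod {..<n}) (gaussian_prod {..<m}) (\<lambda>x. restrict x {..<m})) borel (lincomb m b)"
    using b(3) by (subst distr_distr) (auto intro!: measurable_restrict_subset)
  also have "distr (gaussian_prod {..<n}) (gaussian_prod {..<m}) (\<lambda>x. restrict x {..<m}) = gaussian_prod {..<m}"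
  proof -
    interpret product_prob_space "\<lambda>_::nat. density lborel (\<lambda>x. ennreal (std_normal_density x))" "{..<n}" ..
    show ?thesis using b(3) by (intro distr_PiM_restrict_finite) auto
  qed
  finally show ?thesis by (simp add: gauss_on_eq[OF b(2)])
qed

subsection \<open>Haar measure on spheres\<close>

text \<open>The default u, a unit vector of V in all uses, keeps the values in the sphere of V on
  the exceptional Gaussian null set.\<close>

definition direction :: "fseq set \<Rightarrow> fseq \<Rightarrow> fseq \<Rightarrow> fseq" where
  "direction V u x = (if x \<in> V \<and> x \<noteq> 0 then x /\<^sub>R norm x else u)"

lemma direction_measurable:
  assumes "orthonormal_basis V d b" "u \<in> V" "norm u = 1"
  shows "direction V u \<in> measurable borel (sphere_borel V)"
  unfolding sphere_borel_def
proof (rule measurable_restrict_space2)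
  show "direction V u \<in> space borel \<rightarrow> sphere 0 1 \<inter> V"
    using assms orthonormal_basis_subspace[OF assms(1)] by (auto simp: direction_def subspace_scale)
  have [measurable]: "V \<in> sets borel" using borel_orthonormal_basis[OF assms(1)] by auto
  show "direction V u \<in> borel_measurable borel"
    unfolding direction_def by measurable
qed

lemma orthonormal_basis_first:
  assumes V: "subspace V" "V \<subseteq> Euclid n" and u: "u \<in> V" "norm u = 1"
  shows "\<exists>b. orthonormal_basis V (dim V) b \<and> b 0 = u \<and> 0 < dim V"
proof -
  have "orthonormal_family 1 (\<lambda>_. u)"
    using u by (simp add: orthonormal_family_def flip: power2_norm_eq_inner)
  then obtain d b where "1 \<le> d" "orthonormal_basis V d b" "b 0 = u"
    using orthonormal_family_extend[OF V, of 1 "\<lambda>_. u"] u by auto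
  then show ?thesis using orthonormal_basis_dim by fastforce
qed

lemma orthogonal_transformation_transitive:
  assumes V: "subspace V" "V \<subseteq> Euclid n" and x: "x \<in> V" "norm x = 1" and y: "y \<in> V" "norm y = 1"
  shows "\<exists>g. orthogonal_transformation g \<and> g x = y \<and> g ` V = V"
proof -
  obtain b b' where "orthonormal_basis V (dim V) b" "b 0 = x" "orthonormal_basis V (dim V) b'" "b' 0 = y" "0 < dim V"
    using orthonormal_basis_first[OF V x] orthonormal_basis_first[OF V y] by blast
  then show ?thesis using orthogonal_transformation_exists by metis
qed

definition invariant_sphere_measure :: "fseq set \<Rightarrow> fseq measure \<Rightarrow> bool" where
  "invariant_sphere_measure V M \<longleftrightarrow> sets M = sets (sphere_borel V) \<and> prob_space M \<and>
     (\<forall>g. orthogonal_transformation g \<and> g ` V = V \<longrightarrow> distr M M g = M)"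

lemma orthogonal_transformation_sphere_measurable:
  assumes g: "orthogonal_transformation g" "g ` V = V" and M: "sets M = sets (sphere_borel V)"
  shows "g \<in> measurable M M"
proof -
  have "g \<in> measurable (sphere_borel V) (sphere_borel V)"
    unfolding sphere_borel_def
    using g orthogonal_transformation_norm[OF g(1)]
    by (intro measurable_restrict_space3 borel_measurable_orthogonal_transformation) auto
  then show ?thesis by (simp add: measurable_cong_sets[OF M M])
qed

text \<open>Normalisation commutes with a linear isometry of V wherever x is a non-zero vector of V,
  hence almost everywhere, and the isometry preserves the Gaussian measure.\<close>

lemma invariant_sphere_measure_exists:
  assumes b: "orthonormal_basis V d b" and d: "d > 0"
  shows "invariant_sphere_measure V (distr (gauss_on V) (sphere_borel V) (direction V (b 0)))"
proof -
  let ?u = "b 0"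
  have u: "?u \<in> V" "norm ?u = 1"
    using orthonormal_basis_mem[OF b d] orthonormal_familyD[OF orthonormal_basis_family[OF b] d d]
    by (auto simp: norm_eq_1)
  note dm = direction_measurable[OF b u]
  then have [measurable]: "direction V ?u \<in> measurable (gauss_on V) (sphere_borel V)"
    by (simp cong: measurable_cong_sets)
  let ?N = "distr (gauss_on V) (sphere_borel V) (direction V ?u)"
  have "distr ?N ?N g = ?N" if g: "orthogonal_transformation g" "g ` V = V" for g
  proof -
    have [measurable]: "g \<in> measurable (sphere_borel V) (sphere_borel V)"
      by (rule orthogonal_transformation_sphere_measurable[OF g refl])
    have [measurable]: "g \<in> borel_measurable borel"
      by (rule borel_measurable_orthogonal_transformation[OF g(1)])
    have "distr ?N ?N g = distr ?N (sphere_borel V) g" by (intro distr_cong) auto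
    also have "\<dots> = distr (gauss_on V) (sphere_borel V) (g \<circ> direction V ?u)"
      by (subst distr_distr) auto
    also have "\<dots> = distr (gauss_on V) (sphere_borel V) (direction V ?u \<circ> g)"
    proof (rule distr_cong_AE)
      have "AE x in gauss_on V. x \<in> V \<and> x \<noteq> 0"
        using AE_gauss_on_mem[OF b] AE_gauss_on_nonzero[OF b d] by auto
      then show "AE x in gauss_on V. (g \<circ> direction V ?u) x = (direction V ?u \<circ> g) x"
      proof eventually_elim
        fix x assume x: "x \<in> V \<and> x \<noteq> 0"
        then have "g x \<in> V" "norm (g x) = norm x" using g orthogonal_transformation_norm[OF g(1)] by auto
        moreover from this have "g x \<noteq> 0" using x by auto
        ultimately show "(g \<circ> direction V ?u) x = (direction V ?u \<circ> g) x"
          using x linear_scale[OF orthogonal_transformation_linear[OF g(1)]] by (simp add: direction_def)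
      qed
    qed (use dm in \<open>auto intro!: measurable_comp[OF _ dm]\<close>)
    also have "\<dots> = distr (distr (gauss_on V) borel g) (sphere_borel V) (direction V ?u)"
      using dm by (subst distr_distr) auto
    also have "distr (gauss_on V) borel g = gauss_on V"
      by (simp add: distr_gauss_on_orthogonal[OF b g(1)] g(2))
    finally show ?thesis .
  qed
  moreover have "prob_space ?N" by (intro prob_space.prob_space_distr prob_space_gauss_on) simp
  ultimately show ?thesis by (simp add: invariant_sphere_measure_def)
qed

text \<open>The isometries of V act transitively on its unit sphere, so balls of equal radius
  centred there have equal mass. The comparison takes place after pushing the measures forward to
  the sequence space, where the sphere is a Borel set.\<close>

lemma invariant_sphere_measure_unique:
  assumes V: "subspace V" "V \<subseteq> Euclid n" and M: "invariant_sphere_measure V M" and N: "invariant_sphere_measure V N"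
  shows "M = N"
proof -
  obtain b where b: "orthonormal_basis V (dim V) b" using orthonormal_basis_exists[OF V] by blast
  let ?S = "sphere 0 1 \<inter> V"
  have S: "?S \<in> sets borel" by (rule sphere_Int_borel[OF b])
  have K: "space K = ?S" "sets K = sets (sphere_borel V)" "prob_space K" "(\<lambda>x. x) \<in> borel_measurable K"
    "\<And>x y r. x \<in> ?S \<Longrightarrow> y \<in> ?S \<Longrightarrow>
      emeasure (distr K borel (\<lambda>x. x)) (ball x r) = emeasure (distr K borel (\<lambda>x. x)) (ball y r)"
    "AE x in distr K borel (\<lambda>x. x). x \<in> ?S"
    if K: "invariant_sphere_measure V K" for K
  proof -
    have sK: "sets K = sets (sphere_borel V)" using K by (simp add: invariant_sphere_measure_def)
    show spK: "space K = ?S" using sets_eq_imp_space_eq[OF sK] by (simp add: sphere_borel_def space_restrict_space)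
    show "sets K = sets (sphere_borel V)" "prob_space K" using K by (simp_all add: invariant_sphere_measure_def)
    show id: "(\<lambda>x. x) \<in> borel_measurable K"
      by (subst measurable_cong_sets[OF sK refl]) (simp add: sphere_borel_def measurable_restrict_space1)
    show "AE x in distr K borel (\<lambda>x. x). x \<in> ?S"
    proof (subst AE_distr_iff[OF id])
      have "{x \<in> space borel. x \<in> ?S} = ?S" by auto
      then show "{x \<in> space borel. x \<in> ?S} \<in> sets borel" using S by simp
    qed (use spK in auto)
    fix x y r assume x: "x \<in> ?S" and y: "y \<in> ?S"
    obtain g where g: "orthogonal_transformation g" "g x = y" "g ` V = V"
      using orthogonal_transformation_transitive[OF V, of x y] x y by auto
    have BS: "ball z r \<inter> ?S \<in> sets K" for z
      unfolding sK sphere_borel_def using S by (auto simp: sets_restrict_space_iff)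
    have "emeasure K (ball y r \<inter> ?S) = emeasure (distr K K g) (ball y r \<inter> ?S)"
      using K g by (simp add: invariant_sphere_measure_def)
    also have "\<dots> = emeasure K (g -` (ball y r \<inter> ?S) \<inter> space K)"
      by (rule emeasure_distr[OF orthogonal_transformation_sphere_measurable[OF g(1,3) sK] BS])
    also have "g -` (ball y r \<inter> ?S) \<inter> space K = ball x r \<inter> ?S"
    proof -
      have "dist y (g z) = dist x z" for z
        using g orthogonal_transformation_norm[OF g(1), of "x - z"]
          linear_diff[OF orthogonal_transformation_linear[OF g(1)], of x z] by (simp add: dist_norm)
      then show ?thesis using spK g orthogonal_transformation_norm[OF g(1)] by auto
    qed
    finally show "emeasure (distr K borel (\<lambda>x. x)) (ball x r) = emeasure (distr K borel (\<lambda>x. x)) (ball y r)"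
      using id spK by (simp add: emeasure_distr)
  qed
  have eq: "distr M borel (\<lambda>x. x) = distr N borel (\<lambda>x. x)"
  proof (rule uniform_balls_unique_prob[where S="?S"])
    show "prob_space (distr M borel (\<lambda>x. x))" "prob_space (distr N borel (\<lambda>x. x))"
      using K[OF M] K[OF N] by (auto intro: prob_space.prob_space_distr)
  qed (rule sets_distr K(5)[OF M] K(6)[OF M] K(5)[OF N] K(6)[OF N]; assumption)+
  show ?thesis
  proof (rule measure_eqI)
    fix A assume A: "A \<in> sets M"
    then have "A \<in> sets borel" "A \<subseteq> ?S"
      using K[OF M] S by (auto simp: sphere_borel_def sets_restrict_space_iff)
    then have "emeasure K A = emeasure (distr K borel (\<lambda>x. x)) A" if "K = M \<or> K = N" for K
      using that K(1,4)[OF M] K(1,4)[OF N] by (subst emeasure_distr) (auto simp: Int_absorb2)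
    then show "emeasure M A = emeasure N A" using eq by simp
  qed (use K[OF M] K[OF N] in simp)
qed

lemma haar_sphere_eq:
  assumes b: "orthonormal_basis V d b" and d: "d > 0" and V: "V \<subseteq> Euclid n"
  shows "haar_sphere V = distr (gauss_on V) (sphere_borel V) (direction V (b 0))"
proof -
  have "haar_sphere V = (THE M. invariant_sphere_measure V M)"
    by (simp add: haar_sphere_def invariant_sphere_measure_def)
  also have "\<dots> = distr (gauss_on V) (sphere_borel V) (direction V (b 0))"
    using invariant_sphere_measure_unique[OF orthonormal_basis_subspace[OF b] V]
      invariant_sphere_measure_exists[OF b d] by (intro the_equality) auto
  finally show ?thesis .
qed

text \<open>The case distinction in \<open>direction\<close> concerns a null set only, so the radial
  projection can be written as plain division; at x = 0 it gives 0, which is not in the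
  sphere.\<close>

lemma measure_haar_sphere:
  assumes b: "orthonormal_basis V d b" and d: "d > 0" and V: "V \<subseteq> Euclid n" and A: "A \<in> sets (sphere_borel V)"
  shows "measure (haar_sphere V) A = measure (gauss_on V) {x. x /\<^sub>R norm x \<in> A}"
proof -
  have u: "b 0 \<in> V" "norm (b 0) = 1"
    using orthonormal_basis_mem[OF b d] orthonormal_familyD[OF orthonormal_basis_family[OF b] d d]
    by (auto simp: norm_eq_1)
  have A': "A \<in> sets borel"
    using A sphere_Int_borel[OF b] by (auto simp: sphere_borel_def sets_restrict_space_iff)
  have "measure (haar_sphere V) A = measure (gauss_on V) (direction V (b 0) -` A \<inter> space (gauss_on V))"
    using direction_measurable[OF b u] A by (simp add: haar_sphere_eq[OF b d V] measure_distr)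
  also have "\<dots> = measure (gauss_on V) {x. x /\<^sub>R norm x \<in> A}"
  proof (rule measure_eq_AE)
    have "AE x in gauss_on V. x \<in> V \<and> x \<noteq> 0"
      using AE_gauss_on_mem[OF b] AE_gauss_on_nonzero[OF b d] by auto
    then show "AE x in gauss_on V. (x \<in> direction V (b 0) -` A \<inter> space (gauss_on V)) = (x \<in> {x. x /\<^sub>R norm x \<in> A})"
      by eventually_elim (auto simp: direction_def)
    show "direction V (b 0) -` A \<inter> space (gauss_on V) \<in> sets (gauss_on V)"
      using measurable_sets[OF direction_measurable[OF b u] A] by simp
    show "{x. x /\<^sub>R norm x \<in> A} \<in> sets (gauss_on V)" using A' by simp
  qed
  finally show ?thesis .
qed

subsection \<open>Haar measure on Grassmannians\<close>

lemma grassmannian_basis: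
  assumes "H \<in> grassmannian n k"
  shows "\<exists>b. orthonormal_basis (Euclid n) n b \<and> orthonormal_basis H k b \<and> k \<le> n"
proof -
  have H: "subspace H" "H \<subseteq> Euclid n" "dim H = k" using assms by (auto simp: grassmannian_def)
  then obtain b where "orthonormal_basis H k b" using orthonormal_basis_exists by blast
  then show ?thesis using orthonormal_basis_extend_Euclid H by blast
qed

lemma grassmannianI: "orthonormal_basis H k b \<Longrightarrow> H \<subseteq> Euclid n \<Longrightarrow> H \<in> grassmannian n k"
  using orthonormal_basis_dim orthonormal_basis_subspace by (auto simp: grassmannian_def)

lemma grassmannian_nonempty: "k \<le> n \<Longrightarrow> \<exists>H. H \<in> grassmannian n k"
  by (rule exI[of _ "Euclid k"]) (rule grassmannianI[OF orthonormal_basis_unit], auto simp: Euclid_def)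

lemma orth_proj_grassmannian:
  assumes H: "H \<in> grassmannian n k"
  shows "linear (orth_proj H)" "orth_proj H x \<in> H" "orth_proj H x \<in> Euclid n"
    "orth_proj H x \<bullet> y = x \<bullet> orth_proj H y" "(x - orth_proj H x) \<bullet> orth_proj H y = 0"
proof -
  obtain b where b: "orthonormal_basis (Euclid n) n b" "orthonormal_basis H k b" using grassmannian_basis[OF H] by blast
  show "linear (orth_proj H)" unfolding orth_proj_eq[OF b(2), abs_def] by (rule linear_proj_family)
  show *: "orth_proj H x \<in> H" for x unfolding orth_proj_eq[OF b(2)] by (rule lincomb_mem[OF b(2)])
  show "orth_proj H x \<in> Euclid n" using *[of x] H by (auto simp: grassmannian_def)
  show "(x - orth_proj H x) \<bullet> orth_proj H y = 0" for x y
    using proj_family_orthogonal[OF b(2) *[of y], of x] by (simp add: orth_proj_eq[OF b(2)])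
  from this[of x y] this[of y x] show "orth_proj H x \<bullet> y = x \<bullet> orth_proj H y"
    by (simp add: inner_diff_left inner_diff_right inner_commute)
qed

lemma grassmannian_image:
  assumes "orthogonal_transformation g" "g ` Euclid n = Euclid n" "H \<in> grassmannian n k"
  shows "g ` H \<in> grassmannian n k"
proof -
  obtain b where b: "orthonormal_basis H k b" using grassmannian_basis[OF assms(3)] by blast
  have "g ` H \<subseteq> Euclid n" using assms by (auto simp: grassmannian_def)
  then show ?thesis by (rule grassmannianI[OF orthogonal_transformation_basis[OF assms(1) b]])
qed

lemma orth_proj_grassmannian_image:
  assumes "orthogonal_transformation g" "H \<in> grassmannian n k"
  shows "orth_proj (g ` H) (g x) = g (orth_proj H x)"
  using grassmannian_basis[OF assms(2)] orth_proj_image[OF assms(1)] by blast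

lemma grassmannian_transitive:
  assumes "H \<in> grassmannian n k" "H' \<in> grassmannian n k"
  shows "\<exists>g. orthogonal_transformation g \<and> g ` Euclid n = Euclid n \<and> g ` H = H'"
proof -
  obtain b b' where b: "orthonormal_basis (Euclid n) n b" "orthonormal_basis H k b" "k \<le> n"
    and b': "orthonormal_basis (Euclid n) n b'" "orthonormal_basis H' k b'"
    using grassmannian_basis[OF assms(1)] grassmannian_basis[OF assms(2)] by metis
  obtain g where g: "orthogonal_transformation g" "\<forall>i<n. g (b i) = b' i" "g ` Euclid n = Euclid n"
    using orthogonal_transformation_exists[OF b(1) b'(1)] by blast
  have "(\<lambda>i. g (b i)) ` {..<k} = b' ` {..<k}" using g b(3) by force
  then have "g ` H = H'"
    using orthogonal_transformation_basis[OF g(1) b(2)] b'(2) by (simp add: orthonormal_basis_def)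
  then show ?thesis using g by blast
qed

lemma unit_fseq_Euclid: "i < n \<Longrightarrow> unit_fseq i \<in> Euclid n"
  by (auto simp: Euclid_def coord_unit_fseq)

lemma orth_proj_expand:
  assumes "H \<in> grassmannian n k" "x \<in> Euclid n"
  shows "orth_proj H x = (\<Sum>i<n. coord x i *\<^sub>R orth_proj H (unit_fseq i))"
  by (subst fseq_expand[OF assms(2)])
    (simp add: linear_sum[OF orth_proj_grassmannian(1)[OF assms(1)]] linear_scale[OF orth_proj_grassmannian(1)[OF assms(1)]])

lemma orth_proj_unit_outside:
  assumes "H \<in> grassmannian n k" "i \<ge> n"
  shows "orth_proj H (unit_fseq i) = 0"
proof (rule orth_proj_eqI)
  show "subspace H" "0 \<in> H" using assms subspace_0 by (auto simp: grassmannian_def)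
  fix v assume "v \<in> H"
  then have "coord v i = 0" using assms by (auto simp: grassmannian_def Euclid_def)
  then show "(unit_fseq i - 0) \<bullet> v = 0" by (simp add: coord_eq_inner inner_commute)
qed

section \<open>Measurability on the Grassmannian\<close>

lemma space_grassmannian_borel [simp]: "space (grassmannian_borel n k) = grassmannian n k"
  by (simp add: grassmannian_borel_def)

text \<open>Only finitely many columns have to be tested, as those from index n on vanish
  identically. Measurability into the countable product follows coordinatewise.\<close>

lemma measurable_grassmannianI:
  assumes "\<And>x. x \<in> space M \<Longrightarrow> f x \<in> grassmannian n k"
    and "\<And>i. i < n \<Longrightarrow> (\<lambda>x. orth_proj (f x) (unit_fseq i)) \<in> borel_measurable M"
  shows "f \<in> measurable M (grassmannian_borel n k)"
  unfolding grassmannian_borel_def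
proof (rule measurable_vimage_algebra2)
  show "f \<in> space M \<rightarrow> grassmannian n k" using assms(1) by auto
  show "(\<lambda>x i. orth_proj (f x) (unit_fseq i)) \<in> borel_measurable M"
  proof (rule measurable_coordinatewise_then_product)
    fix i
    show "(\<lambda>x. orth_proj (f x) (unit_fseq i)) \<in> borel_measurable M"
    proof (cases "i < n")
      case False
      then show ?thesis
        by (subst measurable_cong[where g="\<lambda>x. 0"]) (simp_all add: orth_proj_unit_outside[OF assms(1)])
    qed (use assms(2) in auto)
  qed
qed

lemma orth_proj_unit_measurable [measurable]:
  "(\<lambda>H. orth_proj H (unit_fseq i)) \<in> borel_measurable (grassmannian_borel n k)"
proof -
  have "(\<lambda>H i. orth_proj H (unit_fseq i)) \<in> measurable (grassmannian_borel n k) borel"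
    unfolding grassmannian_borel_def by (rule measurable_vimage_algebra1) auto
  from measurable_compose[OF this measurable_product_coordinates[of i]] show ?thesis by simp
qed

lemma coord_measurable [measurable]: "(\<lambda>x. coord x i) \<in> borel_measurable borel"
  unfolding coord_eq_inner by measurable

lemma orth_proj_measurable:
  assumes f: "f \<in> measurable M (grassmannian_borel n k)" and g [measurable]: "g \<in> borel_measurable M"
    and E: "\<And>x. x \<in> space M \<Longrightarrow> g x \<in> Euclid n"
  shows "(\<lambda>x. orth_proj (f x) (g x)) \<in> borel_measurable M"
proof -
  have [measurable]: "(\<lambda>x. orth_proj (f x) (unit_fseq i)) \<in> borel_measurable M" for i
    using measurable_compose[OF f orth_proj_unit_measurable] .
  have "orth_proj (f x) (g x) = (\<Sum>i<n. coord (g x) i *\<^sub>R orth_proj (f x) (unit_fseq i))" if "x \<in> space M" for x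
    using measurable_space[OF f that] E[OF that] by (simp add: orth_proj_expand)
  then show ?thesis by (subst measurable_cong) auto
qed

lemma image_grassmannian_measurable:
  assumes g: "orthogonal_transformation g" "g ` Euclid n = Euclid n"
  shows "(`) g \<in> measurable (grassmannian_borel n k) (grassmannian_borel n k)"
proof (rule measurable_grassmannianI)
  fix i assume "i < n"
  then obtain y where y: "y \<in> Euclid n" "g y = unit_fseq i" using unit_fseq_Euclid g(2) by (metis imageE)
  have [measurable]: "g \<in> borel_measurable borel" by (rule borel_measurable_orthogonal_transformation[OF g(1)])
  have "(\<lambda>H. orth_proj H y) \<in> borel_measurable (grassmannian_borel n k)"
    by (rule orth_proj_measurable[where k=k and n=n]) (use y in auto)
  then have "(\<lambda>H. g (orth_proj H y)) \<in> borel_measurable (grassmannian_borel n k)" by measurable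
  then show "(\<lambda>H. orth_proj (g ` H) (unit_fseq i)) \<in> borel_measurable (grassmannian_borel n k)"
    by (subst measurable_cong[where g="\<lambda>H. g (orth_proj H y)"])
      (auto simp: orth_proj_grassmannian_image[OF g(1)] simp flip: y(2))
qed (simp add: grassmannian_image[OF g])

text \<open>An isometric copy of the projection matrices with the Hilbert--Schmidt distance inside the sequence space.\<close>

definition proj_code :: "nat \<Rightarrow> fseq set \<Rightarrow> fseq" where
  "proj_code n H = lincomb (n * n) unit_fseq (\<lambda>p. coord (orth_proj H (unit_fseq (p div n))) (p mod n))"

text \<open>The basis is an argument because the effect of an isometry g is computed by passing from
  the standard basis to its image under g.\<close>

definition hs_dist_sq :: "nat \<Rightarrow> (nat \<Rightarrow> fseq) \<Rightarrow> fseq set \<Rightarrow> fseq set \<Rightarrow> real" where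
  "hs_dist_sq n b H H' = (\<Sum>i<n. (norm (orth_proj H (b i) - orth_proj H' (b i)))\<^sup>2)"

lemma sum_div_mod: "(\<Sum>p<n*n. f (p div n) (p mod n)) = (\<Sum>i<n. \<Sum>j<n. (f i j :: real))" for n :: nat
proof -
  have "(\<Sum>p<n*n. f (p div n) (p mod n)) = (\<Sum>i<n. \<Sum>p\<in>{i*n..<i*n+n}. f (p div n) (p mod n))"
    by (rule sum.nat_group[symmetric])
  also have "\<dots> = (\<Sum>i<n. \<Sum>j<n. f i j)"
  proof (rule sum.cong[OF refl])
    fix i
    have dm: "a div n = i" "a mod n = a - i * n" if "i * n \<le> a" "a < i * n + n" for a
    proof -
      show "a div n = i" using that by (intro div_nat_eqI) (auto simp: mult.commute)
      then show "a mod n = a - i * n" using minus_mult_div_eq_mod[of a n] by (simp add: mult.commute)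
    qed
    show "(\<Sum>p\<in>{i*n..<i*n+n}. f (p div n) (p mod n)) = (\<Sum>j<n. f i j)"
      by (rule sum.reindex_bij_witness[of _ "\<lambda>j. i * n + j" "\<lambda>p. p - i * n"])
        (auto simp: dm)
  qed
  finally show ?thesis .
qed

lemma dist_proj_code:
  assumes "H \<in> grassmannian n k" "H' \<in> grassmannian n k"
  shows "(dist (proj_code n H) (proj_code n H'))\<^sup>2 = hs_dist_sq n unit_fseq H H'"
proof -
  have u: "orthonormal_family m unit_fseq" for m using orthonormal_basis_unit orthonormal_basis_family by blast
  let ?D = "\<lambda>i. orth_proj H (unit_fseq i) - orth_proj H' (unit_fseq i)"
  have "(dist (proj_code n H) (proj_code n H'))\<^sup>2
    = (\<Sum>p<n*n. (coord (?D (p div n)) (p mod n))\<^sup>2)"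
    by (simp add: proj_code_def dist_norm norm_lincomb_sq[OF u] flip: lincomb_diff)
  also have "\<dots> = (\<Sum>i<n. \<Sum>j<n. (coord (?D i) j)\<^sup>2)" by (rule sum_div_mod)
  also have "\<dots> = hs_dist_sq n unit_fseq H H'"
    unfolding hs_dist_sq_def
  proof (rule sum.cong[OF refl])
    fix i
    have "?D i \<in> Euclid n" using orth_proj_grassmannian(3) assms subspace_Euclid subspace_diff by metis
    then show "(\<Sum>j<n. (coord (?D i) j)\<^sup>2) = (norm (?D i))\<^sup>2"
      by (simp add: power2_norm_eq_inner inner_Euclid) (simp add: power2_eq_square)
  qed
  finally show ?thesis .
qed

text \<open>The difference D of two projections is self-adjoint, so by Parseval both sides equal the
  sum over i and j of the squares of \<open>D (b i) \<bullet> c j\<close>, read by rows or by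
  columns.\<close>

lemma hs_dist_sq_basis:
  assumes H: "H \<in> grassmannian n k" "H' \<in> grassmannian n k"
    and b: "orthonormal_basis (Euclid n) n b" and c: "orthonormal_basis (Euclid n) n c"
  shows "hs_dist_sq n b H H' = hs_dist_sq n c H H'"
proof -
  let ?D = "\<lambda>x. orth_proj H x - orth_proj H' x"
  have DE: "?D x \<in> Euclid n" for x using orth_proj_grassmannian(3) H subspace_Euclid subspace_diff by metis
  have adj: "?D x \<bullet> y = x \<bullet> ?D y" for x y
    using orth_proj_grassmannian(4)[OF H(1)] orth_proj_grassmannian(4)[OF H(2)]
    by (simp add: inner_diff_left inner_diff_right)
  have sq: "(norm y)\<^sup>2 = (\<Sum>j<n. (y \<bullet> e j)\<^sup>2)" if "y \<in> Euclid n" "orthonormal_basis (Euclid n) n e" for y e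
    using orthonormal_basis_parseval[OF that(2,1), of y]
    unfolding power2_norm_eq_inner by (simp add: power2_eq_square inner_commute)
  have "hs_dist_sq n b H H' = (\<Sum>i<n. \<Sum>j<n. (?D (b i) \<bullet> c j)\<^sup>2)"
    unfolding hs_dist_sq_def using sq[OF DE c] by simp
  also have "\<dots> = (\<Sum>j<n. \<Sum>i<n. (?D (c j) \<bullet> b i)\<^sup>2)"
  proof (subst sum.swap)
    have "?D (b i) \<bullet> c j = ?D (c j) \<bullet> b i" for i j using adj[of "b i" "c j"] by (simp only: inner_commute)
    then show "(\<Sum>j<n. \<Sum>i<n. (?D (b i) \<bullet> c j)\<^sup>2) = (\<Sum>j<n. \<Sum>i<n. (?D (c j) \<bullet> b i)\<^sup>2)" by (simp only:)
  qed
  also have "\<dots> = hs_dist_sq n c H H'"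
    unfolding hs_dist_sq_def using sq[OF DE b] by simp
  finally show ?thesis .
qed

text \<open>In the basis of the vectors \<open>g (unit_fseq i)\<close> the projections onto the
  images act as g after the original projections; g preserves norms, and the choice of basis does
  not matter.\<close>

lemma dist_proj_code_image:
  assumes H: "H \<in> grassmannian n k" "H' \<in> grassmannian n k"
    and g: "orthogonal_transformation g" "g ` Euclid n = Euclid n"
  shows "dist (proj_code n (g ` H)) (proj_code n (g ` H')) = dist (proj_code n H) (proj_code n H')"
proof -
  have gb: "orthonormal_basis (Euclid n) n (\<lambda>i. g (unit_fseq i))"
    using orthogonal_transformation_basis[OF g(1) orthonormal_basis_unit[of n]] g(2) by simp
  have "(dist (proj_code n (g ` H)) (proj_code n (g ` H')))\<^sup>2 = hs_dist_sq n (\<lambda>i. g (unit_fseq i)) (g ` H) (g ` H')"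
    using grassmannian_image[OF g] H hs_dist_sq_basis[OF _ _ orthonormal_basis_unit gb] dist_proj_code by metis
  also have "\<dots> = hs_dist_sq n unit_fseq H H'"
    unfolding hs_dist_sq_def
    using orth_proj_grassmannian_image[OF g(1) H(1)] orth_proj_grassmannian_image[OF g(1) H(2)]
      linear_diff[OF orthogonal_transformation_linear[OF g(1)], symmetric] orthogonal_transformation_norm[OF g(1)]
    by simp
  also have "\<dots> = (dist (proj_code n H) (proj_code n H'))\<^sup>2" by (rule dist_proj_code[OF H, symmetric])
  finally show ?thesis by (simp add: power2_eq_iff_nonneg)
qed

lemma proj_code_measurable [measurable]: "proj_code n \<in> borel_measurable (grassmannian_borel n k)"
  unfolding proj_code_def lincomb_def by measurable

text \<open>Reading the columns back off the code is a Borel map, so every Borel condition on the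
  columns is one on the code. Equality of image measures under \<open>proj_code\<close> thereby
  lifts to the Grassmannian.\<close>

lemma grassmannian_sets_proj_code:
  assumes "A \<in> sets (grassmannian_borel n k)"
  shows "\<exists>B\<in>sets borel. A = proj_code n -` B \<inter> grassmannian n k"
proof -
  define dec where "dec y = (\<lambda>i. if i < n then (\<Sum>j<n. coord y (i * n + j) *\<^sub>R unit_fseq j) else 0)" for y
  have dec_m: "dec \<in> borel_measurable borel"
  proof (rule measurable_coordinatewise_then_product)
    fix i show "(\<lambda>y. dec y i) \<in> borel_measurable borel"
      unfolding dec_def by (cases "i < n") simp_all
  qed
  have dec: "dec (proj_code n H) = (\<lambda>i. orth_proj H (unit_fseq i))" if H: "H \<in> grassmannian n k" for H
  proof
    fix i
    show "dec (proj_code n H) i = orth_proj H (unit_fseq i)"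
    proof (cases "i < n")
      case True
      have c: "coord (proj_code n H) (i * n + j) = coord (orth_proj H (unit_fseq i)) j" if "j < n" for j
      proof -
        have "i * n + j < n * n"
          using True that by (metis add.commute mult.commute mult_Suc mult_le_mono1 less_le_trans add_less_cancel_left Suc_leI)
        then have "coord (proj_code n H) (i * n + j) = coord (orth_proj H (unit_fseq ((i*n+j) div n))) ((i*n+j) mod n)"
          by (simp add: proj_code_def lincomb_def coord_unit_fseq if_distrib cong: if_cong)
        then show ?thesis using that by simp
      qed
      show ?thesis
        using fseq_expand[OF orth_proj_grassmannian(3)[OF H, of "unit_fseq i"]] True c by (simp add: dec_def)
    qed (simp add: dec_def orth_proj_unit_outside[OF H])
  qed
  obtain B where B: "B \<in> sets borel" "A = (\<lambda>H i. orth_proj H (unit_fseq i)) -` B \<inter> grassmannian n k"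
    using assms by (auto simp: grassmannian_borel_def sets_vimage_algebra2)
  have "A = proj_code n -` (dec -` B) \<inter> grassmannian n k" using B(2) dec by auto
  moreover have "dec -` B \<in> sets borel" using measurable_sets[OF dec_m B(1)] by simp
  ultimately show ?thesis by blast
qed

section \<open>Uniqueness of the invariant measure on the Grassmannian\<close>

definition invariant_grassmannian_measure :: "nat \<Rightarrow> nat \<Rightarrow> fseq set measure \<Rightarrow> bool" where
  "invariant_grassmannian_measure n k M \<longleftrightarrow> sets M = sets (grassmannian_borel n k) \<and> prob_space M \<and>
     (\<forall>g. orthogonal_transformation g \<and> g ` Euclid n = Euclid n \<longrightarrow> distr M M ((`) g) = M)"

text \<open>As for spheres: the orthogonal group acts transitively and, through the code, by
  isometries, so balls centred at codes have a mass that depends on the radius alone. The image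
  measures on the sequence space then coincide.\<close>

lemma invariant_grassmannian_measure_unique:
  assumes M: "invariant_grassmannian_measure n k M" and N: "invariant_grassmannian_measure n k N"
  shows "M = N"
proof -
  let ?S = "proj_code n ` grassmannian n k"
  have K: "space K = grassmannian n k" "sets K = sets (grassmannian_borel n k)" "prob_space K"
    "proj_code n \<in> borel_measurable K"
    "\<And>x y r. x \<in> ?S \<Longrightarrow> y \<in> ?S \<Longrightarrow>
      emeasure (distr K borel (proj_code n)) (ball x r) = emeasure (distr K borel (proj_code n)) (ball y r)"
    if K: "invariant_grassmannian_measure n k K" for K
  proof -
    show sK: "sets K = sets (grassmannian_borel n k)" using K by (simp add: invariant_grassmannian_measure_def)
    show spK: "space K = grassmannian n k" using sets_eq_imp_space_eq[OF sK] by simp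
    show "prob_space K" using K by (simp add: invariant_grassmannian_measure_def)
    show pm: "proj_code n \<in> borel_measurable K"
      using proj_code_measurable by (simp add: measurable_cong_sets[OF sK refl])
    fix x y r assume "x \<in> ?S" "y \<in> ?S"
    then obtain H H' where H: "H \<in> grassmannian n k" "x = proj_code n H" and H': "H' \<in> grassmannian n k" "y = proj_code n H'"
      by auto
    obtain g where g: "orthogonal_transformation g" "g ` Euclid n = Euclid n" "g ` H = H'"
      using grassmannian_transitive[OF H(1) H'(1)] by blast
    have gm: "(`) g \<in> measurable K K"
      using image_grassmannian_measurable[OF g(1,2)] by (simp add: measurable_cong_sets[OF sK sK])
    let ?B = "proj_code n -` ball y r \<inter> space K"
    have B: "?B \<in> sets K" using measurable_sets[OF pm, of "ball y r"] by simp
    have "emeasure K ?B = emeasure (distr K K ((`) g)) ?B"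
      using K g by (simp add: invariant_grassmannian_measure_def)
    also have "\<dots> = emeasure K ((`) g -` ?B \<inter> space K)" by (rule emeasure_distr[OF gm B])
    also have "(`) g -` ?B \<inter> space K = proj_code n -` ball x r \<inter> space K"
      using dist_proj_code_image[OF H(1) _ g(1,2)] grassmannian_image[OF g(1,2)]
      by (auto simp: H H' spK g(3)[symmetric])
    finally show "emeasure (distr K borel (proj_code n)) (ball x r) = emeasure (distr K borel (proj_code n)) (ball y r)"
      using pm by (simp add: emeasure_distr)
  qed
  interpret M: prob_space M using K[OF M] by simp
  interpret N: prob_space N using K[OF N] by simp
  interpret M': prob_space "distr M borel (proj_code n)" using K[OF M] by (intro M.prob_space_distr) simp
  interpret N': prob_space "distr N borel (proj_code n)" using K[OF N] by (intro N.prob_space_distr) simp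
  obtain H0 where H0: "H0 \<in> grassmannian n k" using M.not_empty K[OF M] by auto
  \<comment> \<open>Instead of the image of the Grassmannian, whose measurability would need an
    argument of its own, all points whose balls have the same masses as those at the code of
    \<open>H0\<close> serve as centres. Rational radii make this set a countable intersection, hence
    Borel.\<close>
  define S where "S = {x. \<forall>r\<in>\<rat>.
    emeasure (distr M borel (proj_code n)) (ball x r) = emeasure (distr M borel (proj_code n)) (ball (proj_code n H0) r) \<and>
    emeasure (distr N borel (proj_code n)) (ball x r) = emeasure (distr N borel (proj_code n)) (ball (proj_code n H0) r)}"
  have SS: "proj_code n H \<in> S" if "H \<in> grassmannian n k" for H
    unfolding S_def using K(5)[OF M] K(5)[OF N] H0 that by blast
  have SB: "S \<in> sets borel"
  proof -
    have *: "(\<lambda>x. emeasure L (ball x r)) \<in> borel_measurable borel"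
      if "prob_space L" and L: "sets L = sets borel" for L :: "fseq measure" and r
    proof -
      interpret L: prob_space L by fact
      have "open {p::fseq\<times>fseq. dist (fst p) (snd p) < r}" by (intro open_Collect_less continuous_intros)
      then have "{p::fseq\<times>fseq. dist (fst p) (snd p) < r} \<in> sets (borel \<Otimes>\<^sub>M borel)"
        unfolding borel_prod by (rule borel_open)
      also have "sets (borel \<Otimes>\<^sub>M borel) = sets (borel \<Otimes>\<^sub>M L)" using L by (intro sets_pair_measure_cong) auto
      finally have "(\<lambda>x. emeasure L (Pair x -` {p::fseq\<times>fseq. dist (fst p) (snd p) < r})) \<in> borel_measurable borel"
        by (rule L.measurable_emeasure_Pair)
      then show ?thesis by (simp add: ball_def vimage_def)
    qed
    have [measurable]: "(\<lambda>x. emeasure (distr M borel (proj_code n)) (ball x r)) \<in> borel_measurable borel"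
      "(\<lambda>x. emeasure (distr N borel (proj_code n)) (ball x r)) \<in> borel_measurable borel" for r
      by (intro *; (simp | unfold_locales))+
    have "S = (\<Inter>r\<in>\<rat>. {x. emeasure (distr M borel (proj_code n)) (ball x r) = emeasure (distr M borel (proj_code n)) (ball (proj_code n H0) r) \<and>
        emeasure (distr N borel (proj_code n)) (ball x r) = emeasure (distr N borel (proj_code n)) (ball (proj_code n H0) r)})"
      by (auto simp: S_def)
    also have "\<dots> \<in> sets borel"
      by (rule sets.countable_INT'[OF countable_rat]) (use Rats_0 in \<open>auto intro: pred_intros_logic\<close>)
    finally show ?thesis .
  qed
  have eq: "distr M borel (proj_code n) = distr N borel (proj_code n)"
  proof (rule uniform_balls_unique_prob[where S=S])
    show "AE x in distr M borel (proj_code n). x \<in> S"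
      using SB SS K[OF M] by (subst AE_distr_iff) auto
    show "AE x in distr N borel (proj_code n). x \<in> S"
      using SB SS K[OF N] by (subst AE_distr_iff) auto
  qed (auto simp: S_def M'.prob_space_axioms N'.prob_space_axioms)
  show ?thesis
  proof (rule measure_eqI)
    fix A assume "A \<in> sets M"
    then obtain B where B: "B \<in> sets borel" "A = proj_code n -` B \<inter> grassmannian n k"
      using grassmannian_sets_proj_code[of A n k] K(2)[OF M] by auto
    then have "emeasure (distr M borel (proj_code n)) B = emeasure M A" "emeasure (distr N borel (proj_code n)) B = emeasure N A"
      using K[OF M] K[OF N] by (simp_all add: emeasure_distr)
    then show "emeasure M A = emeasure N A" using eq by simp
  qed (use K[OF M] K[OF N] in simp)
qed

lemma haar_grassmannianI:
  assumes "invariant_grassmannian_measure n k M"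
  shows "haar_grassmannian n k = M"
proof -
  have "haar_grassmannian n k = (THE M. invariant_grassmannian_measure n k M)"
    by (simp add: haar_grassmannian_def invariant_grassmannian_measure_def)
  also have "\<dots> = M"
    using invariant_grassmannian_measure_unique assms by (intro the_equality) auto
  finally show ?thesis .
qed

section \<open>Existence of the invariant measure, one dimension at a time\<close>

lemma grassmannian_insert:
  assumes H: "H \<in> grassmannian n k" and w: "w \<in> Euclid n" "w \<noteq> 0" "\<And>h. h \<in> H \<Longrightarrow> w \<bullet> h = 0"
  shows "span (insert w H) \<in> grassmannian n (Suc k)"
    and "orth_proj (span (insert w H)) y = orth_proj H y + ((y \<bullet> w) / (w \<bullet> w)) *\<^sub>R w"
proof -
  obtain b where b: "orthonormal_basis H k b" using grassmannian_basis[OF H] by blast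
  define c where "c = b(k := w /\<^sub>R norm w)"
  have "w \<bullet> b i = 0" if "i < k" for i using w(3) orthonormal_basis_mem[OF b that] by auto
  then have F: "orthonormal_family (Suc k) c"
    using w orthonormal_basis_family[OF b]
    by (auto simp: c_def orthonormal_family_def less_Suc_eq inner_commute[of "b _" w]
      divide_simps power2_eq_square simp flip: power2_norm_eq_inner)
  have img: "c ` {..<Suc k} = insert (w /\<^sub>R norm w) (b ` {..<k})"
    by (auto simp: c_def lessThan_Suc)
  have "span (c ` {..<Suc k}) = span (insert w H)"
  proof
    show "span (c ` {..<Suc k}) \<subseteq> span (insert w H)"
      unfolding img using orthonormal_basis_mem[OF b]
      by (intro span_minimal) (auto intro: span_base span_scale)
    have "w = norm w *\<^sub>R (w /\<^sub>R norm w)" using w by simp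
    also have "\<dots> \<in> span (c ` {..<Suc k})" unfolding img by (intro span_scale span_base) simp
    finally have "w \<in> span (c ` {..<Suc k})" .
    moreover have "H \<subseteq> span (c ` {..<Suc k})"
      using b span_mono[of "b ` {..<k}" "c ` {..<Suc k}"] img by (auto simp: orthonormal_basis_def)
    ultimately show "span (insert w H) \<subseteq> span (c ` {..<Suc k})" by (intro span_minimal) auto
  qed
  then have c: "orthonormal_basis (span (insert w H)) (Suc k) c" using F by (simp add: orthonormal_basis_def)
  have "span (insert w H) \<subseteq> Euclid n"
    using H w by (intro span_minimal subspace_Euclid) (auto simp: grassmannian_def)
  with c show "span (insert w H) \<in> grassmannian n (Suc k)" by (rule grassmannianI)
  show "orth_proj (span (insert w H)) y = orth_proj H y + ((y \<bullet> w) / (w \<bullet> w)) *\<^sub>R w"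
    unfolding orth_proj_eq[OF c] orth_proj_eq[OF b]
    by (simp add: lincomb_def c_def divide_simps power2_eq_square flip: power2_norm_eq_inner)
qed

text \<open>Adjoining to an invariant random subspace the residual of an independent Gaussian vector keeps it invariant.\<close>

lemma invariant_grassmannian_measure_step:
  assumes M: "invariant_grassmannian_measure n k M" and k: "k < n"
  shows "\<exists>M'. invariant_grassmannian_measure n (Suc k) M'"
proof -
  have sM: "sets M = sets (grassmannian_borel n k)" and pM: "prob_space M"
    and iM: "\<And>g. orthogonal_transformation g \<Longrightarrow> g ` Euclid n = Euclid n \<Longrightarrow> distr M M ((`) g) = M"
    using M by (auto simp: invariant_grassmannian_measure_def)
  have spM: "space M = grassmannian n k" using sets_eq_imp_space_eq[OF sM] by simp
  interpret M: prob_space M by fact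
  define G where "G = gauss_on (Euclid n)"
  have sG [measurable_cong]: "sets G = sets borel" and spG: "space G = UNIV" by (simp_all add: G_def)
  interpret G: prob_space G unfolding G_def by (rule prob_space_gauss_on)
  interpret P: pair_prob_space M G ..
  define P where "P = M \<Otimes>\<^sub>M G"
  have pP: "prob_space P" unfolding P_def by unfold_locales
  have spP: "space P = grassmannian n k \<times> UNIV" by (simp add: P_def space_pair_measure spM spG)
  define GB where "GB = grassmannian_borel n (Suc k)"
  obtain H1 where H1: "H1 \<in> grassmannian n (Suc k)" using grassmannian_nonempty[of "Suc k" n] k by auto
  \<comment> \<open>On \<open>Euclid n\<close> this is the residual of x after projection onto H;
    expanding in columns makes its joint measurability in H and x visible.\<close>
  define w where "w p = snd p - (\<Sum>i<n. coord (snd p) i *\<^sub>R orth_proj (fst p) (unit_fseq i))" for p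
  define good where "good p \<longleftrightarrow> snd p \<in> Euclid n \<and> w p \<noteq> 0" for p
  \<comment> \<open>\<open>H1\<close> is an arbitrary value on the null set where x lies outside
    \<open>Euclid n\<close> or has residual zero.\<close>
  define T where "T p = (if good p then span (insert (w p) (fst p)) else H1)" for p
  have w_eq: "w (H, x) = x - orth_proj H x" if "H \<in> grassmannian n k" "x \<in> Euclid n" for H x
    using orth_proj_expand[OF that] by (simp add: w_def)
  have fstm: "fst \<in> measurable P (grassmannian_borel n k)"
    using measurable_fst[of M G] by (simp add: P_def measurable_cong_sets[OF refl sM])
  have sndm [measurable]: "snd \<in> borel_measurable P"
    using measurable_snd[of M G] by (simp add: P_def measurable_cong_sets[OF refl sG])
  have om [measurable]: "(\<lambda>p. orth_proj (fst p) (unit_fseq i)) \<in> borel_measurable P" for i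
    by (rule measurable_compose[OF fstm orth_proj_unit_measurable])
  have wm [measurable]: "w \<in> borel_measurable P" unfolding w_def by measurable
  have goodm [measurable]: "Measurable.pred P good" unfolding good_def by measurable
  have ins: "span (insert (w p) (fst p)) \<in> grassmannian n (Suc k)"
    "orth_proj (span (insert (w p) (fst p))) y = orth_proj (fst p) y + ((y \<bullet> w p) / (w p \<bullet> w p)) *\<^sub>R w p"
    if "p \<in> space P" "good p" for p y
  proof -
    obtain H x where p: "p = (H, x)" by (cases p)
    have H: "H \<in> grassmannian n k" and x: "x \<in> Euclid n" using that by (auto simp: spP p good_def)
    have "w p \<in> Euclid n" using x orth_proj_grassmannian(3)[OF H]
      by (auto simp: p w_eq[OF H x] intro!: subspace_diff[OF subspace_Euclid])
    moreover have "w p \<bullet> h = 0" if "h \<in> H" for h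
    proof -
      obtain b where b: "orthonormal_basis H k b" using grassmannian_basis[OF H] by blast
      show ?thesis using proj_family_orthogonal[OF b that] by (simp add: p w_eq[OF H x] orth_proj_eq[OF b])
    qed
    ultimately show "span (insert (w p) (fst p)) \<in> grassmannian n (Suc k)"
    "orth_proj (span (insert (w p) (fst p))) y = orth_proj (fst p) y + ((y \<bullet> w p) / (w p \<bullet> w p)) *\<^sub>R w p"
      using grassmannian_insert[OF H, of "w p"] that by (auto simp: p good_def)
  qed
  have Tm [measurable]: "T \<in> measurable P GB"
    unfolding GB_def
  proof (rule measurable_grassmannianI)
    show "T p \<in> grassmannian n (Suc k)" if "p \<in> space P" for p
      using ins(1)[OF that] H1 by (simp add: T_def)
    fix i
    have "(\<lambda>p. if good p then orth_proj (fst p) (unit_fseq i) + ((unit_fseq i \<bullet> w p) / (w p \<bullet> w p)) *\<^sub>R w p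
       else orth_proj H1 (unit_fseq i)) \<in> borel_measurable P" by measurable
    then show "(\<lambda>p. orth_proj (T p) (unit_fseq i)) \<in> borel_measurable P"
      by (rule measurable_cong[THEN iffD1, rotated]) (simp add: T_def ins(2))
  qed
  have AEgood: "AE p in P. good p"
    unfolding P_def
  proof (rule P.AE_pair_measure)
    show "{p \<in> space (M \<Otimes>\<^sub>M G). good p} \<in> sets (M \<Otimes>\<^sub>M G)"
      using goodm unfolding pred_def P_def .
    show "AE H in M. AE x in G. good (H, x)"
    proof (rule AE_I2)
      fix H assume "H \<in> space M"
      then have H: "H \<in> grassmannian n k" by (simp add: spM)
      obtain b where b: "orthonormal_basis (Euclid n) n b" "orthonormal_basis H k b" using grassmannian_basis[OF H] by blast
      show "AE x in G. good (H, x)"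
        using AE_gauss_on_inner[OF b(1) k] AE_gauss_on_mem[OF b(1)] unfolding G_def
      proof eventually_elim
        fix x assume x: "x \<bullet> b k \<noteq> 0" "x \<in> Euclid n"
        \<comment> \<open>H is spanned by the members of b before \<open>b k\<close>, so the
          residual keeps the coordinate of x along \<open>b k\<close>, which is almost surely
          non-zero.\<close>
        have "orth_proj H x \<bullet> b k = 0"
          unfolding orth_proj_eq[OF b(2)] inner_lincomb_left
          using k orthonormal_familyD[OF orthonormal_basis_family[OF b(1)], of _ k] by simp
        then have "w (H, x) \<bullet> b k = x \<bullet> b k" by (simp add: w_eq[OF H x(2)] inner_diff_left)
        then show "good (H, x)" using x by (auto simp: good_def)
      qed
    qed
  qed
  have "distr (distr P GB T) (distr P GB T) ((`) g) = distr P GB T"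
    if g: "orthogonal_transformation g" "g ` Euclid n = Euclid n" for g
  proof -
    have gm [measurable]: "(`) g \<in> measurable GB GB" unfolding GB_def by (rule image_grassmannian_measurable[OF g])
    have gb [measurable]: "g \<in> borel_measurable borel" by (rule borel_measurable_orthogonal_transformation[OF g(1)])
    have gM: "(`) g \<in> measurable M M"
      using image_grassmannian_measurable[OF g] by (simp add: measurable_cong_sets[OF sM sM])
    have gG: "g \<in> measurable G G" using gb by (simp add: measurable_cong_sets[OF sG sG])
    have dG: "distr G G g = G"
      using distr_gauss_on_orthogonal[OF orthonormal_basis_unit g(1), of n] g(2) sG
      by (simp add: G_def cong: distr_cong)
    \<comment> \<open>Rotating the subspace and the Gaussian vector together preserves their product
      measure, and T intertwines this action with the action on the larger subspaces.\<close>
    define S where "S = (\<lambda>(H, x). (g ` H, g x))"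
    have Sm [measurable]: "S \<in> measurable P P"
      unfolding S_def P_def using gM gG by measurable
    have "distr P P S = distr M M ((`) g) \<Otimes>\<^sub>M distr G G g"
      unfolding P_def S_def
      by (rule pair_measure_distr[OF gM gG, symmetric]) (simp add: dG G.sigma_finite_measure_axioms)
    then have dP: "distr P P S = P" by (simp add: dG iM[OF g] P_def)
    have "distr (distr P GB T) (distr P GB T) ((`) g) = distr (distr P GB T) GB ((`) g)"
      by (intro distr_cong) auto
    also have "\<dots> = distr P GB ((`) g \<circ> T)" by (subst distr_distr) auto
    also have "\<dots> = distr P GB (T \<circ> S)"
    proof (rule distr_cong_AE)
      have "AE p in P. p \<in> space P" by simp
      then show "AE p in P. ((`) g \<circ> T) p = (T \<circ> S) p" using AEgood
      proof eventually_elim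
        fix p assume p: "p \<in> space P" "good p"
        obtain H x where Hx: "p = (H, x)" by (cases p)
        have H: "H \<in> grassmannian n k" and x: "x \<in> Euclid n" using p by (auto simp: spP Hx good_def)
        have gH: "g ` H \<in> grassmannian n k" and gx: "g x \<in> Euclid n"
          using grassmannian_image[OF g H] x g(2) by auto
        have wg: "w (g ` H, g x) = g (w (H, x))"
          unfolding w_eq[OF H x] w_eq[OF gH gx]
          by (simp add: orth_proj_grassmannian_image[OF g(1) H] linear_diff[OF orthogonal_transformation_linear[OF g(1)]])
        have "norm (g (w (H, x))) = norm (w (H, x))" by (rule orthogonal_transformation_norm[OF g(1)])
        then have "good (S p)" using p gx by (auto simp: good_def Hx S_def wg)
        moreover have "span (insert (g (w (H, x))) (g ` H)) = g ` span (insert (w (H, x)) H)"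
          using linear_span_image[OF orthogonal_transformation_linear[OF g(1)], of "insert (w (H, x)) H"] by simp
        ultimately show "((`) g \<circ> T) p = (T \<circ> S) p"
          using p by (simp add: T_def Hx S_def wg)
      qed
    qed auto
    also have "\<dots> = distr (distr P P S) GB T" by (subst distr_distr) auto
    finally show ?thesis by (simp add: dP)
  qed
  moreover have "prob_space (distr P GB T)" using Tm by (rule prob_space.prob_space_distr[OF pP])
  ultimately have "invariant_grassmannian_measure n (Suc k) (distr P GB T)"
    by (simp add: invariant_grassmannian_measure_def GB_def)
  then show ?thesis by blast
qed

lemma invariant_grassmannian_measure_exists:
  "k \<le> n \<Longrightarrow> \<exists>M. invariant_grassmannian_measure n k M"
proof (induction k)
  case 0
  obtain H where H: "H \<in> grassmannian n 0" using grassmannian_nonempty by blast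
  let ?M = "return (grassmannian_borel n 0) H"
  have "distr ?M ?M ((`) g) = ?M" if g: "orthogonal_transformation g" "g ` Euclid n = Euclid n" for g
  proof -
    have z: "H' = {0}" if "H' \<in> grassmannian n 0" for H'
      using grassmannian_basis[OF that] by (auto simp: orthonormal_basis_def)
    then have "g ` H = H" using z[OF H] z[OF grassmannian_image[OF g H]] by simp
    moreover have "distr ?M ?M ((`) g) = distr ?M (grassmannian_borel n 0) ((`) g)"
      by (rule distr_cong) auto
    ultimately show ?thesis
      using distr_return[OF image_grassmannian_measurable[OF g], of H 0] H by simp
  qed
  then show ?case
    using H by (intro exI[of _ ?M]) (auto simp: invariant_grassmannian_measure_def intro!: prob_space_return)
qed (use invariant_grassmannian_measure_step in force)

lemma haar_grassmannian_invariant: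
  assumes "k \<le> n"
  shows "invariant_grassmannian_measure n k (haar_grassmannian n k)"
  using invariant_grassmannian_measure_exists[OF assms] haar_grassmannianI by metis

subsection \<open>Simultaneous diagonalisation\<close>

text \<open>Compactness comes from the product topology on functions: a product of intervals is
  compact, and the coordinates from d on are pinned to 0. Within it the vectors of Euclidean norm 1
  form a closed set that parametrises the unit sphere of V.\<close>

lemma attains_max_sphere:
  fixes \<phi> :: "fseq \<Rightarrow> real"
  assumes b: "orthonormal_basis V d b" and d: "d > 0" and \<phi>: "continuous_on UNIV \<phi>"
  shows "\<exists>u\<in>V. norm u = 1 \<and> (\<forall>v\<in>V. norm v = 1 \<longrightarrow> \<phi> v \<le> \<phi> u)"
proof -
  note F = orthonormal_basis_family[OF b]
  define C where "C i = (if i < d then {-1..1} else {0::real})" for i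
  define K where "K = Pi\<^sub>E UNIV C \<inter> {x. (\<Sum>i<d. (x i)\<^sup>2) = 1}"
  have "compactin (product_topology (\<lambda>i. euclidean) UNIV) (Pi\<^sub>E UNIV C)"
    unfolding compactin_PiE by (auto simp: C_def)
  then have "compact (Pi\<^sub>E UNIV C)" by (simp only: euclidean_product_topology compactin_euclidean_iff)
  moreover have "closed {x::nat\<Rightarrow>real. (\<Sum>i<d. (x i)\<^sup>2) = 1}"
    by (intro closed_Collect_eq continuous_intros continuous_on_product_coordinates)
  ultimately have cK: "compact K" unfolding K_def by (rule compact_Int_closed)
  have cont: "continuous_on K (\<lambda>x. \<phi> (lincomb d b x))"
    unfolding lincomb_def
    by (intro continuous_on_compose2[OF \<phi>] continuous_intros
        continuous_on_subset[OF continuous_on_product_coordinates]) auto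
  have coords: "(\<lambda>i. if i < d then v \<bullet> b i else 0) \<in> K" if "v \<in> V" "norm v = 1" for v
  proof -
    have "(\<Sum>i<d. (v \<bullet> b i)\<^sup>2) = 1"
      using norm_proj_family_sq[OF F, of v] orthonormal_basis_expand[OF b that(1)] that by simp
    moreover have "\<bar>v \<bullet> b i\<bar> \<le> 1" if "i < d" for i
      using Cauchy_Schwarz_ineq2[of v "b i"] \<open>norm v = 1\<close> orthonormal_familyD[OF F that that]
      by (simp add: norm_eq_1[of "b i", symmetric])
    ultimately show ?thesis by (force simp: K_def C_def PiE_iff abs_le_iff)
  qed
  have "K \<noteq> {}"
    using coords[OF orthonormal_basis_mem[OF b d]] orthonormal_familyD[OF F d d] by (auto simp: norm_eq_1)
  then have "\<exists>x\<in>K. \<forall>y\<in>K. \<phi> (lincomb d b y) \<le> \<phi> (lincomb d b x)"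
    using continuous_attains_sup[OF cK _ cont] by simp
  then obtain x where x: "x \<in> K" "\<And>y. y \<in> K \<Longrightarrow> \<phi> (lincomb d b y) \<le> \<phi> (lincomb d b x)" by blast
  have "\<phi> v \<le> \<phi> (lincomb d b x)" if "v \<in> V" "norm v = 1" for v
  proof -
    have "v = lincomb d b (\<lambda>i. if i < d then v \<bullet> b i else 0)"
      by (subst orthonormal_basis_expand[OF b that(1), symmetric]) (auto intro: lincomb_cong)
    then show ?thesis using x(2)[OF coords[OF that]] by simp
  qed
  moreover have "norm (lincomb d b x) = 1" using x(1) by (simp add: K_def norm_lincomb[OF F])
  ultimately show ?thesis using lincomb_mem[OF b] by blast
qed

text \<open>The first-order condition at a maximum: for s of the sign of B and small, the linear
  term would win. The choice s = B / k with k positive and larger than c is small enough.\<close>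

lemma linear_le_quadratic_zero:
  assumes "\<And>s::real. 2 * s * B \<le> s\<^sup>2 * c"
  shows "B = 0"
proof (rule ccontr)
  assume B: "B \<noteq> 0"
  define k where "k = \<bar>c\<bar> + 1"
  have k: "k > 0" "c < k" by (auto simp: k_def)
  have "2 * (B / k) * B \<le> (B / k)\<^sup>2 * c" by (rule assms)
  then have "2 * B\<^sup>2 * k \<le> B\<^sup>2 * c" using k by (simp add: field_simps power2_eq_square)
  moreover have "B\<^sup>2 * c < B\<^sup>2 * k" using k B by (intro mult_strict_left_mono) auto
  moreover have "0 < B\<^sup>2 * k" using k B by simp
  ultimately show False by linarith
qed

lemma span_insert_span: "span (insert u (span S)) = span (insert u (S :: fseq set))"
proof
  show "span (insert u (span S)) \<subseteq> span (insert u S)"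
    using span_mono[of S "insert u S"] by (intro span_minimal) (auto intro: span_base)
  show "span (insert u S) \<subseteq> span (insert u (span S))"
    using span_superset[of S] by (intro span_mono) auto
qed

text \<open>The spectral theorem for the compression of a projection to F, by induction on d. A unit
  vector u maximising \<open>orth_proj H v \<bullet> v\<close> on F is perturbed to u + s v with v
  orthogonal to u; the vanishing first-order term says that \<open>orth_proj H u\<close> is
  orthogonal to v. That vector may leave F, but only its inner products with F matter. The rest of
  the basis comes from the complement of u in F.\<close>

lemma diagonal_basis_exists:
  assumes H: "H \<in> grassmannian n k" and b: "orthonormal_basis F d b" and F: "F \<subseteq> Euclid n"
  shows "\<exists>f. orthonormal_basis F d f \<and> (\<forall>i<d. \<forall>j<d. i \<noteq> j \<longrightarrow> orth_proj H (f i) \<bullet> f j = 0)"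
  using b F
proof (induction d arbitrary: F b)
  case 0
  then show ?case by (intro exI[of _ b]) auto
next
  case (Suc d)
  let ?P = "orth_proj H"
  have lin: "linear ?P" and adj: "\<And>x y. ?P x \<bullet> y = x \<bullet> ?P y" using orth_proj_grassmannian[OF H] by auto
  obtain c where c: "orthonormal_basis H k c" using grassmannian_basis[OF H] by blast
  have "continuous_on UNIV (\<lambda>x. ?P x \<bullet> x)"
    unfolding orth_proj_eq[OF c] lincomb_def by (intro continuous_intros)
  then obtain u where u: "u \<in> F" "norm u = 1" and max: "\<And>v. v \<in> F \<Longrightarrow> norm v = 1 \<Longrightarrow> ?P v \<bullet> v \<le> ?P u \<bullet> u"
    using attains_max_sphere[OF Suc.prems(1)] by blast
  have sF: "subspace F" using Suc.prems(1) by (rule orthonormal_basis_subspace)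
  have eig: "?P u \<bullet> v = 0" if v: "v \<in> F" "u \<bullet> v = 0" for v
  proof (rule linear_le_quadratic_zero)
    fix s :: real
    define y where "y = u + s *\<^sub>R v"
    have yF: "y \<in> F" using u v sF by (simp add: y_def subspace_add subspace_scale)
    have uu: "u \<bullet> u = 1" using u by (simp add: norm_eq_1)
    have yy: "(norm y)\<^sup>2 = 1 + s\<^sup>2 * (v \<bullet> v)"
      unfolding power2_norm_eq_inner using uu v by (simp add: y_def inner_add_left inner_add_right inner_commute[of v u] power2_eq_square)
    then have "(norm y)\<^sup>2 > 0" by (auto intro: add_pos_nonneg)
    then have y0: "norm y > 0" by auto
    have "?P (y /\<^sub>R norm y) \<bullet> (y /\<^sub>R norm y) \<le> ?P u \<bullet> u"
      using y0 yF sF by (intro max) (auto simp: subspace_scale)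
    then have "?P y \<bullet> y \<le> (norm y)\<^sup>2 * (?P u \<bullet> u)"
      using y0 by (simp add: linear_scale[OF lin] field_simps power2_eq_square)
    moreover have "?P y \<bullet> y = ?P u \<bullet> u + 2 * s * (?P u \<bullet> v) + s\<^sup>2 * (?P v \<bullet> v)"
      using adj[of v u] by (simp add: y_def linear_add[OF lin] linear_scale[OF lin] inner_add_left inner_add_right
          inner_commute[of v "?P u"] power2_eq_square algebra_simps)
    ultimately show "2 * s * (?P u \<bullet> v) \<le> s\<^sup>2 * ((v \<bullet> v) * (?P u \<bullet> u) - ?P v \<bullet> v)"
      by (simp add: yy algebra_simps)
  qed
  have dimF: "dim F = Suc d" using Suc.prems(1) by (rule orthonormal_basis_dim)
  obtain e where e: "orthonormal_basis F (Suc d) e" "e 0 = u"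
    using orthonormal_basis_first[OF sF Suc.prems(2) u] by (auto simp: dimF)
  define F' where "F' = span ((\<lambda>i. e (Suc i)) ` {..<d})"
  have e': "orthonormal_basis F' d (\<lambda>i. e (Suc i))"
    using orthonormal_basis_family[OF e(1)] by (auto simp: F'_def orthonormal_basis_def orthonormal_family_def)
  have split: "span (insert u F') = F"
  proof -
    have img: "e ` {..<Suc d} = insert u ((\<lambda>i. e (Suc i)) ` {..<d})"
      by (simp add: lessThan_Suc_eq_insert_0 image_image e(2))
    show ?thesis using e(1) img by (simp add: F'_def span_insert_span orthonormal_basis_def)
  qed
  have F'F: "F' \<subseteq> F" using span_superset[of "insert u F'"] split by auto
  have orth: "u \<bullet> v = 0" if "v \<in> F'" for v
    using that unfolding F'_def
  proof (rule span_induct)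
    show "u \<bullet> x = 0" if "x \<in> (\<lambda>i. e (Suc i)) ` {..<d}" for x
      using that orthonormal_familyD[OF orthonormal_basis_family[OF e(1)], of 0] e(2) by auto
  qed (auto simp: subspace_def inner_add_right)
  obtain f' where f': "orthonormal_basis F' d f'" "\<And>i j. i < d \<Longrightarrow> j < d \<Longrightarrow> i \<noteq> j \<Longrightarrow> ?P (f' i) \<bullet> f' j = 0"
    using Suc.IH[OF e'] F'F Suc.prems(2) by blast
  define f where "f i = (case i of 0 \<Rightarrow> u | Suc j \<Rightarrow> f' j)" for i
  have f'm: "f' i \<in> F'" if "i < d" for i by (rule orthonormal_basis_mem[OF f'(1) that])
  have "orthonormal_family (Suc d) f"
    using orthonormal_basis_family[OF f'(1)] orth[OF f'm] u
    by (auto simp: orthonormal_family_def f_def norm_eq_1 inner_commute[of "f' _" u] split: nat.split)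
  moreover have "span (f ` {..<Suc d}) = F"
  proof -
    have img: "f ` {..<Suc d} = insert u (f' ` {..<d})"
      by (simp add: lessThan_Suc_eq_insert_0 image_image f_def)
    have "span (insert u (f' ` {..<d})) = span (insert u F')"
      using f'(1) span_insert_span[of u "f' ` {..<d}"] by (simp add: orthonormal_basis_def)
    then show ?thesis using img split by simp
  qed
  moreover have "?P (f i) \<bullet> f j = 0" if "i < Suc d" "j < Suc d" "i \<noteq> j" for i j
  proof -
    have e0: "?P u \<bullet> f' m = 0" if "m < d" for m using eig orth f'm[OF that] F'F by blast
    then have "?P (f' m) \<bullet> u = 0" if "m < d" for m using that adj[of "f' m" u] by (simp add: inner_commute)
    with e0 show ?thesis using that f'(2) by (cases i; cases j) (auto simp: f_def)
  qed
  ultimately show ?case by (auto simp: orthonormal_basis_def intro!: exI[of _ f])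
qed

subsection \<open>Concentration of the projected norm\<close>

text \<open>Multiplying the standard density by \<open>exp (a * x^2)\<close> gives s times the
  normal density with variance s^2 = 1 / (1 - 2 a), so no integral has to be evaluated.\<close>

lemma nn_integral_exp_std_normal:
  assumes "a < 1 / 2"
  shows "(\<integral>\<^sup>+x. ennreal (exp (a * x\<^sup>2)) \<partial>density lborel (\<lambda>x. ennreal (std_normal_density x)))
    = ennreal (1 / sqrt (1 - 2 * a))"
proof -
  define s where "s = 1 / sqrt (1 - 2 * a)"
  have s: "s > 0" "s\<^sup>2 = 1 / (1 - 2 * a)" using assms by (simp_all add: s_def power_divide)
  have eq: "std_normal_density x * exp (a * x\<^sup>2) = s * normal_density 0 s x" for x
  proof -
    have "- x\<^sup>2 / 2 + a * x\<^sup>2 = - x\<^sup>2 / (2 * s\<^sup>2)" using assms by (simp add: s(2) field_simps)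
    moreover have "sqrt (2 * pi * s\<^sup>2) = sqrt (2 * pi) * s" using s(1) by (simp add: real_sqrt_mult)
    ultimately show ?thesis using s(1) by (simp add: std_normal_density_def normal_density_def exp_add[symmetric])
  qed
  have "(\<integral>\<^sup>+x. ennreal (exp (a * x\<^sup>2)) \<partial>density lborel (\<lambda>x. ennreal (std_normal_density x)))
    = (\<integral>\<^sup>+x. ennreal s * ennreal (normal_density 0 s x) \<partial>lborel)"
    using s by (subst nn_integral_density) (auto simp: ennreal_mult[symmetric] eq)
  also have "\<dots> = ennreal s * (\<integral>\<^sup>+x. ennreal (normal_density 0 s x) \<partial>lborel)"
    by (rule nn_integral_cmult) simp
  also have "(\<integral>\<^sup>+x. ennreal (normal_density 0 s x) \<partial>lborel) = 1"
    using prob_space.emeasure_space_1[OF prob_space_normal_density[OF s(1), of 0]]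
    by (simp add: emeasure_density)
  finally show ?thesis by (simp add: s_def)
qed

text \<open>The indicator of q >= 0 is at most exp q, and the expectation of exp q factorises by
  independence. The free parameter of the Chernoff method is absorbed in the coefficients
  \<open>a\<close>.\<close>

lemma gaussian_chernoff:
  assumes I: "finite I" and a: "\<And>i. i \<in> I \<Longrightarrow> a i < 1 / 2"
  shows "measure (gaussian_prod I) {x \<in> space (gaussian_prod I). 0 \<le> (\<Sum>i\<in>I. a i * (x i)\<^sup>2)}
    \<le> (\<Prod>i\<in>I. 1 / sqrt (1 - 2 * a i))"
proof -
  interpret prob_space "gaussian_prod I" by (rule prob_space_gaussian_prod)
  let ?A = "{x \<in> space (gaussian_prod I). 0 \<le> (\<Sum>i\<in>I. a i * (x i)\<^sup>2)}"
  have A: "?A \<in> sets (gaussian_prod I)" by measurable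
  have "emeasure (gaussian_prod I) ?A = (\<integral>\<^sup>+x. indicator ?A x \<partial>gaussian_prod I)" using A by simp
  also have "\<dots> \<le> (\<integral>\<^sup>+x. (\<Prod>i\<in>I. ennreal (exp (a i * (x i)\<^sup>2))) \<partial>gaussian_prod I)"
  proof (rule nn_integral_mono)
    fix x
    have "(\<Prod>i\<in>I. ennreal (exp (a i * (x i)\<^sup>2))) = ennreal (exp (\<Sum>i\<in>I. a i * (x i)\<^sup>2))"
      using I by (simp add: prod_ennreal exp_sum)
    then show "indicator ?A x \<le> (\<Prod>i\<in>I. ennreal (exp (a i * (x i)\<^sup>2)))"
      by (auto split: split_indicator)
  qed
  also have "\<dots> = (\<Prod>i\<in>I. \<integral>\<^sup>+x. ennreal (exp (a i * x\<^sup>2)) \<partial>density lborel (\<lambda>x. ennreal (std_normal_density x)))"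
    using I by (intro gaussian_prod.product_nn_integral_prod) auto
  also have "\<dots> = (\<Prod>i\<in>I. ennreal (1 / sqrt (1 - 2 * a i)))"
    using a by (intro prod.cong refl nn_integral_exp_std_normal)
  also have "\<dots> = ennreal (\<Prod>i\<in>I. 1 / sqrt (1 - 2 * a i))"
    by (intro prod_ennreal) (use a in force)
  finally have "ennreal (measure (gaussian_prod I) ?A) \<le> ennreal (\<Prod>i\<in>I. 1 / sqrt (1 - 2 * a i))"
    by (simp add: emeasure_eq_measure)
  moreover have "0 \<le> (\<Prod>i\<in>I. 1 / sqrt (1 - 2 * a i))" by (intro prod_nonneg) (use a in force)
  ultimately show ?thesis by (simp add: ennreal_le_iff)
qed

lemma ln_one_plus_ge_half: "0 \<le> x \<Longrightarrow> x \<le> 1 / 2 \<Longrightarrow> x / 2 \<le> ln (1 + x)" for x :: real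
  using ln_one_plus_pos_lower_bound[of x] mult_left_mono[of x "1/2" x] by (simp add: power2_eq_square)

text \<open>The condition \<open>2 * p \<le> n + 1\<close> admits both floor and ceiling of n / 2,
  so that the bound also covers the complement when n is odd. The one surplus coordinate is what the
  factor 2 pays for.\<close>

lemma projection_upper_tail:
  assumes H: "H \<in> grassmannian n p" and p: "2 * p \<le> n + 1" and t: "0 < t" "t \<le> 1 / 4"
  shows "measure (gauss_on (Euclid n)) {x. x \<in> Euclid n \<and> t * (norm x)\<^sup>2 < (norm (orth_proj H x))\<^sup>2 - (norm x)\<^sup>2 / 2}
    \<le> 2 * exp (- (t\<^sup>2 * n) / 2)"
proof -
  obtain b where b: "orthonormal_basis (Euclid n) n b" "orthonormal_basis H p b" "p \<le> n"
    using grassmannian_basis[OF H] by blast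
  note F = orthonormal_basis_family[OF b(1)] and F2 = orthonormal_basis_family[OF b(2)]
  note [measurable] = orth_proj_borel_measurable[OF b(2)]
  interpret prob_space "gaussian_prod {..<n}" by (rule prob_space_gaussian_prod)
  \<comment> \<open>The event reads: (1/2 - t) times the squares before p exceeds (1/2 + t) times
    the others. These coefficients are that difference times the Chernoff parameter 2 t; u and v
    below are the resulting values of 1 - 2 a.\<close>
  define a where "a i = (if i < p then t * (1 - 2 * t) else - t * (1 + 2 * t))" for i
  define u where "u = 1 - 2 * t + 4 * t\<^sup>2"
  define v where "v = 1 + 2 * t + 4 * t\<^sup>2"
  let ?A = "{x. x \<in> Euclid n \<and> t * (norm x)\<^sup>2 < (norm (orth_proj H x))\<^sup>2 - (norm x)\<^sup>2 / 2}"
  have A: "?A \<in> sets borel" by measurable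
  have "measure (gauss_on (Euclid n)) ?A
     = measure (gaussian_prod {..<n}) (lincomb n b -` ?A \<inter> space (gaussian_prod {..<n}))"
    unfolding gauss_on_eq[OF b(1)] using A by (intro measure_distr) auto
  also have "\<dots> \<le> measure (gaussian_prod {..<n}) {x \<in> space (gaussian_prod {..<n}). 0 \<le> (\<Sum>i\<in>{..<n}. a i * (x i)\<^sup>2)}"
  proof (rule finite_measure_mono)
    show "lincomb n b -` ?A \<inter> space (gaussian_prod {..<n})
      \<subseteq> {x \<in> space (gaussian_prod {..<n}). 0 \<le> (\<Sum>i\<in>{..<n}. a i * (x i)\<^sup>2)}"
    proof safe
      fix x assume "t * (norm (lincomb n b x))\<^sup>2 < (norm (orth_proj H (lincomb n b x)))\<^sup>2 - (norm (lincomb n b x))\<^sup>2 / 2"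
      moreover have "(norm (orth_proj H (lincomb n b x)))\<^sup>2 = (\<Sum>i<p. (x i)\<^sup>2)"
        using b(3) unfolding orth_proj_eq[OF b(2)] norm_lincomb_sq[OF F2]
        by (intro sum.cong) (auto simp: inner_lincomb[OF F])
      ultimately have "0 < (\<Sum>i<p. (x i)\<^sup>2) - (1/2 + t) * (\<Sum>i<n. (x i)\<^sup>2)"
        by (simp add: norm_lincomb_sq[OF F] algebra_simps)
      then have "0 \<le> 2 * t * ((\<Sum>i<p. (x i)\<^sup>2) - (1/2 + t) * (\<Sum>i<n. (x i)\<^sup>2))" using t by simp
      also have "(\<Sum>i<p. (x i)\<^sup>2) = (\<Sum>i<n. if i < p then (x i)\<^sup>2 else 0)"
        using b(3) by (intro sum.mono_neutral_cong_left) auto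
      also have "2 * t * ((\<Sum>i<n. if i < p then (x i)\<^sup>2 else 0) - (1/2 + t) * (\<Sum>i<n. (x i)\<^sup>2)) = (\<Sum>i<n. a i * (x i)\<^sup>2)"
        by (simp add: sum_distrib_left sum_subtractf[symmetric] a_def algebra_simps if_distrib cong: if_cong)
          (intro sum.cong; simp add: algebra_simps)
      finally show "0 \<le> (\<Sum>i\<in>{..<n}. a i * (x i)\<^sup>2)" .
    qed
  qed measurable
  also have "\<dots> \<le> (\<Prod>i\<in>{..<n}. 1 / sqrt (1 - 2 * a i))"
  proof (rule gaussian_chernoff)
    fix i
    have "t * (1 - 2 * t) \<le> (1/4) * 1" using t by (intro mult_mono) auto
    moreover have "- t * (1 + 2 * t) \<le> 0" using t by (simp add: mult_nonneg_nonneg)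
    ultimately show "a i < 1 / 2" by (auto simp: a_def)
  qed simp
  also have "\<dots> = (1 / sqrt u) ^ p * (1 / sqrt v) ^ (n - p)"
  proof -
    have "(\<Prod>i\<in>{..<n}. 1 / sqrt (1 - 2 * a i)) = (\<Prod>i\<in>{..<p} \<union> {p..<n}. 1 / sqrt (1 - 2 * a i))"
      using b(3) by (intro prod.cong) auto
    also have "\<dots> = (\<Prod>i\<in>{..<p}. 1 / sqrt (1 - 2 * a i)) * (\<Prod>i\<in>{p..<n}. 1 / sqrt (1 - 2 * a i))"
      by (intro prod.union_disjoint) auto
    also have "(\<Prod>i\<in>{..<p}. 1 / sqrt (1 - 2 * a i)) = (\<Prod>i\<in>{..<p}. 1 / sqrt u)"
      by (intro prod.cong) (auto simp: a_def u_def algebra_simps power2_eq_square)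
    also have "(\<Prod>i\<in>{p..<n}. 1 / sqrt (1 - 2 * a i)) = (\<Prod>i\<in>{p..<n}. 1 / sqrt v)"
      by (intro prod.cong) (auto simp: a_def v_def algebra_simps power2_eq_square)
    finally show ?thesis by simp
  qed
  also have "\<dots> \<le> 2 * exp (- (t\<^sup>2 * n) / 2)"
  proof -
    have u: "u \<ge> 1/2" "u \<le> 1" and v: "v \<ge> 1" "v \<le> 2"
    proof -
      have "4 * t\<^sup>2 \<le> t" using t mult_left_mono[of t "1/4" t] by (simp add: power2_eq_square)
      then show "u \<ge> 1/2" "u \<le> 1" "v \<ge> 1" "v \<le> 2" using t zero_le_power2[of t] unfolding u_def v_def by linarith+
    qed
    have lu: "ln u \<ge> - ln 2" using u ln_mono[of "1/2" u] by (simp add: ln_div)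
    have lu2: "ln u \<le> 0" using u by simp
    have lv: "ln v \<le> ln 2" "ln v \<ge> 0" using v by auto
    have "u * v = 1 + 4 * t\<^sup>2 + 16 * (t\<^sup>2)\<^sup>2" unfolding u_def v_def by algebra
    then have uv: "1 + 4 * t\<^sup>2 \<le> u * v" by simp
    have "t\<^sup>2 \<le> (1/4)\<^sup>2" using t by (intro power_mono) auto
    then have "2 * t\<^sup>2 \<le> ln (1 + 4 * t\<^sup>2)" using ln_one_plus_ge_half[of "4 * t\<^sup>2"] by (simp add: power2_eq_square)
    also have "\<dots> \<le> ln (u * v)" using uv by (intro ln_mono) (auto intro: add_pos_nonneg)
    also have "\<dots> = ln u + ln v" using u v by (simp add: ln_mult)
    finally have S: "2 * t\<^sup>2 \<le> ln u + ln v" .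
    have "(1 / sqrt u) ^ p * (1 / sqrt v) ^ (n - p) = exp (- (p * ln u + (n - p) * ln v) / 2)"
    proof -
      have r: "1 / sqrt z = exp (- ln z / 2)" if "z > 0" for z :: real
        using that by (simp add: ln_sqrt[symmetric] exp_minus inverse_eq_divide)
      show ?thesis using u v b(3)
        by (simp add: r exp_of_nat_mult[symmetric] exp_add[symmetric] of_nat_diff field_simps)
    qed
    also have "\<dots> \<le> exp (ln 2 - (t\<^sup>2 * n) / 2)"
    proof -
      have "real n * (2 * t\<^sup>2) \<le> real n * (ln u + ln v)" by (intro mult_left_mono S) simp
      \<comment> \<open>The exponent splits into the balanced part n (ln u + ln v) and this
        imbalance, in which 2 p - n is at most 1.\<close>
      moreover have "(2 * real p - real n) * (ln v - ln u) \<le> 1 * (2 * ln 2)"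
      proof (cases "2 * real p - real n \<ge> 0")
        case True
        moreover have "2 * real p \<le> real n + 1" using p by linarith
        ultimately show ?thesis using lu lu2 lv by (intro mult_mono) linarith+
      next
        case False
        then have "(2 * real p - real n) * (ln v - ln u) \<le> 0"
          using lv lu2 by (intro mult_nonpos_nonneg) linarith+
        then show ?thesis by (smt (verit) ln_2_less_1 ln_gt_zero)
      qed
      ultimately have "2 * (real n * t\<^sup>2) - 2 * ln 2 \<le> 2 * (p * ln u + (real n - p) * ln v)"
        by (simp add: algebra_simps)
      moreover have "0 \<le> ln (2::real)" by simp
      ultimately have "- (p * ln u + (real n - p) * ln v) / 2 \<le> ln 2 - (t\<^sup>2 * n) / 2"
        unfolding mult.commute[of "t\<^sup>2"] by linarith
      then show ?thesis using b(3) by (simp add: of_nat_diff)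
    qed
    also have "\<dots> = 2 * exp (- (t\<^sup>2 * n) / 2)"
      using exp_add[of "ln 2" "- (t\<^sup>2 * n) / 2"] by simp
    finally show ?thesis .
  qed
  finally show ?thesis .
qed

text \<open>By Pythagoras the lower tail for H is the upper tail for its orthogonal
  complement.\<close>

lemma projection_tail:
  assumes H: "H \<in> grassmannian n (n div 2)" and t: "0 < t" "t \<le> 1 / 4"
  shows "measure (gauss_on (Euclid n)) {x. x \<in> Euclid n \<and> t * (norm x)\<^sup>2 < \<bar>(norm (orth_proj H x))\<^sup>2 - (norm x)\<^sup>2 / 2\<bar>}
    \<le> 4 * exp (- (t\<^sup>2 * n) / 2)"
proof -
  interpret prob_space "gauss_on (Euclid n)" by (rule prob_space_gauss_on)
  obtain b where b: "orthonormal_basis (Euclid n) n b" "orthonormal_basis H (n div 2) b" "n div 2 \<le> n"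
    using grassmannian_basis[OF H] by blast
  let ?H' = "orthogonal_comp H \<inter> Euclid n"
  note b' = orthonormal_basis_complement[OF b]
  have H': "?H' \<in> grassmannian n (n - n div 2)" by (rule grassmannianI[OF b']) auto
  let ?A = "\<lambda>H. {x. x \<in> Euclid n \<and> t * (norm x)\<^sup>2 < (norm (orth_proj H x))\<^sup>2 - (norm x)\<^sup>2 / 2}"
  note [measurable] = orth_proj_borel_measurable[OF b(2)] orth_proj_borel_measurable[OF b']
  have m: "?A H \<in> sets borel" "?A ?H' \<in> sets borel" by measurable
  have "{x. x \<in> Euclid n \<and> t * (norm x)\<^sup>2 < \<bar>(norm (orth_proj H x))\<^sup>2 - (norm x)\<^sup>2 / 2\<bar>} \<subseteq> ?A H \<union> ?A ?H'"
  proof safe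
    fix x assume x: "x \<in> Euclid n" "t * (norm x)\<^sup>2 < \<bar>(norm (orth_proj H x))\<^sup>2 - (norm x)\<^sup>2 / 2\<bar>"
      "\<not> t * (norm x)\<^sup>2 < (norm (orth_proj ?H' x))\<^sup>2 - (norm x)\<^sup>2 / 2"
    have "(norm x)\<^sup>2 = (norm (orth_proj H x))\<^sup>2 + (norm (orth_proj ?H' x))\<^sup>2"
      using norm_proj_pythagoras[OF b(2), of x] orth_proj_complement[OF b x(1)] by (simp add: orth_proj_eq[OF b(2)])
    then show "t * (norm x)\<^sup>2 < (norm (orth_proj H x))\<^sup>2 - (norm x)\<^sup>2 / 2" using x(2,3) by linarith
  qed
  then have "measure (gauss_on (Euclid n)) {x. x \<in> Euclid n \<and> t * (norm x)\<^sup>2 < \<bar>(norm (orth_proj H x))\<^sup>2 - (norm x)\<^sup>2 / 2\<bar>}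
    \<le> measure (gauss_on (Euclid n)) (?A H \<union> ?A ?H')"
    using m by (intro finite_measure_mono) auto
  also have "\<dots> \<le> measure (gauss_on (Euclid n)) (?A H) + measure (gauss_on (Euclid n)) (?A ?H')"
    using m by (intro measure_Un_le) auto
  also have "\<dots> \<le> 2 * exp (- (t\<^sup>2 * n) / 2) + 2 * exp (- (t\<^sup>2 * n) / 2)"
    by (intro add_mono projection_upper_tail[OF H _ t] projection_upper_tail[OF H' _ t]) auto
  finally show ?thesis by simp
qed

text \<open>The condition is homogeneous in x, so net points of any norm can be tested without
  normalising; for x = 0 there are no bad subspaces.\<close>

definition bad_subspaces :: "nat \<Rightarrow> nat \<Rightarrow> real \<Rightarrow> fseq \<Rightarrow> fseq set set" where
  "bad_subspaces n k t x =
     {H \<in> grassmannian n k. t * (norm x)\<^sup>2 < \<bar>(norm (orth_proj H x))\<^sup>2 - (norm x)\<^sup>2 / 2\<bar>}"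

lemma bad_subspaces_sets:
  assumes "x \<in> Euclid n"
  shows "bad_subspaces n k t x \<in> sets (grassmannian_borel n k)"
proof -
  have [measurable]: "(\<lambda>H. orth_proj H x) \<in> borel_measurable (grassmannian_borel n k)"
    by (rule orth_proj_measurable[where n=n and k=k]) (use assms in auto)
  have "{H \<in> space (grassmannian_borel n k). t * (norm x)\<^sup>2 < \<bar>(norm (orth_proj H x))\<^sup>2 - (norm x)\<^sup>2 / 2\<bar>} \<in> sets (grassmannian_borel n k)"
    by measurable
  then show ?thesis by (simp add: bad_subspaces_def)
qed

lemma measure_bad_subspaces_eq:
  assumes M: "invariant_grassmannian_measure n k M" and x: "x \<in> Euclid n" "x \<noteq> 0" and y: "y \<in> Euclid n" "y \<noteq> 0"
  shows "emeasure M (bad_subspaces n k t x) = emeasure M (bad_subspaces n k t y)"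
proof -
  have sM: "sets M = sets (grassmannian_borel n k)" using M by (simp add: invariant_grassmannian_measure_def)
  have spM: "space M = grassmannian n k" using sets_eq_imp_space_eq[OF sM] by simp
  obtain g where g: "orthogonal_transformation g" "g (x /\<^sub>R norm x) = y /\<^sub>R norm y" "g ` Euclid n = Euclid n"
    using orthogonal_transformation_transitive[OF subspace_Euclid subset_refl, of "x /\<^sub>R norm x" n "y /\<^sub>R norm y"]
      x y by (auto simp: subspace_scale[OF subspace_Euclid])
  define c where "c = norm y / norm x"
  have c: "c > 0" using x y by (simp add: c_def)
  have gx: "g x = (1 / c) *\<^sub>R y"
  proof -
    have "g x = norm x *\<^sub>R g (x /\<^sub>R norm x)"
      using x linear_scale[OF orthogonal_transformation_linear[OF g(1)], of "norm x" "x /\<^sub>R norm x"] by simp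
    then show ?thesis using g(2) by (simp add: c_def divide_inverse)
  qed
  have "emeasure M (bad_subspaces n k t y) = emeasure (distr M M ((`) g)) (bad_subspaces n k t y)"
    using M g by (simp add: invariant_grassmannian_measure_def)
  also have "\<dots> = emeasure M ((`) g -` bad_subspaces n k t y \<inter> space M)"
    using image_grassmannian_measurable[OF g(1,3), of k] bad_subspaces_sets[OF y(1)]
    by (intro emeasure_distr) (simp_all add: sM measurable_cong_sets[OF sM sM])
  also have "(`) g -` bad_subspaces n k t y \<inter> space M = bad_subspaces n k t x"
  proof -
    have "g ` H \<in> bad_subspaces n k t y \<longleftrightarrow> H \<in> bad_subspaces n k t x" if H: "H \<in> grassmannian n k" for H
    proof -
      have gH: "g ` H \<in> grassmannian n k" by (rule grassmannian_image[OF g(1,3) H])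
      have "y = c *\<^sub>R g x" using gx c by simp
      then have "orth_proj (g ` H) y = c *\<^sub>R g (orth_proj H x)"
        using linear_scale[OF orth_proj_grassmannian(1)[OF gH]] orth_proj_grassmannian_image[OF g(1) H] by metis
      then have "norm (orth_proj (g ` H) y) = c * norm (orth_proj H x)"
        using c orthogonal_transformation_norm[OF g(1)] by simp
      moreover have "norm y = c * norm x" using x by (simp add: c_def)
      ultimately have "t * (norm y)\<^sup>2 < \<bar>(norm (orth_proj (g ` H) y))\<^sup>2 - (norm y)\<^sup>2 / 2\<bar>
        \<longleftrightarrow> t * (c * norm x)\<^sup>2 < \<bar>(c * norm (orth_proj H x))\<^sup>2 - (c * norm x)\<^sup>2 / 2\<bar>" by simp
      also have "t * (c * norm x)\<^sup>2 = c\<^sup>2 * (t * (norm x)\<^sup>2)" by (simp add: power_mult_distrib)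
      also have "\<bar>(c * norm (orth_proj H x))\<^sup>2 - (c * norm x)\<^sup>2 / 2\<bar> = c\<^sup>2 * \<bar>(norm (orth_proj H x))\<^sup>2 - (norm x)\<^sup>2 / 2\<bar>"
      proof -
        have "(c * norm (orth_proj H x))\<^sup>2 - (c * norm x)\<^sup>2 / 2 = c\<^sup>2 * ((norm (orth_proj H x))\<^sup>2 - (norm x)\<^sup>2 / 2)"
          by (simp add: power_mult_distrib algebra_simps)
        then show ?thesis by (simp only: abs_mult) simp
      qed
      also have "c\<^sup>2 * (t * (norm x)\<^sup>2) < c\<^sup>2 * \<bar>(norm (orth_proj H x))\<^sup>2 - (norm x)\<^sup>2 / 2\<bar>
        \<longleftrightarrow> t * (norm x)\<^sup>2 < \<bar>(norm (orth_proj H x))\<^sup>2 - (norm x)\<^sup>2 / 2\<bar>"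
        using c by (intro mult_less_cancel_left_pos) simp
      finally show ?thesis using H gH by (simp add: bad_subspaces_def)
    qed
    then show ?thesis by (auto simp: spM bad_subspaces_def)
  qed
  finally show ?thesis ..
qed

text \<open>By invariance the probability of a bad subspace does not depend on the direction, so the
  direction may be randomised and, after exchanging the order of integration, the subspace fixed.\<close>

lemma measure_bad_subspaces:
  assumes x: "x \<in> Euclid n" "x \<noteq> 0" and t: "0 < t" "t \<le> 1 / 4"
  shows "measure (haar_grassmannian n (n div 2)) (bad_subspaces n (n div 2) t x) \<le> 4 * exp (- (t\<^sup>2 * n) / 2)"
proof -
  define k where "k = n div 2"
  define M where "M = haar_grassmannian n k"
  have M: "invariant_grassmannian_measure n k M"
    unfolding M_def by (rule haar_grassmannian_invariant) (simp add: k_def)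
  have sM: "sets M = sets (grassmannian_borel n k)" and pM: "prob_space M"
    using M by (simp_all add: invariant_grassmannian_measure_def)
  have spM: "space M = grassmannian n k" using sets_eq_imp_space_eq[OF sM] by simp
  interpret M: prob_space M by fact
  define G where "G = gauss_on (Euclid n)"
  have sG [measurable_cong]: "sets G = sets borel" and spG: "space G = UNIV" by (simp_all add: G_def)
  interpret G: prob_space G unfolding G_def by (rule prob_space_gauss_on)
  interpret P: pair_prob_space M G ..
  have n: "n > 0"
  proof (rule ccontr)
    assume "\<not> n > 0"
    then have "x = 0" using x(1) by (auto simp: Euclid_def intro: fseq_eqI)
    then show False using x by simp
  qed
  let ?P = "M \<Otimes>\<^sub>M G"
  have fstm: "fst \<in> measurable ?P (grassmannian_borel n k)"
    using measurable_fst[of M G] by (simp add: measurable_cong_sets[OF refl sM])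
  have sndm [measurable]: "snd \<in> borel_measurable ?P"
    using measurable_snd[of M G] by (simp add: measurable_cong_sets[OF refl sG])
  have om [measurable]: "(\<lambda>p. orth_proj (fst p) (unit_fseq i)) \<in> borel_measurable ?P" for i
    by (rule measurable_compose[OF fstm orth_proj_unit_measurable])
  \<comment> \<open>For y in \<open>Euclid n\<close> this is the projection of y onto H, in a form
    that is measurable in the pair.\<close>
  define pr where "pr p = (\<Sum>i<n. coord (snd p) i *\<^sub>R orth_proj (fst p) (unit_fseq i))" for p
  have [measurable]: "pr \<in> borel_measurable ?P" unfolding pr_def by measurable
  define I where "I H y = (indicator {p. snd p \<in> Euclid n \<and>
     t * (norm (snd p))\<^sup>2 < \<bar>(norm (pr p))\<^sup>2 - (norm (snd p))\<^sup>2 / 2\<bar>} (H, y) :: ennreal)" for H y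
  have Im: "(\<lambda>(H, y). I H y) \<in> borel_measurable ?P"
    unfolding I_def by measurable
  have I: "I H y = indicator (bad_subspaces n k t y) H" if "H \<in> grassmannian n k" "y \<in> Euclid n" for H y
    using that orth_proj_expand[OF that] by (auto simp: I_def pr_def bad_subspaces_def split: split_indicator)
  have I0: "I H y = 0" if "y \<notin> Euclid n" for H y using that by (simp add: I_def)
  have "emeasure M (bad_subspaces n k t x) = (\<integral>\<^sup>+y. emeasure M (bad_subspaces n k t x) \<partial>G)"
    by (simp add: G.emeasure_space_1)
  also have "\<dots> = (\<integral>\<^sup>+y. (\<integral>\<^sup>+H. I H y \<partial>M) \<partial>G)"
  proof (rule nn_integral_cong_AE)
    have "AE y in G. y \<in> Euclid n \<and> y \<noteq> 0"
      using AE_gauss_on_mem[OF orthonormal_basis_unit[of n]] AE_gauss_on_nonzero[OF orthonormal_basis_unit n] unfolding G_def by eventually_elim simp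
    then show "AE y in G. emeasure M (bad_subspaces n k t x) = (\<integral>\<^sup>+H. I H y \<partial>M)"
    proof eventually_elim
      fix y assume y: "y \<in> Euclid n \<and> y \<noteq> 0"
      have "(\<integral>\<^sup>+H. I H y \<partial>M) = (\<integral>\<^sup>+H. indicator (bad_subspaces n k t y) H \<partial>M)"
        using y by (intro nn_integral_cong I) (auto simp: spM)
      also have "\<dots> = emeasure M (bad_subspaces n k t y)"
        using bad_subspaces_sets[of y n k t] y by (simp add: sM)
      finally show "emeasure M (bad_subspaces n k t x) = (\<integral>\<^sup>+H. I H y \<partial>M)"
        using measure_bad_subspaces_eq[OF M x, of y t] y by simp
    qed
  qed
  also have "\<dots> = (\<integral>\<^sup>+H. (\<integral>\<^sup>+y. I H y \<partial>G) \<partial>M)" by (rule P.Fubini'[OF Im])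
  also have "\<dots> \<le> (\<integral>\<^sup>+H. ennreal (4 * exp (- (t\<^sup>2 * n) / 2)) \<partial>M)"
  proof (rule nn_integral_mono)
    fix H assume "H \<in> space M"
    then have H: "H \<in> grassmannian n k" by (simp add: spM)
    let ?A = "{x. x \<in> Euclid n \<and> t * (norm x)\<^sup>2 < \<bar>(norm (orth_proj H x))\<^sup>2 - (norm x)\<^sup>2 / 2\<bar>}"
    obtain b where b: "orthonormal_basis H k b" using grassmannian_basis[OF H] by blast
    note [measurable] = orth_proj_borel_measurable[OF b]
    have A: "?A \<in> sets borel" by measurable
    have "(\<integral>\<^sup>+y. I H y \<partial>G) = (\<integral>\<^sup>+y. indicator ?A y \<partial>G)"
    proof (rule nn_integral_cong)
      fix y
      show "I H y = indicator ?A y"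
        using I[OF H, of y] I0[of y H] H
        by (cases "y \<in> Euclid n") (auto simp: bad_subspaces_def split: split_indicator)
    qed
    also have "\<dots> = ennreal (measure G ?A)" using A by (simp add: G.emeasure_eq_measure sG)
    also have "\<dots> \<le> ennreal (4 * exp (- (t\<^sup>2 * n) / 2))"
      using projection_tail[OF _ t, of H n] H unfolding G_def k_def by (intro ennreal_leI) simp
    finally show "(\<integral>\<^sup>+y. I H y \<partial>G) \<le> ennreal (4 * exp (- (t\<^sup>2 * n) / 2))" .
  qed
  also have "\<dots> = ennreal (4 * exp (- (t\<^sup>2 * n) / 2))" by (simp add: M.emeasure_space_1)
  finally have "ennreal (measure M (bad_subspaces n k t x)) \<le> ennreal (4 * exp (- (t\<^sup>2 * n) / 2))"
    by (simp only: M.emeasure_eq_measure)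
  then show ?thesis by (simp add: M_def k_def)
qed

subsection \<open>A net of lattice points\<close>

text \<open>The subtracted term makes the induction close: passing to N + 1 adds two terms, each at
  most (1/2)^(N + 1).\<close>

lemma sum_exp_sq_le: "(\<Sum>k\<in>{- int N..int N}. exp (- (real_of_int k)\<^sup>2)) \<le> 3 - 2 * (1/2) ^ N"
proof (induction N)
  case (Suc N)
  have "{- int (Suc N)..int (Suc N)} = insert (- int (Suc N)) (insert (int (Suc N)) {- int N..int N})" by auto
  then have "(\<Sum>k\<in>{- int (Suc N)..int (Suc N)}. exp (- (real_of_int k)\<^sup>2))
     = 2 * exp (- (real (Suc N))\<^sup>2) + (\<Sum>k\<in>{- int N..int N}. exp (- (real_of_int k)\<^sup>2))"
    by (simp add: power2_eq_square algebra_simps)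
  moreover have "exp (- (real (Suc N))\<^sup>2) \<le> (1/2) ^ Suc N"
  proof -
    have "real (Suc N) * 1 \<le> real (Suc N) * real (Suc N)" by (intro mult_left_mono) auto
    then have "exp (- (real (Suc N))\<^sup>2) \<le> exp (real (Suc N) * (-1))"
      unfolding exp_le_cancel_iff power2_eq_square by linarith
    also have "\<dots> = exp (-1) ^ Suc N" by (rule exp_of_nat_mult)
    also have "\<dots> \<le> (1/2) ^ Suc N"
    proof (rule power_mono)
      have "2 \<le> exp (1::real)" using exp_ge_add_one_self[of 1] by simp
      then show "exp (-1) \<le> (1/2 :: real)" by (simp add: exp_minus field_simps)
    qed simp
    finally show ?thesis .
  qed
  ultimately show ?case using Suc by simp
qed simp

text \<open>The integer points of the ball of radius K sqrt l in dimension l, presented as part of a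
  finite product over which sums of products factorise.\<close>

definition lattice_ball :: "nat \<Rightarrow> nat \<Rightarrow> (nat \<Rightarrow> int) set" where
  "lattice_ball K l = {z \<in> PiE {..<l} (\<lambda>_. {- int (K * l)..int (K * l)}). (\<Sum>i<l. (real_of_int (z i))\<^sup>2) \<le> real (K\<^sup>2 * l)}"

text \<open>Count with Gaussian weights: every point of the ball has exp (K^2 l - |z|^2) >= 1, and
  summing this weight over the whole box factorises into l sums, each at most 3 and hence at most
  exp 2.\<close>

lemma card_lattice_ball:
  "finite (lattice_ball K l)" "real (card (lattice_ball K l)) \<le> exp (real ((K\<^sup>2 + 2) * l))"
proof -
  let ?P = "PiE {..<l} (\<lambda>_. {- int (K * l)..int (K * l)})"
  have fP: "finite ?P" by (intro finite_PiE) auto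
  have sub: "lattice_ball K l \<subseteq> ?P" by (auto simp: lattice_ball_def)
  then show "finite (lattice_ball K l)" using fP finite_subset by blast
  have "real (card (lattice_ball K l)) = (\<Sum>z\<in>lattice_ball K l. 1)" by simp
  also have "\<dots> \<le> (\<Sum>z\<in>lattice_ball K l. exp (real (K\<^sup>2 * l)) * (\<Prod>i<l. exp (- (real_of_int (z i))\<^sup>2)))"
  proof (rule sum_mono)
    fix z assume "z \<in> lattice_ball K l"
    then have "0 \<le> real (K\<^sup>2 * l) - (\<Sum>i<l. (real_of_int (z i))\<^sup>2)" by (simp add: lattice_ball_def)
    then have "1 \<le> exp (real (K\<^sup>2 * l) + (\<Sum>i<l. - (real_of_int (z i))\<^sup>2))" by (simp add: sum_negf)
    then show "1 \<le> exp (real (K\<^sup>2 * l)) * (\<Prod>i<l. exp (- (real_of_int (z i))\<^sup>2))" by (simp only: exp_add exp_sum finite_lessThan)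
  qed
  also have "\<dots> \<le> (\<Sum>z\<in>?P. exp (real (K\<^sup>2 * l)) * (\<Prod>i<l. exp (- (real_of_int (z i))\<^sup>2)))"
    by (intro sum_mono2 fP sub) (simp add: prod_nonneg)
  also have "\<dots> = exp (real (K\<^sup>2 * l)) * (\<Prod>i<l. \<Sum>k\<in>{- int (K * l)..int (K * l)}. exp (- (real_of_int k)\<^sup>2))"
    by (subst prod_sum_PiE) (simp_all add: sum_distrib_left)
  also have "\<dots> \<le> exp (real (K\<^sup>2 * l)) * (\<Prod>i<l. exp 2)"
  proof (intro mult_left_mono prod_mono conjI sum_nonneg)
    have "3 \<le> exp (2::real)" using exp_ge_add_one_self[of 2] by simp
    then show "(\<Sum>k\<in>{- int (K * l)..int (K * l)}. exp (- (real_of_int k)\<^sup>2)) \<le> exp 2"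
      using sum_exp_sq_le[of "K * l"] zero_le_power[of "1/2::real" "K*l"] by linarith
  qed auto
  also have "\<dots> = exp (real ((K\<^sup>2 + 2) * l))"
    by (simp add: exp_of_nat_mult[symmetric] exp_add[symmetric] algebra_simps)
  finally show "real (card (lattice_ball K l)) \<le> exp (real ((K\<^sup>2 + 2) * l))" .
qed

text \<open>Rounding towards zero, because rounding to the nearest integer could lengthen the vector
  and push it out of the lattice ball.\<close>

lemma truncate_toward_zero: "\<exists>z::int. \<bar>real_of_int z\<bar> \<le> \<bar>a\<bar> \<and> \<bar>a - real_of_int z\<bar> \<le> 1" for a :: real
proof (cases "a \<ge> 0")
  case True
  then show ?thesis by (intro exI[of _ "\<lfloor>a\<rfloor>"]) (auto simp: abs_le_iff; linarith)
next
  case False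
  then show ?thesis by (intro exI[of _ "\<lceil>a\<rceil>"]) (auto simp: abs_le_iff; linarith)
qed

text \<open>With mesh 1 / (K sqrt l) the l coordinate errors add up to a Euclidean error of at most
  1 / K.\<close>

definition lattice_net :: "nat \<Rightarrow> nat \<Rightarrow> (nat \<Rightarrow> fseq) \<Rightarrow> fseq set" where
  "lattice_net K l f = (\<lambda>z. lincomb l f (\<lambda>i. real_of_int (z i) / (K * sqrt l))) ` lattice_ball K l"

lemma lattice_net_approx:
  assumes f: "orthonormal_basis F l f" and y: "y \<in> F" "norm y = 1" and K: "K > 0"
  shows "\<exists>u\<in>lattice_net K l f. norm u \<le> 1 \<and> norm (y - u) \<le> 1 / K"
proof -
  note Of = orthonormal_basis_family[OF f]
  have l: "l > 0"
  proof (rule ccontr)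
    assume "\<not> l > 0"
    then show False using orthonormal_basis_expand[OF f y(1)] y(2) by (simp add: lincomb_def)
  qed
  define c where "c = K * sqrt l"
  have c: "c > 0" using K l by (simp add: c_def)
  have c2: "c\<^sup>2 = real (K\<^sup>2 * l)" by (simp add: c_def power_mult_distrib)
  define a where "a i = y \<bullet> f i" for i
  have a: "(\<Sum>i<l. (a i)\<^sup>2) = 1"
    using norm_proj_family_sq[OF Of, of y] orthonormal_basis_expand[OF f y(1)] y(2) by (simp add: a_def)
  have "\<forall>i. \<exists>z::int. \<bar>real_of_int z\<bar> \<le> \<bar>c * a i\<bar> \<and> \<bar>c * a i - real_of_int z\<bar> \<le> 1"
    using truncate_toward_zero by blast
  then obtain z0 :: "nat \<Rightarrow> int" where "\<forall>i. \<bar>real_of_int (z0 i)\<bar> \<le> \<bar>c * a i\<bar> \<and> \<bar>c * a i - real_of_int (z0 i)\<bar> \<le> 1"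
    using choice by metis
  then have z0: "\<bar>real_of_int (z0 i)\<bar> \<le> \<bar>c * a i\<bar>" "\<bar>c * a i - real_of_int (z0 i)\<bar> \<le> 1" for i by auto
  define z where "z = restrict z0 {..<l}"
  have sq: "(\<Sum>i<l. (real_of_int (z i))\<^sup>2) \<le> c\<^sup>2"
  proof -
    have "(\<Sum>i<l. (real_of_int (z i))\<^sup>2) \<le> (\<Sum>i<l. (c * a i)\<^sup>2)"
      using z0(1) by (intro sum_mono) (simp add: z_def abs_le_square_iff)
    also have "\<dots> = c\<^sup>2 * (\<Sum>i<l. (a i)\<^sup>2)" by (simp add: power_mult_distrib sum_distrib_left)
    finally show ?thesis by (simp add: a)
  qed
  have "\<bar>z i\<bar> \<le> int (K * l)" if "i < l" for i
  proof -
    have "(real_of_int (z i))\<^sup>2 \<le> (\<Sum>i<l. (real_of_int (z i))\<^sup>2)" using that by (intro member_le_sum) auto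
    also have "\<dots> \<le> real (K\<^sup>2 * l)" using sq by (simp add: c2)
    also have "\<dots> \<le> (real (K * l))\<^sup>2" using l mult_left_mono[of 1 "real l" "(real K)\<^sup>2 * real l"]
      by (simp add: power_mult_distrib power2_eq_square mult_ac)
    finally have "\<bar>real_of_int (z i)\<bar> \<le> \<bar>real (K * l)\<bar>" by (simp only: abs_le_square_iff)
    then show ?thesis by linarith
  qed
  then have zL: "z \<in> lattice_ball K l"
    using sq c2 by (force simp: lattice_ball_def z_def PiE_iff abs_le_iff)
  let ?u = "lincomb l f (\<lambda>i. real_of_int (z i) / c)"
  have "(norm ?u)\<^sup>2 = (\<Sum>i<l. (real_of_int (z i))\<^sup>2) / c\<^sup>2"
    by (simp add: norm_lincomb_sq[OF Of] power_divide sum_divide_distrib)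
  also have "\<dots> \<le> 1\<^sup>2" using sq c by simp
  finally have n1: "norm ?u \<le> 1" by (rule power2_le_imp_le) simp
  have "y - ?u = lincomb l f (\<lambda>i. a i - real_of_int (z i) / c)"
    unfolding lincomb_diff a_def by (simp add: orthonormal_basis_expand[OF f y(1)])
  then have "(norm (y - ?u))\<^sup>2 = (\<Sum>i<l. (a i - real_of_int (z i) / c)\<^sup>2)" by (simp add: norm_lincomb_sq[OF Of])
  also have "\<dots> \<le> (\<Sum>i<l. (1 / c)\<^sup>2)"
  proof (rule sum_mono)
    fix i assume "i \<in> {..<l}"
    then have "a i - real_of_int (z i) / c = (c * a i - real_of_int (z0 i)) / c"
      using c by (simp add: z_def field_simps)
    then have "\<bar>a i - real_of_int (z i) / c\<bar> = \<bar>c * a i - real_of_int (z0 i)\<bar> / c"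
      using c by simp
    also have "\<dots> \<le> 1 / c" using z0(2)[of i] c by (intro divide_right_mono) auto
    finally show "(a i - real_of_int (z i) / c)\<^sup>2 \<le> (1 / c)\<^sup>2" using c by (simp add: abs_le_square_iff[symmetric])
  qed
  also have "\<dots> = (1 / K)\<^sup>2" using l K by (simp add: power_divide c2)
  finally have "norm (y - ?u) \<le> 1 / K" by (rule power2_le_imp_le) simp
  then show ?thesis using n1 zL unfolding lattice_net_def c_def[symmetric] by (auto intro!: bexI[OF _ zL])
qed

text \<open>Let s be the supremum of the deviation |q| over the unit sphere of F. Moving to a net
  point at distance at most 1/8 changes q by at most s / 4, so s <= t + s / 4. Absorbing s / 4
  requires s to be finite, which follows from |q| <= 1/2 on unit vectors.\<close>

lemma projection_near_half_from_net:
  assumes H: "H \<in> grassmannian n k" and f: "orthonormal_basis F l f" and F: "F \<subseteq> Euclid n"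
    and net: "\<And>u. u \<in> lattice_net 8 l f \<Longrightarrow> H \<notin> bad_subspaces n k t u" and t: "t > 0"
    and y: "y \<in> F" "norm y = 1"
  shows "\<bar>(norm (orth_proj H y))\<^sup>2 - 1 / 2\<bar> \<le> 2 * t"
proof -
  let ?P = "orth_proj H"
  have lin: "linear ?P" using orth_proj_grassmannian(1)[OF H] .
  define q where "q x = (norm (?P x))\<^sup>2 - (norm x)\<^sup>2 / 2" for x
  define B where "B x y = ?P x \<bullet> ?P y - (x \<bullet> y) / 2" for x y
  have qB: "q x = B x x" for x by (simp add: q_def B_def power2_norm_eq_inner)
  have B_add: "B (x + y) z = B x z + B y z" "B z (x + y) = B z x + B z y"
    "B (x - y) z = B x z - B y z" "B z (x - y) = B z x - B z y" "B x y = B y x"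
    "B (r *\<^sub>R x) y = r * B x y" "B x (r *\<^sub>R y) = r * B x y" for x y z r
    by (simp_all add: B_def linear_add[OF lin] linear_diff[OF lin] linear_scale[OF lin] inner_add_left inner_add_right inner_diff_left
        inner_diff_right inner_commute algebra_simps add_divide_distrib diff_divide_distrib)
  have sF: "subspace F" using f by (rule orthonormal_basis_subspace)
  have qbound: "\<bar>q x\<bar> \<le> (norm x)\<^sup>2 / 2" for x
  proof -
    obtain c where c: "orthonormal_basis H k c" using grassmannian_basis[OF H] by blast
    show ?thesis using norm_proj_pythagoras[OF c, of x] zero_le_power2[of "norm (?P x)"]
      zero_le_power2[of "norm (x - ?P x)"] unfolding orth_proj_eq[OF c] q_def by linarith
  qed
  define U where "U = (\<lambda>x. \<bar>q x\<bar>) ` {x \<in> F. norm x = 1}"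
  define s where "s = Sup U"
  have bdd: "bdd_above U"
  proof (rule bdd_aboveI[of _ "1/2"])
    fix r assume "r \<in> U"
    then obtain x where "r = \<bar>q x\<bar>" "norm x = 1" by (auto simp: U_def)
    then show "r \<le> 1 / 2" using qbound[of x] by simp
  qed
  have s_le: "\<bar>q x\<bar> \<le> s" if "x \<in> F" "norm x = 1" for x
    unfolding s_def using that bdd by (intro cSup_upper) (auto simp: U_def)
  have s0: "0 \<le> s" using s_le[OF y] by linarith
  have s_hom: "\<bar>q x\<bar> \<le> s * (norm x)\<^sup>2" if "x \<in> F" for x
  proof (cases "x = 0")
    case False
    have "\<bar>q (x /\<^sub>R norm x)\<bar> \<le> s" using False that sF by (intro s_le) (auto simp: subspace_scale)
    then show ?thesis using False by (simp add: qB B_add abs_mult field_simps power2_eq_square)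
  qed (simp add: q_def linear_0[OF lin])
  have B_le: "\<bar>B a b\<bar> \<le> s * ((norm a)\<^sup>2 + (norm b)\<^sup>2) / 2" if ab: "a \<in> F" "b \<in> F" for a b
  proof -
    have "4 * B a b = q (a + b) - q (a - b)" by (simp add: qB B_add)
    then have "4 * \<bar>B a b\<bar> \<le> \<bar>q (a + b)\<bar> + \<bar>q (a - b)\<bar>" by linarith
    also have "\<dots> \<le> s * (norm (a + b))\<^sup>2 + s * (norm (a - b))\<^sup>2"
      using ab sF by (intro add_mono s_hom) (auto simp: subspace_add subspace_diff)
    also have "\<dots> = s * (2 * (norm a)\<^sup>2 + 2 * (norm b)\<^sup>2)"
      unfolding power2_norm_eq_inner by (simp add: inner_add_left inner_add_right inner_diff_left inner_diff_right inner_commute algebra_simps)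
    finally show ?thesis by (simp add: algebra_simps)
  qed
  have "\<bar>q x\<bar> \<le> t + s / 4" if x: "x \<in> F" "norm x = 1" for x
  proof -
    obtain u where u: "u \<in> lattice_net 8 l f" "norm u \<le> 1" "norm (x - u) \<le> 1 / 8"
      using lattice_net_approx[OF f x, of 8] by auto
    have uF: "u \<in> F" using u(1) lincomb_mem[OF f] by (auto simp: lattice_net_def)
    have "\<bar>q u\<bar> \<le> t * (norm u)\<^sup>2" using net[OF u(1)] H by (simp add: bad_subspaces_def q_def)
    also have "\<dots> \<le> t * 1" using u(2) t by (intro mult_left_mono) (auto simp: power_le_one)
    finally have qu: "\<bar>q u\<bar> \<le> t" by simp
    \<comment> \<open>This is B (x - u) (x + u). The norms are at most 1/8 and 2; since
      \<open>B_le\<close> bounds by a sum of squares, the factors 4 and 1/4 balance both to at most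
      1/2.\<close>
    have "q x - q u = B (4 *\<^sub>R (x - u)) ((1/4) *\<^sub>R (x + u))" by (simp add: qB B_add)
    also have "\<bar>\<dots>\<bar> \<le> s * ((norm (4 *\<^sub>R (x - u)))\<^sup>2 + (norm ((1/4) *\<^sub>R (x + u)))\<^sup>2) / 2"
      using x uF sF by (intro B_le) (auto simp: subspace_add subspace_diff subspace_scale)
    also have "\<dots> \<le> s * ((1/2)\<^sup>2 + (1/2)\<^sup>2) / 2"
    proof (intro divide_right_mono mult_left_mono add_mono power_mono s0)
      show "norm (4 *\<^sub>R (x - u)) \<le> 1 / 2" using u(3) by simp
      show "norm ((1/4) *\<^sub>R (x + u)) \<le> 1 / 2" using norm_triangle_ineq[of x u] x u(2) by simp
    qed auto
    finally show ?thesis using qu abs_triangle_ineq[of "q x - q u" "q u"] by (simp add: power2_eq_square)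
  qed
  then have "s \<le> t + s / 4"
    unfolding s_def using y by (intro cSup_least) (auto simp: U_def s_def[unfolded U_def])
  then have "s \<le> 2 * t" using t by linarith
  then show ?thesis using s_le[OF y] y(2) by (simp add: q_def)
qed

text \<open>A union bound over the net with K = 8, whence 66 = 8^2 + 2. The conclusion names a set
  G, the complement of finitely many bad events, because G is visibly measurable while the condition
  on all y in F is uncountable.\<close>

lemma measure_good_subspaces:
  assumes f: "orthonormal_basis F l f" and F: "F \<subseteq> Euclid n" and t: "0 < t" "t \<le> 1 / 4"
  shows "\<exists>G \<in> sets (haar_grassmannian n (n div 2)).
     measure (haar_grassmannian n (n div 2)) G \<ge> 1 - 4 * exp (66 * real l - t\<^sup>2 * n / 2) \<and>
     (\<forall>H\<in>G. H \<in> grassmannian n (n div 2) \<and> (\<forall>y\<in>F. norm y = 1 \<longrightarrow> \<bar>(norm (orth_proj H y))\<^sup>2 - 1 / 2\<bar> \<le> 2 * t))"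
proof -
  let ?k = "n div 2"
  let ?M = "haar_grassmannian n ?k"
  have M: "invariant_grassmannian_measure n ?k ?M" by (rule haar_grassmannian_invariant) simp
  have sM: "sets ?M = sets (grassmannian_borel n ?k)" and pM: "prob_space ?M"
    using M by (simp_all add: invariant_grassmannian_measure_def)
  have spM: "space ?M = grassmannian n ?k" using sets_eq_imp_space_eq[OF sM] by simp
  interpret prob_space ?M by (rule pM)
  let ?N = "lattice_net 8 l f"
  have NE: "u \<in> Euclid n" if "u \<in> ?N" for u using that lincomb_mem[OF f] F by (auto simp: lattice_net_def)
  have fN: "finite ?N" and cN: "real (card ?N) \<le> exp (66 * real l)"
  proof -
    show "finite ?N" unfolding lattice_net_def by (intro finite_imageI card_lattice_ball)
    have "real (card ?N) \<le> real (card (lattice_ball 8 l))"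
      unfolding lattice_net_def by (intro of_nat_mono card_image_le card_lattice_ball)
    also have "\<dots> \<le> exp (66 * real l)" using card_lattice_ball(2)[of 8 l] by simp
    finally show "real (card ?N) \<le> exp (66 * real l)" .
  qed
  let ?Bad = "\<Union>u\<in>?N. bad_subspaces n ?k t u"
  have mB: "bad_subspaces n ?k t u \<in> sets ?M" if "u \<in> ?N" for u
    using bad_subspaces_sets[OF NE[OF that]] by (simp add: sM)
  have "measure ?M ?Bad \<le> (\<Sum>u\<in>?N. measure ?M (bad_subspaces n ?k t u))"
    using mB fN by (intro finite_measure_subadditive_finite) auto
  also have "\<dots> \<le> (\<Sum>u\<in>?N. 4 * exp (- (t\<^sup>2 * n) / 2))"
  proof (rule sum_mono)
    fix u assume u: "u \<in> ?N"
    show "measure ?M (bad_subspaces n ?k t u) \<le> 4 * exp (- (t\<^sup>2 * n) / 2)"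
    proof (cases "u = 0")
      case True
      have "bad_subspaces n ?k t u = {}"
        using True linear_0[OF orth_proj_grassmannian(1)] by (auto simp: bad_subspaces_def)
      then show ?thesis by simp
    qed (use measure_bad_subspaces[OF NE[OF u] _ t] in auto)
  qed
  also have "\<dots> \<le> exp (66 * real l) * (4 * exp (- (t\<^sup>2 * n) / 2))"
    using cN by (simp add: mult_right_mono)
  also have "\<dots> = 4 * exp (66 * real l - t\<^sup>2 * n / 2)" by (simp add: exp_add[symmetric] exp_diff exp_minus field_simps)
  finally have "measure ?M ?Bad \<le> 4 * exp (66 * real l - t\<^sup>2 * n / 2)" .
  moreover have BadM: "?Bad \<in> sets ?M" using mB fN by auto
  ultimately have "measure ?M (space ?M - ?Bad) \<ge> 1 - 4 * exp (66 * real l - t\<^sup>2 * n / 2)"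
    by (simp add: prob_compl)
  moreover have "\<bar>(norm (orth_proj H y))\<^sup>2 - 1 / 2\<bar> \<le> 2 * t"
    if "H \<in> space ?M - ?Bad" "y \<in> F" "norm y = 1" for H y
    using that by (intro projection_near_half_from_net[OF _ f F _ t(1)]) (auto simp: spM)
  moreover have "H \<in> grassmannian n ?k" if "H \<in> space ?M - ?Bad" for H using that by (simp add: spM)
  ultimately show ?thesis by (intro bexI[OF _ sets.compl_sets[OF BadM]]) blast
qed

subsection \<open>Densities of projections of the sphere\<close>

text \<open>The unit ball lies between the cubes of half side 1/k and 1, with k the dimension.
  Positivity and finiteness are enough, as the volume is later eliminated by normalisation.\<close>

lemma sum_sq_unit_volume:
  assumes J: "finite J" "J \<noteq> {}"
  shows "0 < emeasure (lebesgue_prod J) {w \<in> space (lebesgue_prod J). (\<Sum>i\<in>J. (w i)\<^sup>2) \<le> 1}"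
    and "emeasure (lebesgue_prod J) {w \<in> space (lebesgue_prod J). (\<Sum>i\<in>J. (w i)\<^sup>2) \<le> 1} < \<infinity>"
proof -
  let ?A = "{w \<in> space (lebesgue_prod J). (\<Sum>i\<in>J. (w i)\<^sup>2) \<le> 1}"
  define k where "k = real (card J)"
  have k: "k \<ge> 1" using J by (simp add: k_def Suc_le_eq card_gt_0_iff)
  have A: "?A \<in> sets (lebesgue_prod J)" by measurable
  have "(0::ennreal) < (\<Prod>i\<in>J. emeasure lborel {-1/k..1/k})"
    using k J(1) by (simp add: ennreal_power)
  also have "\<dots> = emeasure (lebesgue_prod J) (\<Pi>\<^sub>E i\<in>J. {-1/k..1/k})"
    using J by (subst lebesgue_prod.emeasure_PiM) auto
  also have "\<dots> \<le> emeasure (lebesgue_prod J) ?A"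
  proof (rule emeasure_mono[OF _ A], safe)
    fix w assume w: "w \<in> (\<Pi>\<^sub>E i\<in>J. {-1/k..1/k})"
    then show "w \<in> space (lebesgue_prod J)" by (auto simp: space_PiM)
    have "(\<Sum>i\<in>J. (w i)\<^sup>2) \<le> (\<Sum>i\<in>J. (1/k)\<^sup>2)"
      using w k by (intro sum_mono) (auto simp: PiE_iff abs_le_square_iff[symmetric] abs_le_iff minus_le_iff)
    also have "\<dots> = 1 / k" using k by (simp add: k_def power2_eq_square)
    also have "\<dots> \<le> 1" using k by simp
    finally show "(\<Sum>i\<in>J. (w i)\<^sup>2) \<le> 1" .
  qed
  finally show "0 < emeasure (lebesgue_prod J) ?A" .
  have "emeasure (lebesgue_prod J) ?A \<le> emeasure (lebesgue_prod J) (\<Pi>\<^sub>E i\<in>J. {-1..1})"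
  proof (rule emeasure_mono, rule subsetI)
    fix w assume "w \<in> {w \<in> space (lebesgue_prod J). (\<Sum>i\<in>J. (w i)\<^sup>2) \<le> 1}"
    then have w: "w \<in> space (lebesgue_prod J)" "(\<Sum>i\<in>J. (w i)\<^sup>2) \<le> 1" by auto
    have "w i \<in> {-1..1}" if "i \<in> J" for i
    proof -
      have "(w i)\<^sup>2 \<le> (\<Sum>i\<in>J. (w i)\<^sup>2)" using that J by (intro member_le_sum) auto
      then have "(w i)\<^sup>2 \<le> 1" using w(2) by linarith
      then have "\<bar>w i\<bar> \<le> 1" by (simp only: abs_square_le_1)
      then show ?thesis by auto
    qed
    then show "w \<in> (\<Pi>\<^sub>E i\<in>J. {-1..1})" using w by (auto simp: space_PiM PiE_iff)
  qed (use J in \<open>auto intro!: sets_PiM_I_finite\<close>)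
  also have "\<dots> < \<infinity>"
    using J by (subst lebesgue_prod.emeasure_PiM) (auto simp: less_top[symmetric] power_eq_top_ennreal)
  finally show "emeasure (lebesgue_prod J) ?A < \<infinity>" .
qed

lemma sqrt_power_powr: "a > 0 \<Longrightarrow> sqrt a ^ k = a powr (real k / 2)"
  by (simp add: powr_half_sqrt[symmetric] powr_realpow[symmetric] powr_powr)

text \<open>By scaling, the ball of squared radius a has volume \<open>V0 * a powr (k / 2)\<close>;
  differentiating in a gives the density. The constant stays implicit until the Gaussian
  normalisation determines it.\<close>

lemma distr_lebesgue_sum_sq:
  assumes J: "finite J" "J \<noteq> {}"
  shows "\<exists>V>0. distr (lebesgue_prod J) borel (\<lambda>w. \<Sum>i\<in>J. (w i)\<^sup>2)
    = density lborel (\<lambda>s. ennreal (V * s powr (card J / 2 - 1)) * indicator {0..} s)"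
proof -
  let ?S = "\<lambda>w::nat\<Rightarrow>real. \<Sum>i\<in>J. (w i)\<^sup>2"
  let ?k = "card J"
  have k: "?k > 0" using J by (simp add: card_gt_0_iff)
  let ?E = "\<lambda>a. emeasure (lebesgue_prod J) {w \<in> space (lebesgue_prod J). ?S w \<le> a}"
  obtain V0 where V0: "V0 > 0" "?E 1 = ennreal V0"
    using sum_sq_unit_volume[OF J] by (cases "?E 1") auto
  \<comment> \<open>The factor k / 2 comes from differentiating
    \<open>a powr (k / 2)\<close>.\<close>
  define V where "V = V0 * ?k / 2"
  have V: "V > 0" using V0 k by (simp add: V_def)
  let ?D = "density lborel (\<lambda>s. ennreal (V * s powr (?k / 2 - 1)) * indicator {0..} s)"
  have Sm [measurable]: "?S \<in> borel_measurable (lebesgue_prod J)" by measurable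
  have E: "?E a = ennreal (V0 * a powr (?k / 2))" if "a \<ge> 0" for a
  proof (cases "a = 0")
    case True
    have "?E a \<le> emeasure (lebesgue_prod J) (Pi\<^sub>E J (\<lambda>_. {0}))"
    proof (rule emeasure_mono, rule subsetI)
      fix w assume "w \<in> {w \<in> space (lebesgue_prod J). ?S w \<le> a}"
      then have w: "w \<in> space (lebesgue_prod J)" "?S w \<le> a" by auto
      then have "?S w = 0" using True by (intro antisym sum_nonneg) auto
      then show "w \<in> Pi\<^sub>E J (\<lambda>_. {0})" using J w by (auto simp: sum_nonneg_eq_0_iff space_PiM extensional_def fun_eq_iff)
    qed (intro sets_PiM_I_finite J, simp)
    also have "\<dots> = 0" using J k by (subst lebesgue_prod.emeasure_PiM) auto
    finally show ?thesis using True by simp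
  next
    case False
    then have a: "a > 0" using that by simp
    have "?E a = (\<integral>\<^sup>+w. indicator {w \<in> space (lebesgue_prod J). ?S w \<le> a} w \<partial>lebesgue_prod J)"
      by (rule nn_integral_indicator[symmetric]) measurable
    also have "\<dots> = (\<integral>\<^sup>+w. indicator {w. ?S w \<le> a} w \<partial>lebesgue_prod J)"
      by (rule nn_integral_cong) (simp split: split_indicator)
    also have "\<dots> = (\<Prod>i\<in>J. ennreal \<bar>sqrt a\<bar>) * (\<integral>\<^sup>+w. indicator {w. ?S w \<le> a} (\<lambda>i\<in>J. 0 + sqrt a * w i) \<partial>lebesgue_prod J)"
      using a by (intro nn_integral_lebesgue_prod_affine J) auto
    also have "(\<integral>\<^sup>+w. indicator {w. ?S w \<le> a} (\<lambda>i\<in>J. 0 + sqrt a * w i) \<partial>lebesgue_prod J) = ?E 1"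
    proof -
      have "(\<integral>\<^sup>+w. indicator {w. ?S w \<le> a} (\<lambda>i\<in>J. 0 + sqrt a * w i) \<partial>lebesgue_prod J)
        = (\<integral>\<^sup>+w. indicator {w \<in> space (lebesgue_prod J). ?S w \<le> 1} w \<partial>lebesgue_prod J)"
      proof (rule nn_integral_cong)
        fix w assume "w \<in> space (lebesgue_prod J)"
        moreover have "?S (\<lambda>i\<in>J. 0 + sqrt a * w i) = a * ?S w"
          using a by (simp add: power_mult_distrib sum_distrib_left)
        ultimately show "indicator {w. ?S w \<le> a} (\<lambda>i\<in>J. 0 + sqrt a * w i)
          = (indicator {w \<in> space (lebesgue_prod J). ?S w \<le> 1} w :: ennreal)"
          using a by (simp split: split_indicator)
      qed
      also have "\<dots> = ?E 1" by (rule nn_integral_indicator) measurable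
      finally show ?thesis .
    qed
    also have "(\<Prod>i\<in>J. ennreal \<bar>sqrt a\<bar>) = ennreal (a powr (?k / 2))"
      using a by (simp add: ennreal_power sqrt_power_powr)
    finally show ?thesis using V0 by (simp add: ennreal_mult'[symmetric] mult.commute)
  qed
  have "distr (lebesgue_prod J) borel ?S = ?D"
  proof (rule measure_eqI_generator_eq[where E="range atMost" and \<Omega>=UNIV and A="\<lambda>n. {..real n}"])
    have eqM: "emeasure (distr (lebesgue_prod J) borel ?S) {..a} = ?E a" for a
      by (subst emeasure_distr) (auto intro!: arg_cong[where f="emeasure _"])
    show "emeasure (distr (lebesgue_prod J) borel ?S) X = emeasure ?D X" if "X \<in> range atMost" for X
    proof -
      obtain a where X: "X = {..a}" using \<open>X \<in> range atMost\<close> by auto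
      have D: "emeasure ?D X = (\<integral>\<^sup>+s. ennreal (V * s powr (?k / 2 - 1)) * indicator {0..a} s \<partial>lborel)"
        unfolding X by (subst emeasure_density) (auto intro!: nn_integral_cong split: split_indicator)
      show ?thesis
      proof (cases "a \<ge> 0")
        case True
        have "((\<lambda>s. V * s powr (?k / 2 - 1)) has_integral V * (a powr (?k / 2 - 1 + 1) / (?k / 2 - 1 + 1))) {0..a}"
          using k True by (intro has_integral_mult_right has_integral_powr_from_0) auto
        then have "emeasure ?D X = ennreal (V * (a powr (?k / 2 - 1 + 1) / (?k / 2 - 1 + 1)))"
          unfolding D using V by (intro nn_integral_has_integral_lebesgue') auto
        also have "V * (a powr (?k / 2 - 1 + 1) / (?k / 2 - 1 + 1)) = V0 * a powr (?k / 2)"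
          using k by (simp add: V_def field_simps)
        finally show ?thesis using eqM E[OF True] X by simp
      next
        case False
        then have empty: "{w \<in> space (lebesgue_prod J). ?S w \<le> a} = {}"
          by (auto simp: not_le intro: less_le_trans[OF _ sum_nonneg])
        then show ?thesis using eqM[of a, unfolded empty] D False X by simp
      qed
    qed
    show "emeasure (distr (lebesgue_prod J) borel ?S) {..real n} \<noteq> \<infinity>" for n using eqM E[of "real n"] by simp
    show "Int_stable (range atMost :: real set set)" by (auto simp: Int_stable_def)
    show "sets (distr (lebesgue_prod J) borel ?S) = sigma_sets UNIV (range atMost)"
      "sets ?D = sigma_sets UNIV (range atMost)" by (simp_all add: borel_eq_atMost)
    show "(\<Union>n. {..real n}) = UNIV" using real_arch_simple by auto
  qed auto
  then show ?thesis using V by blast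
qed

text \<open>The normalising constant of the chi-squared density with d degrees of freedom.\<close>

definition chi_const :: "nat \<Rightarrow> real" where
  "chi_const d = 2 powr (d / 2) * Gamma (d / 2)"

lemma chi_const_pos: "d > 0 \<Longrightarrow> chi_const d > 0"
  by (simp add: chi_const_def)

lemma nn_integral_chi:
  assumes "d > 0"
  shows "(\<integral>\<^sup>+s. ennreal (s powr (real d / 2 - 1) * exp (- s / 2)) * indicator {0..} s \<partial>lborel) = ennreal (chi_const d)"
proof -
  have "(\<integral>\<^sup>+s. ennreal (s powr (real d / 2 - 1) * exp (- s / 2)) * indicator {0..} s \<partial>lborel)
    = ennreal \<bar>2\<bar> * (\<integral>\<^sup>+s. ennreal ((0 + 2 * s) powr (real d / 2 - 1) * exp (- (0 + 2 * s) / 2)) * indicator {0..} (0 + 2 * s) \<partial>lborel)"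
    by (rule nn_integral_real_affine) auto
  also have "(\<integral>\<^sup>+s. ennreal ((0 + 2 * s) powr (real d / 2 - 1) * exp (- (0 + 2 * s) / 2)) * indicator {0..} (0 + 2 * s) \<partial>lborel)
    = (\<integral>\<^sup>+s. ennreal (2 powr (real d / 2 - 1)) * ennreal (indicator {0..} s * s powr (real d / 2 - 1) / exp s) \<partial>lborel)"
    by (intro nn_integral_cong)
      (auto simp: powr_mult exp_minus ennreal_mult'[symmetric] field_simps split: split_indicator)
  also have "\<dots> = ennreal (2 powr (real d / 2 - 1)) * ennreal (Gamma (real d / 2))"
    using assms by (subst nn_integral_cmult) (auto simp: Gamma_conv_nn_integral_real)
  also have "ennreal \<bar>2\<bar> * \<dots> = ennreal (2 * (2 powr (real d / 2 - 1) * Gamma (real d / 2)))"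
    using Gamma_real_pos[of "real d / 2"] assms by (simp add: ennreal_mult)
  also have "2 * (2 powr (real d / 2 - 1) * Gamma (real d / 2)) = chi_const d"
    by (simp add: chi_const_def powr_diff)
  finally show ?thesis .
qed

text \<open>Write \<open>x = (u, w)\<close>. The density of \<open>s = |w|\<^sup>2\<close> is a power of \<open>s\<close>, so the shift \<open>s = \<sigma> - |u|\<^sup>2\<close>
  and the scaling \<open>u = \<surd>\<sigma> z\<close> separate the radius \<open>\<sigma> = |x|\<^sup>2\<close> from the direction.\<close>

lemma gaussian_sphere_projection:
  fixes l k :: nat and h :: "(nat \<Rightarrow> real) \<Rightarrow> ennreal"
  assumes k: "k > 0" and h [measurable]: "h \<in> borel_measurable (lebesgue_prod {..<l})"
  shows "(\<integral>\<^sup>+x. h (\<lambda>i\<in>{..<l}. x i / sqrt (\<Sum>i<l+k. (x i)\<^sup>2)) \<partial>gaussian_prod {..<l+k})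
    = ennreal ((1 / sqrt (2 * pi)) ^ l * chi_const (l + k) / chi_const k) *
      (\<integral>\<^sup>+z. h z * ennreal (if (\<Sum>i<l. (z i)\<^sup>2) < 1 then (1 - (\<Sum>i<l. (z i)\<^sup>2)) powr (k / 2 - 1) else 0) \<partial>lebesgue_prod {..<l})"
proof -
  define I where "I = {..<l}"
  define J where "J = {l..<l+k}"
  define d where "d = l + k"
  have IJ: "I \<inter> J = {}" "I \<union> J = {..<d}" "finite I" "finite J" "J \<noteq> {}" "card J = k" "card I = l"
    using k by (auto simp: I_def J_def d_def)
  define \<kappa> where "\<kappa> = 1 / sqrt (2 * pi)"
  have \<kappa>: "\<kappa> > 0" by (simp add: \<kappa>_def)
  define S where "S u = (\<Sum>i\<in>I. (u i)\<^sup>2)" for u :: "nat \<Rightarrow> real"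
  define T where "T w = (\<Sum>i\<in>J. (w i)\<^sup>2)" for w :: "nat \<Rightarrow> real"
  have [measurable]: "S \<in> borel_measurable (lebesgue_prod I)" "T \<in> borel_measurable (lebesgue_prod J)"
    unfolding S_def T_def by measurable
  have hI [measurable]: "h \<in> borel_measurable (lebesgue_prod I)" using h by (simp add: I_def)
  interpret L: sigma_finite_measure "lebesgue_prod I" by (rule lebesgue_prod.sigma_finite) fact
  interpret P: pair_sigma_finite "lebesgue_prod I" "lborel :: real measure" ..
  obtain V where V: "V > 0" "distr (lebesgue_prod J) borel T
    = density lborel (\<lambda>s. ennreal (V * s powr (k / 2 - 1)) * indicator {0..} s)"
    using distr_lebesgue_sum_sq[OF IJ(4,5)] by (auto simp: IJ T_def[abs_def])
  have push: "(\<integral>\<^sup>+w. \<psi> (T w) \<partial>lebesgue_prod J)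
    = (\<integral>\<^sup>+s. (ennreal (V * s powr (k / 2 - 1)) * indicator {0..} s) * \<psi> s \<partial>lborel)"
    if [measurable]: "\<psi> \<in> borel_measurable borel" for \<psi> :: "real \<Rightarrow> ennreal"
  proof -
    have "(\<integral>\<^sup>+w. \<psi> (T w) \<partial>lebesgue_prod J) = (\<integral>\<^sup>+s. \<psi> s \<partial>distr (lebesgue_prod J) borel T)"
      by (simp add: nn_integral_distr)
    then show ?thesis unfolding V(2) by (subst (asm) nn_integral_density) auto
  qed
  \<comment> \<open>The total mass 1 of the Gaussian measure on the last k coordinates determines
    V.\<close>
  have norm: "\<kappa> ^ k * V * chi_const k = 1"
  proof -
    have "1 = (\<integral>\<^sup>+w. 1 \<partial>gaussian_prod J)"
      using prob_space.emeasure_space_1[OF prob_space_gaussian_prod] by simp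
    also have "\<dots> = (\<integral>\<^sup>+w. 1 \<partial>density (lebesgue_prod J)
        (\<lambda>x. ennreal ((1 / sqrt (2 * pi)) ^ card J * exp (- (\<Sum>i\<in>J. (x i)\<^sup>2) / 2))))"
      by (simp only: gaussian_prod_density[OF IJ(4)])
    also have "\<dots> = (\<integral>\<^sup>+w. ennreal (\<kappa> ^ k * exp (- T w / 2)) \<partial>lebesgue_prod J)"
      by (subst nn_integral_density) (simp_all add: T_def \<kappa>_def IJ(6))
    also have "\<dots> = (\<integral>\<^sup>+s. (ennreal (V * s powr (k / 2 - 1)) * indicator {0..} s) * ennreal (\<kappa> ^ k * exp (- s / 2)) \<partial>lborel)"
      by (rule push) measurable
    also have "\<dots> = (\<integral>\<^sup>+s. ennreal (\<kappa> ^ k * V) * (ennreal (s powr (k / 2 - 1) * exp (- s / 2)) * indicator {0..} s) \<partial>lborel)"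
      using V \<kappa> by (intro nn_integral_cong) (auto simp: ennreal_mult'[symmetric] mult_ac split: split_indicator)
    also have "\<dots> = ennreal (\<kappa> ^ k * V * chi_const k)"
      using V(1) \<kappa> by (subst nn_integral_cmult, measurable) (subst nn_integral_chi[OF k], simp add: ennreal_mult')
    finally have "ennreal (\<kappa> ^ k * V * chi_const k) = ennreal 1" by simp
    then show ?thesis using V \<kappa> chi_const_pos[OF k] by (subst (asm) ennreal_inj) auto
  qed
  define D where "D z = ennreal (if S z < 1 then (1 - S z) powr (k / 2 - 1) else 0)" for z
  \<comment> \<open>The integrand in u and the full squared radius \<sigma>; the indicator expresses
    that the remaining squared radius \<sigma> - |u|^2 is not negative.\<close>
  define \<Theta> where "\<Theta> u \<sigma> = (ennreal (V * (\<sigma> - S u) powr (k / 2 - 1)) * indicator {0..} (\<sigma> - S u)) *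
     (h (\<lambda>i\<in>I. u i / sqrt \<sigma>) * ennreal (\<kappa> ^ d * exp (- \<sigma> / 2)))" for u \<sigma>
  have hm: "(\<lambda>p. h (\<lambda>i\<in>I. fst p i / sqrt (snd p))) \<in> borel_measurable (lebesgue_prod I \<Otimes>\<^sub>M lborel)"
    by measurable
  have \<Theta>m: "(\<lambda>(u, \<sigma>). \<Theta> u \<sigma>) \<in> borel_measurable (lebesgue_prod I \<Otimes>\<^sub>M lborel)"
    unfolding \<Theta>_def split_beta' using hm by measurable
  have rm [measurable]: "(\<lambda>x. \<lambda>i\<in>I. x i / sqrt (\<Sum>i<d. (x i)\<^sup>2)) \<in> measurable (lebesgue_prod {..<d}) (lebesgue_prod I)"
  proof (rule measurable_restrict)
    fix i assume "i \<in> I"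
    then have [measurable]: "(\<lambda>x. x i) \<in> borel_measurable (lebesgue_prod {..<d})"
      using measurable_component_singleton[of i "{..<d}" "\<lambda>_. lborel :: real measure"] by (simp add: I_def d_def)
    show "(\<lambda>x. x i / sqrt (\<Sum>i<d. (x i)\<^sup>2)) \<in> measurable (lebesgue_prod {..<d}) lborel" by measurable
  qed
  have "(\<integral>\<^sup>+x. h (\<lambda>i\<in>I. x i / sqrt (\<Sum>i<d. (x i)\<^sup>2)) \<partial>gaussian_prod {..<d})
    = (\<integral>\<^sup>+x. h (\<lambda>i\<in>I. x i / sqrt (\<Sum>i\<in>I\<union>J. (x i)\<^sup>2)) * ennreal (\<kappa> ^ d * exp (- (\<Sum>i\<in>I\<union>J. (x i)\<^sup>2) / 2)) \<partial>lebesgue_prod (I \<union> J))"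
  proof -
    show ?thesis
      unfolding IJ(2) gaussian_prod_density[OF finite_lessThan]
      by (subst nn_integral_density, measurable) (simp add: \<kappa>_def mult.commute)
  qed
  also have "\<dots> = (\<integral>\<^sup>+u. (\<integral>\<^sup>+w. h (\<lambda>i\<in>I. u i / sqrt (S u + T w)) * ennreal (\<kappa> ^ d * exp (- (S u + T w) / 2)) \<partial>lebesgue_prod J) \<partial>lebesgue_prod I)"
  proof -
    have s: "(\<Sum>i\<in>I\<union>J. (merge I J (u, w) i)\<^sup>2) = S u + T w" for u w
    proof -
      have "merge I J (u, w) i = u i" if "i \<in> I" for i using that by (simp add: merge_def)
      moreover have "merge I J (u, w) i = w i" if "i \<in> J" for i using that IJ(1) by (auto simp: merge_def)
      ultimately show ?thesis using IJ(1,3,4) by (simp add: sum.union_disjoint S_def T_def)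
    qed
    have r: "(\<lambda>i\<in>I. merge I J (u, w) i / c) = (\<lambda>i\<in>I. u i / c)" for u w :: "nat \<Rightarrow> real" and c
      by (auto simp: merge_def)
    have m: "(\<lambda>x. h (\<lambda>i\<in>I. x i / sqrt (\<Sum>i\<in>I\<union>J. (x i)\<^sup>2)) * ennreal (\<kappa> ^ d * exp (- (\<Sum>i\<in>I\<union>J. (x i)\<^sup>2) / 2)))
      \<in> borel_measurable (lebesgue_prod (I \<union> J))"
      unfolding IJ(2) by measurable
    show ?thesis
      unfolding lebesgue_prod.product_nn_integral_fold[OF IJ(1,3,4) m] s r ..
  qed
  also have "\<dots> = (\<integral>\<^sup>+u. (\<integral>\<^sup>+\<sigma>. \<Theta> u \<sigma> \<partial>lborel) \<partial>lebesgue_prod I)"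
  proof (rule nn_integral_cong)
    fix u
    have [measurable]: "(\<lambda>s. h (\<lambda>i\<in>I. u i / sqrt (S u + s))) \<in> borel_measurable borel" by measurable
    have [measurable]: "(\<lambda>s. h (\<lambda>i\<in>I. u i / sqrt s)) \<in> borel_measurable borel" by measurable
    have "(\<integral>\<^sup>+w. h (\<lambda>i\<in>I. u i / sqrt (S u + T w)) * ennreal (\<kappa> ^ d * exp (- (S u + T w) / 2)) \<partial>lebesgue_prod J)
      = (\<integral>\<^sup>+s. (ennreal (V * s powr (k / 2 - 1)) * indicator {0..} s) *
          (h (\<lambda>i\<in>I. u i / sqrt (S u + s)) * ennreal (\<kappa> ^ d * exp (- (S u + s) / 2))) \<partial>lborel)"
      by (rule push) measurable
    also have "\<dots> = ennreal \<bar>1\<bar> * (\<integral>\<^sup>+s. (ennreal (V * (- S u + 1 * s) powr (k / 2 - 1)) * indicator {0..} (- S u + 1 * s)) *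
          (h (\<lambda>i\<in>I. u i / sqrt (S u + (- S u + 1 * s))) * ennreal (\<kappa> ^ d * exp (- (S u + (- S u + 1 * s)) / 2))) \<partial>lborel)"
      by (rule nn_integral_real_affine) measurable
    also have "\<dots> = (\<integral>\<^sup>+\<sigma>. \<Theta> u \<sigma> \<partial>lborel)" by (simp add: \<Theta>_def)
    finally show "(\<integral>\<^sup>+w. h (\<lambda>i\<in>I. u i / sqrt (S u + T w)) * ennreal (\<kappa> ^ d * exp (- (S u + T w) / 2)) \<partial>lebesgue_prod J)
      = (\<integral>\<^sup>+\<sigma>. \<Theta> u \<sigma> \<partial>lborel)" .
  qed
  also have "\<dots> = (\<integral>\<^sup>+\<sigma>. (\<integral>\<^sup>+u. \<Theta> u \<sigma> \<partial>lebesgue_prod I) \<partial>lborel)"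
    using P.Fubini'[OF \<Theta>m] by simp
  also have "\<dots> = (\<integral>\<^sup>+\<sigma>. ennreal (\<kappa> ^ d * V) * (ennreal (\<sigma> powr (real d / 2 - 1) * exp (- \<sigma> / 2)) * indicator {0..} \<sigma>) * (\<integral>\<^sup>+z. h z * D z \<partial>lebesgue_prod I) \<partial>lborel)"
  proof (rule nn_integral_cong_AE)
    \<comment> \<open>At \<sigma> = 0 the scaling by sqrt \<sigma> is not invertible.\<close>
    have "AE \<sigma> in lborel. \<sigma> \<noteq> (0::real)" by (rule AE_lborel_singleton)
    then show "AE \<sigma> in lborel. (\<integral>\<^sup>+u. \<Theta> u \<sigma> \<partial>lebesgue_prod I)
      = ennreal (\<kappa> ^ d * V) * (ennreal (\<sigma> powr (real d / 2 - 1) * exp (- \<sigma> / 2)) * indicator {0..} \<sigma>) * (\<integral>\<^sup>+z. h z * D z \<partial>lebesgue_prod I)"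
    proof eventually_elim
      fix \<sigma> :: real assume "\<sigma> \<noteq> 0"
      show "(\<integral>\<^sup>+u. \<Theta> u \<sigma> \<partial>lebesgue_prod I)
        = ennreal (\<kappa> ^ d * V) * (ennreal (\<sigma> powr (real d / 2 - 1) * exp (- \<sigma> / 2)) * indicator {0..} \<sigma>) * (\<integral>\<^sup>+z. h z * D z \<partial>lebesgue_prod I)"
      proof (cases "\<sigma> < 0")
        case True
        have "\<Theta> u \<sigma> = 0" for u
        proof -
          have "0 \<le> S u" unfolding S_def by (intro sum_nonneg) simp
          then show ?thesis using True by (simp add: \<Theta>_def)
        qed
        then show ?thesis using True by simp
      next
        case False
        then have \<sigma>: "\<sigma> > 0" using \<open>\<sigma> \<noteq> 0\<close> by simp
        have [measurable]: "(\<lambda>u. \<Theta> u \<sigma>) \<in> borel_measurable (lebesgue_prod I)"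
          unfolding \<Theta>_def by measurable
        have "(\<integral>\<^sup>+u. \<Theta> u \<sigma> \<partial>lebesgue_prod I)
          = (\<Prod>i\<in>I. ennreal \<bar>sqrt \<sigma>\<bar>) * (\<integral>\<^sup>+z. \<Theta> (\<lambda>i\<in>I. 0 + sqrt \<sigma> * z i) \<sigma> \<partial>lebesgue_prod I)"
          using \<sigma> IJ by (intro nn_integral_lebesgue_prod_affine) auto
        also have "(\<Prod>i\<in>I. ennreal \<bar>sqrt \<sigma>\<bar>) = ennreal (\<sigma> powr (real l / 2))"
          using \<sigma> IJ by (simp add: ennreal_power sqrt_power_powr)
        also have "(\<integral>\<^sup>+z. \<Theta> (\<lambda>i\<in>I. 0 + sqrt \<sigma> * z i) \<sigma> \<partial>lebesgue_prod I)
          = (\<integral>\<^sup>+z. ennreal (V * \<sigma> powr (k / 2 - 1) * (\<kappa> ^ d * exp (- \<sigma> / 2))) * (h z * D z) \<partial>lebesgue_prod I)"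
        proof (rule nn_integral_cong)
          fix z assume "z \<in> space (lebesgue_prod I)"
          then have z: "(\<lambda>i\<in>I. z i) = z" by (auto simp: space_PiM PiE_iff extensional_restrict)
          have "S (\<lambda>i\<in>I. 0 + sqrt \<sigma> * z i) = \<sigma> * S z"
            using \<sigma> by (simp add: S_def power_mult_distrib sum_distrib_left)
          then have sub: "\<sigma> - S (\<lambda>i\<in>I. 0 + sqrt \<sigma> * z i) = \<sigma> * (1 - S z)" by (simp add: algebra_simps)
          have h': "(\<lambda>i\<in>I. (\<lambda>i\<in>I. 0 + sqrt \<sigma> * z i) i / sqrt \<sigma>) = z"
          proof -
            have "(\<lambda>i\<in>I. (\<lambda>i\<in>I. 0 + sqrt \<sigma> * z i) i / sqrt \<sigma>) = (\<lambda>i\<in>I. z i)" using \<sigma> by (intro restrict_ext) simp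
            then show ?thesis using z by simp
          qed
          have "ennreal (V * (\<sigma> * (1 - S z)) powr (k / 2 - 1)) * indicator {0..} (\<sigma> * (1 - S z))
             = ennreal (V * \<sigma> powr (k / 2 - 1)) * D z"
          proof (cases "S z < 1")
            case True
            then show ?thesis using \<sigma> V by (simp add: D_def powr_mult ennreal_mult'[symmetric] mult_ac)
          next
            case False
            \<comment> \<open>On the boundary the indicator is 1, but \<open>0 powr _\<close> is 0,
              so both sides vanish there as well.\<close>
            then consider "S z = 1" | "S z > 1" by linarith
            then show ?thesis
            proof cases
              case 2
              then have "\<sigma> * (1 - S z) < 0" using \<sigma> by (simp add: mult_pos_neg)
              then show ?thesis using False by (simp add: D_def)
            qed (simp add: D_def)
          qed
          then show "\<Theta> (\<lambda>i\<in>I. 0 + sqrt \<sigma> * z i) \<sigma>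
            = ennreal (V * \<sigma> powr (k / 2 - 1) * (\<kappa> ^ d * exp (- \<sigma> / 2))) * (h z * D z)"
            unfolding \<Theta>_def sub h' using V \<kappa> by (simp add: ennreal_mult' mult_ac)
        qed
        also have "\<dots> = ennreal (V * \<sigma> powr (k / 2 - 1) * (\<kappa> ^ d * exp (- \<sigma> / 2))) * (\<integral>\<^sup>+z. h z * D z \<partial>lebesgue_prod I)"
          unfolding D_def by (rule nn_integral_cmult) measurable
        also have "ennreal (\<sigma> powr (real l / 2)) * \<dots> = ennreal (\<sigma> powr (real l / 2) * (V * \<sigma> powr (k / 2 - 1) * (\<kappa> ^ d * exp (- \<sigma> / 2)))) * (\<integral>\<^sup>+z. h z * D z \<partial>lebesgue_prod I)"
          by (simp add: ennreal_mult'[symmetric] mult.assoc[symmetric])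
        also have "\<sigma> powr (real l / 2) * (V * \<sigma> powr (k / 2 - 1) * (\<kappa> ^ d * exp (- \<sigma> / 2)))
          = (\<kappa> ^ d * V) * ((\<sigma> powr (real l / 2) * \<sigma> powr (k / 2 - 1)) * exp (- \<sigma> / 2))" by (simp add: mult_ac)
        also have "\<sigma> powr (real l / 2) * \<sigma> powr (k / 2 - 1) = \<sigma> powr (real d / 2 - 1)"
          by (simp add: powr_add[symmetric] d_def add_divide_distrib add_diff_eq)
        finally show ?thesis using \<sigma> V \<kappa> by (simp add: ennreal_mult'[symmetric])
      qed
    qed
  qed
  also have "\<dots> = (\<integral>\<^sup>+\<sigma>. ennreal (\<kappa> ^ d * V) * (ennreal (\<sigma> powr (real d / 2 - 1) * exp (- \<sigma> / 2)) * indicator {0..} \<sigma>) \<partial>lborel) * (\<integral>\<^sup>+z. h z * D z \<partial>lebesgue_prod I)"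
    by (rule nn_integral_multc) measurable
  also have "(\<integral>\<^sup>+\<sigma>. ennreal (\<kappa> ^ d * V) * (ennreal (\<sigma> powr (real d / 2 - 1) * exp (- \<sigma> / 2)) * indicator {0..} \<sigma>) \<partial>lborel)
    = ennreal (\<kappa> ^ d * V) * ennreal (chi_const d)"
    using k by (subst nn_integral_cmult, measurable) (subst nn_integral_chi, simp_all add: d_def)
  also have "\<dots> = ennreal (\<kappa> ^ d * V * chi_const d)" using V \<kappa> by (simp add: ennreal_mult')
  also have "\<kappa> ^ d * V * chi_const d = \<kappa> ^ l * chi_const d / chi_const k"
    using norm chi_const_pos[OF k] by (simp add: d_def power_add field_simps)
  finally show ?thesis unfolding I_def d_def D_def S_def[abs_def, unfolded I_def] \<kappa>_def .
qed

text \<open>For l < d and positive \<mu> this is the density of the vector with entries sqrt (\<mu>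
  i) x_i, i < l, where x is uniform on the unit sphere in dimension d. The product is the Jacobian
  of the dilation.\<close>

definition sphere_density :: "nat \<Rightarrow> nat \<Rightarrow> (nat \<Rightarrow> real) \<Rightarrow> (nat \<Rightarrow> real) \<Rightarrow> real" where
  "sphere_density d l \<mu> z = (1 / sqrt (2 * pi)) ^ l * chi_const d / chi_const (d - l) * (\<Prod>i<l. 1 / sqrt (\<mu> i)) *
     (if (\<Sum>i<l. (z i)\<^sup>2 / \<mu> i) < 1 then (1 - (\<Sum>i<l. (z i)\<^sup>2 / \<mu> i)) powr (real (d - l) / 2 - 1) else 0)"

lemma sphere_density_measurable [measurable]:
  "sphere_density d l \<mu> \<in> borel_measurable (lebesgue_prod {..<l})"
  unfolding sphere_density_def by measurable

lemma sphere_density_nonneg: "l < d \<Longrightarrow> (\<And>i. i < l \<Longrightarrow> 0 < \<mu> i) \<Longrightarrow> 0 \<le> sphere_density d l \<mu> z"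
  using chi_const_pos[of d] chi_const_pos[of "d - l"]
  by (auto simp: sphere_density_def intro!: mult_nonneg_nonneg divide_nonneg_pos prod_nonneg)

lemma gauss_on_sphere_density:
  assumes e: "orthonormal_basis V d e" and l: "l < d" and \<mu>: "\<And>i. i < l \<Longrightarrow> 0 < \<mu> i"
    and B [measurable]: "B \<in> sets (lebesgue_prod {..<l})"
  shows "emeasure (gauss_on V) {x. (\<lambda>i\<in>{..<l}. sqrt (\<mu> i) * (x \<bullet> e i) / norm x) \<in> B}
    = (\<integral>\<^sup>+z. indicator B z * ennreal (sphere_density d l \<mu> z) \<partial>lebesgue_prod {..<l})"
proof -
  note F = orthonormal_basis_family[OF e]
  define k where "k = d - l"
  have k: "k > 0" "d = l + k" using l by (auto simp: k_def)
  define h where "h y = (indicator B (\<lambda>i\<in>{..<l}. sqrt (\<mu> i) * y i) :: ennreal)" for y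
  have h [measurable]: "h \<in> borel_measurable (lebesgue_prod {..<l})" unfolding h_def by measurable
  let ?X = "{x. (\<lambda>i\<in>{..<l}. sqrt (\<mu> i) * (x \<bullet> e i) / norm x) \<in> B}"
  have Xm: "?X \<in> sets borel"
  proof -
    have m: "(\<lambda>x. \<lambda>i\<in>{..<l}. sqrt (\<mu> i) * (x \<bullet> e i) / norm x) \<in> measurable borel (lebesgue_prod {..<l})"
      by measurable
    show ?thesis using measurable_sets[OF m B] by (simp add: vimage_def)
  qed
  let ?C = "(1 / sqrt (2 * pi)) ^ l * chi_const d / chi_const k"
  let ?D = "\<lambda>z. if (\<Sum>i<l. (z i)\<^sup>2) < 1 then (1 - (\<Sum>i<l. (z i)\<^sup>2)) powr (k / 2 - 1) else 0"
  have "emeasure (gauss_on V) ?X = (\<integral>\<^sup>+x. indicator ?X x \<partial>gauss_on V)" using Xm by simp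
  also have "\<dots> = (\<integral>\<^sup>+x. indicator ?X (lincomb d e x) \<partial>gaussian_prod {..<d})"
    unfolding gauss_on_eq[OF e] using Xm by (subst nn_integral_distr) auto
  also have "\<dots> = (\<integral>\<^sup>+x. h (\<lambda>i\<in>{..<l}. x i / sqrt (\<Sum>i<d. (x i)\<^sup>2)) \<partial>gaussian_prod {..<d})"
  proof (rule nn_integral_cong)
    fix x
    have "(\<lambda>i\<in>{..<l}. sqrt (\<mu> i) * (lincomb d e x \<bullet> e i) / norm (lincomb d e x))
      = (\<lambda>i\<in>{..<l}. sqrt (\<mu> i) * (\<lambda>i\<in>{..<l}. x i / sqrt (\<Sum>i<d. (x i)\<^sup>2)) i)"
      using l by (intro restrict_ext) (simp add: inner_lincomb[OF F] norm_lincomb[OF F])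
    then show "indicator ?X (lincomb d e x) = h (\<lambda>i\<in>{..<l}. x i / sqrt (\<Sum>i<d. (x i)\<^sup>2))"
      by (simp add: h_def indicator_def)
  qed
  also have "\<dots> = ennreal ?C * (\<integral>\<^sup>+y. h y * ennreal (?D y) \<partial>lebesgue_prod {..<l})"
    using gaussian_sphere_projection[OF k(1) h] by (simp add: k(2))
  also have "(\<integral>\<^sup>+y. h y * ennreal (?D y) \<partial>lebesgue_prod {..<l})
    = (\<Prod>i\<in>{..<l}. ennreal \<bar>1 / sqrt (\<mu> i)\<bar>) *
      (\<integral>\<^sup>+z. h (\<lambda>i\<in>{..<l}. 0 + 1 / sqrt (\<mu> i) * z i) * ennreal (?D (\<lambda>i\<in>{..<l}. 0 + 1 / sqrt (\<mu> i) * z i)) \<partial>lebesgue_prod {..<l})"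
    by (rule nn_integral_lebesgue_prod_affine) (use \<mu> in force, use \<mu> in force, measurable)
  also have "(\<integral>\<^sup>+z. h (\<lambda>i\<in>{..<l}. 0 + 1 / sqrt (\<mu> i) * z i) * ennreal (?D (\<lambda>i\<in>{..<l}. 0 + 1 / sqrt (\<mu> i) * z i)) \<partial>lebesgue_prod {..<l})
    = (\<integral>\<^sup>+z. indicator B z * ennreal (if (\<Sum>i<l. (z i)\<^sup>2 / \<mu> i) < 1 then (1 - (\<Sum>i<l. (z i)\<^sup>2 / \<mu> i)) powr (k / 2 - 1) else 0) \<partial>lebesgue_prod {..<l})"
  proof (rule nn_integral_cong)
    fix z assume "z \<in> space (lebesgue_prod {..<l})"
    then have z: "(\<lambda>i\<in>{..<l}. z i) = z" by (auto simp: space_PiM PiE_iff extensional_restrict)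
    have "(\<lambda>i\<in>{..<l}. sqrt (\<mu> i) * (\<lambda>i\<in>{..<l}. 0 + 1 / sqrt (\<mu> i) * z i) i) = (\<lambda>i\<in>{..<l}. z i)"
      using \<mu> by (intro restrict_ext) (force simp: less_imp_neq)
    then have hz: "h (\<lambda>i\<in>{..<l}. 0 + 1 / sqrt (\<mu> i) * z i) = indicator B z" by (simp only: h_def z)
    have Sz: "(\<Sum>i<l. ((\<lambda>i\<in>{..<l}. 0 + 1 / sqrt (\<mu> i) * z i) i)\<^sup>2) = (\<Sum>i<l. (z i)\<^sup>2 / \<mu> i)"
      using \<mu> by (intro sum.cong) (auto simp: power_divide less_imp_le)
    show "h (\<lambda>i\<in>{..<l}. 0 + 1 / sqrt (\<mu> i) * z i) * ennreal (?D (\<lambda>i\<in>{..<l}. 0 + 1 / sqrt (\<mu> i) * z i))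
      = indicator B z * ennreal (if (\<Sum>i<l. (z i)\<^sup>2 / \<mu> i) < 1 then (1 - (\<Sum>i<l. (z i)\<^sup>2 / \<mu> i)) powr (k / 2 - 1) else 0)"
      unfolding hz Sz ..
  qed
  also have "(\<Prod>i\<in>{..<l}. ennreal \<bar>1 / sqrt (\<mu> i)\<bar>) = ennreal (\<Prod>i<l. 1 / sqrt (\<mu> i))"
    using \<mu> by (subst prod_ennreal[symmetric]) (auto intro!: prod.cong simp: less_imp_le)
  also have "ennreal ?C * (ennreal (\<Prod>i<l. 1 / sqrt (\<mu> i)) * (\<integral>\<^sup>+z. indicator B z * ennreal (if (\<Sum>i<l. (z i)\<^sup>2 / \<mu> i) < 1 then (1 - (\<Sum>i<l. (z i)\<^sup>2 / \<mu> i)) powr (k / 2 - 1) else 0) \<partial>lebesgue_prod {..<l}))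
    = (\<integral>\<^sup>+z. ennreal (?C * (\<Prod>i<l. 1 / sqrt (\<mu> i))) * (indicator B z * ennreal (if (\<Sum>i<l. (z i)\<^sup>2 / \<mu> i) < 1 then (1 - (\<Sum>i<l. (z i)\<^sup>2 / \<mu> i)) powr (k / 2 - 1) else 0)) \<partial>lebesgue_prod {..<l})"
  proof -
    have "0 \<le> ?C" using chi_const_pos[of d] chi_const_pos[of k] k by simp
    then show ?thesis
      by (subst nn_integral_cmult, measurable) (simp only: ennreal_mult'[OF \<open>0 \<le> ?C\<close>] mult.assoc)
  qed
  also have "\<dots> = (\<integral>\<^sup>+z. indicator B z * ennreal (sphere_density d l \<mu> z) \<partial>lebesgue_prod {..<l})"
  proof (rule nn_integral_cong)
    fix z
    have "0 \<le> ?C * (\<Prod>i<l. 1 / sqrt (\<mu> i))"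
      using chi_const_pos[of d] chi_const_pos[of k] k \<mu>
      by (intro mult_nonneg_nonneg prod_nonneg) (auto simp: less_imp_le)
    then show "ennreal (?C * (\<Prod>i<l. 1 / sqrt (\<mu> i))) * (indicator B z * ennreal (if (\<Sum>i<l. (z i)\<^sup>2 / \<mu> i) < 1 then (1 - (\<Sum>i<l. (z i)\<^sup>2 / \<mu> i)) powr (k / 2 - 1) else 0))
      = indicator B z * ennreal (sphere_density d l \<mu> z)"
      unfolding sphere_density_def k_def[symmetric]
      by (subst (2) ennreal_mult') (simp_all add: mult_ac)
  qed
  finally show ?thesis .
qed

subsection \<open>Comparison of the densities\<close>

lemma chi_const_rec: "d > 0 \<Longrightarrow> chi_const (d + 2) = d * chi_const d"
proof -
  assume d: "d > 0"
  have "Gamma (real (d + 2) / 2) = Gamma (real d / 2 + 1)" by (simp add: add_divide_distrib add.commute)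
  also have "\<dots> = real d / 2 * Gamma (real d / 2)"
  proof -
    have "real d / 2 \<notin> \<int>\<^sub>\<le>\<^sub>0" using d nonpos_Ints_nonpos[of "real d / 2"] by auto
    then show ?thesis using Gamma_plus1[of "real d / 2"] by simp
  qed
  finally show ?thesis by (simp add: chi_const_def add_divide_distrib powr_add)
qed

text \<open>Log-convexity of Gamma at the midpoint of x and x + 1. With the two-step recurrence it
  places the square of \<open>chi_const (d + 1) / chi_const d\<close> between d - 1 and d, which is
  all the asymptotics of Gamma that the comparison needs.\<close>

lemma chi_const_log_convex:
  assumes d: "d > 0"
  shows "(chi_const (d + 1))\<^sup>2 \<le> chi_const d * chi_const (d + 2)"
proof -
  define x where "x = real d / 2"
  have x: "x > 0" using d by (simp add: x_def)
  have G: "Gamma x > 0" "Gamma (x + 1) > 0" "Gamma (x + 1/2) > 0" using x by (auto intro: Gamma_real_pos)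
  have "(ln \<circ> Gamma) ((1 - 1/2) *\<^sub>R x + (1/2) *\<^sub>R (x + 1)) \<le> (1 - 1/2) * (ln \<circ> Gamma) x + (1/2) * (ln \<circ> Gamma) (x + 1)"
    using x by (intro convex_onD[OF log_convex_Gamma_real]) auto
  also have "(1 - 1/2) *\<^sub>R x + (1/2) *\<^sub>R (x + 1) = x + 1/2" by (simp add: field_simps)
  finally have "2 * ln (Gamma (x + 1/2)) \<le> ln (Gamma x) + ln (Gamma (x + 1))" by (simp add: field_simps)
  then have "ln ((Gamma (x + 1/2))\<^sup>2) \<le> ln (Gamma x * Gamma (x + 1))"
    using G by (simp add: ln_mult power2_eq_square)
  then have le: "(Gamma (x + 1/2))\<^sup>2 \<le> Gamma x * Gamma (x + 1)" using G by (subst (asm) ln_le_cancel_iff) auto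
  have p: "(2 powr (x + 1/2))\<^sup>2 = 2 powr x * 2 powr (x + 1)"
    by (simp add: power2_eq_square powr_add[symmetric])
  have "(chi_const (d + 1))\<^sup>2 = (2 powr (x + 1/2))\<^sup>2 * (Gamma (x + 1/2))\<^sup>2"
    by (simp add: chi_const_def x_def add_divide_distrib power_mult_distrib add.commute)
  also have "\<dots> \<le> (2 powr (x + 1/2))\<^sup>2 * (Gamma x * Gamma (x + 1))" by (intro mult_left_mono le) simp
  also have "\<dots> = chi_const d * chi_const (d + 2)"
    unfolding p by (simp add: chi_const_def x_def add_divide_distrib add.commute)
  finally show ?thesis .
qed

lemma chi_const_step_le: "d > 0 \<Longrightarrow> (chi_const (Suc d))\<^sup>2 \<le> d * (chi_const d)\<^sup>2"
  using chi_const_log_convex[of d] chi_const_rec[of d] by (simp add: power2_eq_square mult_ac)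

text \<open>The upper bound one step later and the recurrence give the lower bound d^2 / (d + 1),
  which exceeds d - 1.\<close>

lemma chi_const_step_ge:
  assumes d: "d > 0"
  shows "(real d - 1) * (chi_const d)\<^sup>2 \<le> (chi_const (Suc d))\<^sup>2"
proof -
  have "(real d + 1) * ((real d - 1) * (chi_const d)\<^sup>2) = ((real d)\<^sup>2 - 1) * (chi_const d)\<^sup>2"
    by (simp only: power2_eq_square) (simp add: algebra_simps)
  also have "\<dots> \<le> (real d)\<^sup>2 * (chi_const d)\<^sup>2" by (intro mult_right_mono) auto
  also have "\<dots> = (chi_const (Suc (Suc d)))\<^sup>2"
    using chi_const_rec[OF d] by (simp add: power_mult_distrib)
  also have "\<dots> \<le> (real d + 1) * (chi_const (Suc d))\<^sup>2"
    using chi_const_step_le[of "Suc d"] by (simp add: add.commute)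
  finally have "(real d + 1) * ((real d - 1) * (chi_const d)\<^sup>2) \<le> (real d + 1) * (chi_const (Suc d))\<^sup>2" .
  then show ?thesis by (rule mult_left_le_imp_le) simp
qed

lemma chi_const_ratio_le:
  assumes "a > 0" "a + l \<le> n"
  shows "(chi_const (a + l))\<^sup>2 \<le> real n ^ l * (chi_const a)\<^sup>2"
  using assms(2)
proof (induction l)
  case (Suc l)
  have "(chi_const (a + Suc l))\<^sup>2 \<le> real (a + l) * (chi_const (a + l))\<^sup>2"
    using chi_const_step_le[of "a + l"] assms(1) by simp
  also have "\<dots> \<le> real n * (real n ^ l * (chi_const a)\<^sup>2)"
    using Suc by (intro mult_mono) auto
  finally show ?case by simp
qed simp

lemma chi_const_ratio_ge:
  assumes "a > 0"
  shows "(real a - 1) ^ l * (chi_const a)\<^sup>2 \<le> (chi_const (a + l))\<^sup>2"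
proof (induction l)
  case (Suc l)
  have "(real a - 1) ^ Suc l * (chi_const a)\<^sup>2 = (real a - 1) * ((real a - 1) ^ l * (chi_const a)\<^sup>2)" by simp
  also have "\<dots> \<le> (real (a + l) - 1) * (chi_const (a + l))\<^sup>2"
    using Suc assms by (intro mult_mono) (auto simp: Suc_le_eq)
  also have "\<dots> \<le> (chi_const (a + Suc l))\<^sup>2" using chi_const_step_ge[of "a + l"] assms by simp
  finally show ?case .
qed simp

text \<open>After taking logarithms, ln (1 - x) >= - x - 2 x^2 on [0, 1/2] is applied to a and b,
  and ln (1 - s) <= - s to the full density. The halves carry exponents of at most n / 4
  each.\<close>

lemma density_exponent_bound:
  fixes n m l :: nat and \<mu> z :: "nat \<Rightarrow> real" and \<delta> s :: real
  assumes m: "m = n div 2" and lm: "l + 2 \<le> m"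
    and \<mu>: "\<And>i. i < l \<Longrightarrow> \<bar>\<mu> i - 1 / 2\<bar> \<le> \<delta>" and \<delta>: "\<delta> \<le> 1 / 4"
    and s: "s = (\<Sum>i<l. (z i)\<^sup>2)" "s \<le> 1 / 8"
  defines "a \<equiv> \<Sum>i<l. (z i)\<^sup>2 / \<mu> i" and "b \<equiv> \<Sum>i<l. (z i)\<^sup>2 / (1 - \<mu> i)"
  shows "a \<le> 1 / 2" "b \<le> 1 / 2"
    "exp (- (8 * n * s * \<delta>\<^sup>2 + 16 * n * s\<^sup>2 + (l + 2) * s)) * ((1 - s) powr (real (n - l) / 2 - 1))\<^sup>2
      \<le> (1 - a) powr (real (m - l) / 2 - 1) * (1 - b) powr (real (n - m - l) / 2 - 1)"
proof -
  have \<mu>': "1/4 \<le> \<mu> i" "1/4 \<le> 1 - \<mu> i" if "i < l" for i using \<mu>[OF that] \<delta> by (auto simp: abs_le_iff)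
  have s0: "0 \<le> s" unfolding s by (intro sum_nonneg) simp
  have term_le: "(z i)\<^sup>2 / c \<le> 4 * (z i)\<^sup>2" if "1/4 \<le> c" for c :: real and i
    using that mult_right_mono[of "1/4" c "4 * (z i)\<^sup>2"] by (simp add: divide_le_eq mult_ac)
  have a: "a \<le> 4 * s" unfolding a_def s sum_distrib_left by (intro sum_mono term_le \<mu>') auto
  have b: "b \<le> 4 * s" unfolding b_def s sum_distrib_left by (intro sum_mono term_le \<mu>') auto
  have a0: "0 \<le> a" unfolding a_def using \<mu>'(1) by (intro sum_nonneg divide_nonneg_pos) force+
  have b0: "0 \<le> b" unfolding b_def using \<mu>'(2) by (intro sum_nonneg divide_nonneg_pos) force+
  note a = a0 a and b = b0 b
  show a2: "a \<le> 1 / 2" and b2: "b \<le> 1 / 2" using a b s(2) by auto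
  \<comment> \<open>With \<mu> i = 1/2 + e, the sum of 1 / \<mu> i and 1 / (1 - \<mu> i) is 1 / (1/4
    - e^2), which has no first-order term in e. This is the cancellation between H and its
    complement.\<close>
  have ab: "a + b \<le> 4 * s + 32 * s * \<delta>\<^sup>2"
  proof -
    have "(z i)\<^sup>2 / \<mu> i + (z i)\<^sup>2 / (1 - \<mu> i) \<le> (4 + 32 * \<delta>\<^sup>2) * (z i)\<^sup>2" if "i < l" for i
    proof -
      define e where "e = \<mu> i - 1/2"
      have e2: "e\<^sup>2 \<le> \<delta>\<^sup>2" using \<mu>[OF that] by (simp add: e_def abs_le_square_iff[symmetric])
      have "e\<^sup>2 \<le> (1/4)\<^sup>2" using \<mu>[OF that] \<delta> by (simp add: e_def abs_le_square_iff[symmetric])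
      then have e16: "e\<^sup>2 \<le> 1/16" by (simp add: power2_eq_square)
      have pr: "\<mu> i * (1 - \<mu> i) = 1/4 - e\<^sup>2" by (simp add: e_def power2_eq_square algebra_simps)
      have "(z i)\<^sup>2 / \<mu> i + (z i)\<^sup>2 / (1 - \<mu> i) = (z i)\<^sup>2 / (\<mu> i * (1 - \<mu> i))"
        using \<mu>'[OF that] by (simp add: field_simps)
      also have "\<dots> = (z i)\<^sup>2 / (1/4 - e\<^sup>2)" by (simp only: pr)
      also have "\<dots> \<le> (4 + 32 * e\<^sup>2) * (z i)\<^sup>2"
      proof -
        \<comment> \<open>The product in the next line is 1 plus this quantity.\<close>
        have "e\<^sup>2 * (4 - 32 * e\<^sup>2) \<ge> 0" using e16 by (intro mult_nonneg_nonneg) auto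
        then have "1 \<le> (4 + 32 * e\<^sup>2) * (1/4 - e\<^sup>2)" by (simp add: algebra_simps)
        then have "1 * (z i)\<^sup>2 \<le> ((4 + 32 * e\<^sup>2) * (1/4 - e\<^sup>2)) * (z i)\<^sup>2" by (intro mult_right_mono) auto
        then show ?thesis using e16 by (subst pos_divide_le_eq) (auto simp: mult_ac)
      qed
      also have "\<dots> \<le> (4 + 32 * \<delta>\<^sup>2) * (z i)\<^sup>2" using e2 by (intro mult_right_mono) auto
      finally show ?thesis .
    qed
    then have "a + b \<le> (\<Sum>i<l. (4 + 32 * \<delta>\<^sup>2) * (z i)\<^sup>2)"
      unfolding a_def b_def sum.distrib[symmetric] by (intro sum_mono) auto
    also have "\<dots> = (4 + 32 * \<delta>\<^sup>2) * s" unfolding s sum_distrib_left ..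
    finally show ?thesis by (simp add: algebra_simps)
  qed
  define P where "P = real (m - l) / 2 - 1"
  define Q where "Q = real (n - m - l) / 2 - 1"
  define R where "R = real (n - l) / 2 - 1"
  have nm: "2 * m \<le> n" "n \<le> 2 * m + 1" using m by auto
  have rn: "2 * real m \<le> real n" "real n \<le> 2 * real m + 1" "real l + 2 \<le> real m" using nm lm by linarith+
  have rd: "real (m - l) = real m - real l" "real (n - m - l) = real n - real m - real l" "real (n - l) = real n - real l"
    using nm lm by (simp_all add: of_nat_diff)
  have P0: "0 \<le> P" unfolding P_def rd diff_divide_distrib using rn by linarith
  have P1: "P \<le> n / 4" unfolding P_def rd diff_divide_distrib using rn by linarith
  have Q0: "0 \<le> Q" unfolding Q_def rd diff_divide_distrib using rn by linarith
  have Q1: "Q \<le> n / 4" unfolding Q_def rd diff_divide_distrib using rn by linarith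
  note P = P0 P1 and Q = Q0 Q1
  have R: "0 \<le> R" unfolding R_def rd diff_divide_distrib using rn by linarith
  have R2: "2 * R = real n - real l - 2" unfolding R_def rd by (simp add: field_simps)
  have la: "- a - 2 * a\<^sup>2 \<le> ln (1 - a)" by (rule ln_one_minus_pos_lower_bound[OF a(1) a2])
  have lb: "- b - 2 * b\<^sup>2 \<le> ln (1 - b)" by (rule ln_one_minus_pos_lower_bound[OF b(1) b2])
  have a4: "a\<^sup>2 \<le> 16 * s\<^sup>2" using power_mono[OF a(2,1), of 2] by (simp add: power_mult_distrib)
  have b4: "b\<^sup>2 \<le> 16 * s\<^sup>2" using power_mono[OF b(2,1), of 2] by (simp add: power_mult_distrib)
  have P1: "- (n / 4) * (a + 2 * a\<^sup>2) \<le> P * ln (1 - a)"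
  proof -
    have "P * (a + 2 * a\<^sup>2) \<le> (n / 4) * (a + 2 * a\<^sup>2)" using P a by (intro mult_right_mono) auto
    moreover have "P * (- a - 2 * a\<^sup>2) \<le> P * ln (1 - a)" using P la by (intro mult_left_mono) auto
    ultimately show ?thesis by (simp add: algebra_simps)
  qed
  have Q1: "- (n / 4) * (b + 2 * b\<^sup>2) \<le> Q * ln (1 - b)"
  proof -
    have "Q * (b + 2 * b\<^sup>2) \<le> (n / 4) * (b + 2 * b\<^sup>2)" using Q b by (intro mult_right_mono) auto
    moreover have "Q * (- b - 2 * b\<^sup>2) \<le> Q * ln (1 - b)" using Q lb by (intro mult_left_mono) auto
    ultimately show ?thesis by (simp add: algebra_simps)
  qed
  have R1: "2 * R * ln (1 - s) \<le> - (real n - real l - 2) * s"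
  proof -
    have "ln (1 - s) \<le> - s" using ln_add_one_self_le_self2[of "- s"] s(2) by simp
    then have "2 * R * ln (1 - s) \<le> 2 * R * (- s)" using R by (intro mult_left_mono) auto
    then show ?thesis unfolding R2 by (simp add: algebra_simps)
  qed
  \<comment> \<open>The main term n s is compensated by 2 R s = (n - l - 2) s from the full density,
    which leaves (l + 2) s.\<close>
  have "(n / 4) * (a + b + 2 * a\<^sup>2 + 2 * b\<^sup>2) \<le> (n / 4) * (4 * s + 32 * s * \<delta>\<^sup>2 + 64 * s\<^sup>2)"
    using ab a4 b4 by (intro mult_left_mono) auto
  then have "- (8 * n * s * \<delta>\<^sup>2 + 16 * n * s\<^sup>2 + (l + 2) * s) + 2 * R * ln (1 - s) \<le> P * ln (1 - a) + Q * ln (1 - b)"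
    using P1 Q1 R1 by (simp add: algebra_simps)
  then have "exp (- (8 * n * s * \<delta>\<^sup>2 + 16 * n * s\<^sup>2 + (l + 2) * s) + 2 * R * ln (1 - s)) \<le> exp (P * ln (1 - a) + Q * ln (1 - b))"
    by (simp only: exp_le_cancel_iff)
  then show "exp (- (8 * n * s * \<delta>\<^sup>2 + 16 * n * s\<^sup>2 + (l + 2) * s)) * ((1 - s) powr (real (n - l) / 2 - 1))\<^sup>2
      \<le> (1 - a) powr (real (m - l) / 2 - 1) * (1 - b) powr (real (n - m - l) / 2 - 1)"
  proof -
    have "((1 - s) powr R)\<^sup>2 = exp (2 * R * ln (1 - s))"
      using s(2) exp_double[of "R * ln (1 - s)"] by (simp add: powr_def mult.assoc)
    moreover have "(1 - a) powr P * (1 - b) powr Q = exp (P * ln (1 - a) + Q * ln (1 - b))"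
      using a2 b2 by (simp add: powr_def exp_add)
    ultimately show ?thesis
      using \<open>exp (- (8 * n * s * \<delta>\<^sup>2 + 16 * n * s\<^sup>2 + (l + 2) * s) + 2 * R * ln (1 - s)) \<le> _\<close>
      unfolding P_def[symmetric] Q_def[symmetric] R_def[symmetric] exp_add by simp
  qed
qed

text \<open>The squared ratio for dimension n is at most n^l, each of the two halves contributes at
  least c^(l/2) with c = m - l - 1, and the determinants contribute at least 2^l. Hence the quotient
  is at least (2 c / n)^l, and Bernoulli's inequality gives the linear lower bound. Here l^2 has to
  be small against n.\<close>

lemma density_constant_bound:
  assumes m: "m = n div 2" and lm: "l + 2 \<le> m" and \<mu>: "\<And>i. i < l \<Longrightarrow> 0 < \<mu> i \<and> \<mu> i < 1"
  shows "(1 - real l * (2 * real l + 3) / real n) * (chi_const n / chi_const (n - l))\<^sup>2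
    \<le> (chi_const m / chi_const (m - l)) * (chi_const (n - m) / chi_const (n - m - l)) *
       ((\<Prod>i<l. 1 / sqrt (\<mu> i)) * (\<Prod>i<l. 1 / sqrt (1 - \<mu> i)))"
proof -
  have nm: "2 * m \<le> n" "n \<le> 2 * m + 1" using m by auto
  have n0: "n > 0" using lm nm by simp
  define c where "c = real (m - l) - 1"
  have c: "c \<ge> 1" using lm by (simp add: c_def of_nat_diff)
  have r1: "(chi_const n / chi_const (n - l))\<^sup>2 \<le> real n ^ l"
    using chi_const_ratio_le[of "n - l" l n] chi_const_pos[of "n - l"] lm nm
    by (simp add: power_divide divide_le_eq)
  have ge: "c ^ l \<le> (chi_const d / chi_const (d - l))\<^sup>2" if "m \<le> d" for d
  proof -
    have "c ^ l \<le> (real (d - l) - 1) ^ l" using that c by (intro power_mono) (auto simp: c_def)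
    also have "\<dots> \<le> (chi_const d / chi_const (d - l))\<^sup>2"
      using chi_const_ratio_ge[of "d - l" l] chi_const_pos[of "d - l"] lm that
      by (simp add: power_divide le_divide_eq)
    finally show ?thesis .
  qed
  let ?X = "chi_const m / chi_const (m - l)" and ?Y = "chi_const (n - m) / chi_const (n - m - l)"
  have XY0: "0 \<le> ?X" "0 \<le> ?Y"
    using chi_const_pos[of m] chi_const_pos[of "m-l"] chi_const_pos[of "n-m"] chi_const_pos[of "n-m-l"] lm nm by auto
  have "c ^ l * c ^ l \<le> ?X\<^sup>2 * ?Y\<^sup>2"
  proof (rule mult_mono)
    show "c ^ l \<le> ?X\<^sup>2" by (rule ge) simp
    show "c ^ l \<le> ?Y\<^sup>2" by (rule ge) (use nm in linarith)
    show "0 \<le> c ^ l" using c by simp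
  qed simp
  then have "(c ^ l)\<^sup>2 \<le> (?X * ?Y)\<^sup>2" by (simp only: power_mult_distrib[of ?X ?Y] power2_eq_square[of "c ^ l"])
  then have XY: "c ^ l \<le> ?X * ?Y" by (rule power2_le_imp_le) (rule mult_nonneg_nonneg[OF XY0])
  have pr: "2 ^ l \<le> (\<Prod>i<l. 1 / sqrt (\<mu> i)) * (\<Prod>i<l. 1 / sqrt (1 - \<mu> i))"
  proof -
    have "(\<Prod>i<l. 2) \<le> (\<Prod>i<l. 1 / sqrt (\<mu> i) * (1 / sqrt (1 - \<mu> i)))"
    proof (rule prod_mono, rule conjI)
      fix i assume "i \<in> {..<l}"
      then have i: "0 < \<mu> i" "\<mu> i < 1" using \<mu>[of i] by simp_all
      define w where "w = sqrt (\<mu> i) * sqrt (1 - \<mu> i)"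
      have w0: "w > 0" using i by (simp add: w_def)
      have "w\<^sup>2 = \<mu> i * (1 - \<mu> i)" using i by (simp add: w_def power_mult_distrib)
      also have "\<dots> = (1/2)\<^sup>2 - (\<mu> i - 1/2)\<^sup>2" by (simp only: power2_eq_square) (simp add: algebra_simps)
      also have "\<dots> \<le> (1/2)\<^sup>2" by simp
      finally have "w \<le> 1/2" by (rule power2_le_imp_le) simp
      then have "2 \<le> 1 / w" using w0 by (subst le_divide_eq) simp
      then show "2 \<le> 1 / sqrt (\<mu> i) * (1 / sqrt (1 - \<mu> i))" by (simp add: w_def)
    next
      show "0 \<le> (2::real)" by simp
    qed
    then show ?thesis by (simp only: prod.distrib prod_constant card_lessThan)
  qed
  have "(1 - real l * (2 * real l + 3) / real n) = 1 + real l * (- (2 * real l + 3) / n)" using n0 by (simp add: field_simps)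
  also have "\<dots> \<le> (1 + - (2 * real l + 3) / n) ^ l"
  proof (rule Bernoulli_inequality)
    have "2 * real l + 3 \<le> n" using lm nm by linarith
    then show "- 1 \<le> - (2 * real l + 3) / n" using n0 by (simp add: field_simps)
  qed
  also have "\<dots> \<le> (2 * c / n) ^ l"
  proof (rule power_mono)
    have "1 + - (2 * real l + 3) / n = (real n - 2 * real l - 3) / n" using n0 by (simp add: field_simps)
    also have "\<dots> \<le> 2 * c / n"
      using nm lm by (intro divide_right_mono) (auto simp: c_def of_nat_diff)
    finally show "1 + - (2 * real l + 3) / n \<le> 2 * c / n" .
    have "2 * real l + 3 \<le> n" using lm nm by linarith
    then show "0 \<le> 1 + - (2 * real l + 3) / n" using n0 by (simp add: field_simps)
  qed
  finally have b: "(1 - real l * (2 * real l + 3) / real n) \<le> (2 * c / n) ^ l" .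
  have "(1 - real l * (2 * real l + 3) / real n) * (chi_const n / chi_const (n - l))\<^sup>2 \<le> (2 * c / n) ^ l * real n ^ l"
  proof -
    have "(1 - real l * (2 * real l + 3) / real n) * (chi_const n / chi_const (n - l))\<^sup>2 \<le> (2 * c / n) ^ l * (chi_const n / chi_const (n - l))\<^sup>2"
      by (intro mult_right_mono b) simp
    also have "\<dots> \<le> (2 * c / n) ^ l * real n ^ l" using c by (intro mult_left_mono r1) auto
    finally show ?thesis .
  qed
  also have "\<dots> = (2 * c / n * n) ^ l" by (rule power_mult_distrib[symmetric])
  also have "2 * c / n * n = c * 2" using n0 by simp
  also have "(c * 2) ^ l = c ^ l * 2 ^ l" by (rule power_mult_distrib)
  also have "\<dots> \<le> ?X * ?Y * ((\<Prod>i<l. 1 / sqrt (\<mu> i)) * (\<Prod>i<l. 1 / sqrt (1 - \<mu> i)))"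
    by (rule mult_mono[OF XY pr mult_nonneg_nonneg[OF XY0]]) simp
  finally show ?thesis .
qed

text \<open>Constants and powers each lose a factor 0.98, and 0.98^2 exceeds 0.95^2. The powers of 2
  pi are the same on both sides, and squaring avoids roots of the product.\<close>

lemma sphere_density_comparison:
  fixes n l :: nat
  assumes n: "10 ^ 8 \<le> sqrt n" and l: "l \<le> sqrt n / 10 ^ 6"
    and \<mu>: "\<And>i. i < l \<Longrightarrow> \<bar>\<mu> i - 1 / 2\<bar> \<le> \<delta>" and \<delta>: "\<delta>\<^sup>2 = 16 / sqrt n" "0 \<le> \<delta>"
    and z: "(\<Sum>i<l. (z i)\<^sup>2) \<le> 1 / (10 ^ 4 * sqrt n)"
  shows "(0.95 * sphere_density n l (\<lambda>_. 1) z)\<^sup>2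
    \<le> sphere_density (n div 2) l \<mu> z * sphere_density (n - n div 2) l (\<lambda>i. 1 - \<mu> i) z"
proof -
  define r where "r = sqrt (real n)"
  have r1: "r \<ge> 10 ^ 8" using n by (simp add: r_def)
  then have r2: "r > 0" by (rule less_le_trans[rotated]) simp
  have r: "r \<ge> 10 ^ 8" "r > 0" "r * r = n" using r1 r2 by (auto simp: r_def)
  define m where "m = n div 2"
  define s where "s = (\<Sum>i<l. (z i)\<^sup>2)"
  have s0: "0 \<le> s" unfolding s_def by (intro sum_nonneg) simp
  have sr: "s * r \<le> 1 / 10 ^ 4" using z r(2) by (simp add: s_def r_def[symmetric] field_simps)
  have rb: "100000000 \<le> r" using r(1) by simp
  have lr: "1000000 * real l \<le> r" using l by (simp add: r_def)
  have "10 ^ 8 * r \<le> r * r" using r by (intro mult_right_mono) auto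
  then have n8: "100000000 * r \<le> n" using r by simp
  have n0: "0 < real n" using n8 rb by linarith
  have nm: "real n \<le> 2 * real m + 1" unfolding m_def by linarith
  have lm: "l + 2 \<le> m" using n8 lr nm rb by linarith
  have s8: "s \<le> 1 / 8"
  proof -
    have "s * 1 \<le> s * r" using rb s0 by (intro mult_left_mono) auto
    then show ?thesis using sr by simp
  qed
  have \<delta>4: "\<delta> \<le> 1 / 4"
  proof (rule power2_le_imp_le)
    have "16 / r \<le> 16 / 100000000" using rb by (intro divide_left_mono) auto
    then show "\<delta>\<^sup>2 \<le> (1/4)\<^sup>2" unfolding \<delta> r_def[symmetric] by (simp add: power2_eq_square)
  qed simp
  have \<mu>': "0 < \<mu> i" "\<mu> i < 1" if "i < l" for i using \<mu>[OF that] \<delta>4 by (auto simp: abs_le_iff)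
  define a where "a = (\<Sum>i<l. (z i)\<^sup>2 / \<mu> i)"
  define b where "b = (\<Sum>i<l. (z i)\<^sup>2 / (1 - \<mu> i))"
  note ex = density_exponent_bound[where \<mu>=\<mu> and z=z, OF m_def lm \<mu> \<delta>4 s_def s8, folded a_def b_def]
  have a1: "a < 1" and b1: "b < 1" and s1: "s < 1" using ex(1,2) s8 by auto
  define E where "E = exp (- (8 * n * s * \<delta>\<^sup>2 + 16 * n * s\<^sup>2 + (l + 2) * s))"
  \<comment> \<open>With r = sqrt n, s r <= 10^-4 and \<delta>^2 r = 16, the three terms are at most
    128 s r, 16 (s r)^2 and s r, together below 1/50.\<close>
  have E: "0.98 \<le> E"
  proof -
    have "8 * n * s * \<delta>\<^sup>2 = 128 * (s * (real n / r))"
      unfolding \<delta>(1) r_def[symmetric] by simp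
    also have "real n / r = r" using r(2,3) by (simp add: field_simps)
    finally have f1: "8 * n * s * \<delta>\<^sup>2 = 128 * (s * r)" .
    have f2: "16 * n * s\<^sup>2 = 16 * (s * r)\<^sup>2" using r(3)[symmetric] by (simp add: power2_eq_square)
    have "(s * r)\<^sup>2 \<le> (1 / 10 ^ 4)\<^sup>2" using sr s0 r(2) by (intro power_mono) auto
    then have f3: "(s * r)\<^sup>2 \<le> 1 / 100000000" by (simp add: power2_eq_square)
    have f4: "(l + 2) * s \<le> s * r"
      unfolding mult.commute[of s r] by (rule mult_right_mono[OF _ s0]) (use lr rb in simp)
    have f5: "s * r \<le> 1 / 10000" using sr by simp
    have "8 * n * s * \<delta>\<^sup>2 + 16 * n * s\<^sup>2 + (l + 2) * s \<le> 1 / 50"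
      unfolding f1 f2 using f3 f4 f5 by linarith
    then have "1 - 0.02 \<le> 1 + - (8 * n * s * \<delta>\<^sup>2 + 16 * n * s\<^sup>2 + (l + 2) * s)" by simp
    also have "\<dots> \<le> E" unfolding E_def by (rule exp_ge_add_one_self)
    finally show ?thesis by simp
  qed
  have K: "0.98 \<le> 1 - real l * (2 * real l + 3) / real n"
  proof -
    have "real l * (2 * real l + 3) \<le> (r / 1000000) * (r / 10)" using lr rb by (intro mult_mono) auto
    also have "\<dots> \<le> 0.02 * n" unfolding r(3)[symmetric] by simp
    finally have "real l * (2 * real l + 3) / n \<le> 0.02" using n0 by (subst pos_divide_le_eq) auto
    then show ?thesis by simp
  qed
  define CC where "CC = (chi_const m / chi_const (m - l)) * (chi_const (n - m) / chi_const (n - m - l)) *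
       ((\<Prod>i<l. 1 / sqrt (\<mu> i)) * (\<Prod>i<l. 1 / sqrt (1 - \<mu> i)))"
  define C where "C = (chi_const n / chi_const (n - l))\<^sup>2"
  define W where "W = ((1 - s) powr (real (n - l) / 2 - 1))\<^sup>2"
  define W' where "W' = (1 - a) powr (real (m - l) / 2 - 1) * (1 - b) powr (real (n - m - l) / 2 - 1)"
  define q where "q = ((1 / sqrt (2 * pi)) ^ l)\<^sup>2"
  have CW: "0 \<le> C" "0 \<le> W" "0 \<le> q" by (simp_all add: C_def W_def q_def)
  have C: "0.98 * C \<le> CC"
  proof -
    have "0.98 * C \<le> (1 - real l * (2 * real l + 3) / real n) * C" using K CW by (intro mult_right_mono)
    also have "\<dots> \<le> CC" unfolding C_def CC_def by (rule density_constant_bound[OF m_def lm]) (use \<mu>' in auto)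
    finally show ?thesis .
  qed
  have W: "0.98 * W \<le> W'"
  proof -
    have "0.98 * W \<le> E * W" using E CW by (intro mult_right_mono)
    also have "\<dots> \<le> W'" unfolding E_def W_def W'_def by (rule ex(3))
    finally show ?thesis .
  qed
  have "(0.95 * sphere_density n l (\<lambda>_. 1) z)\<^sup>2 = q * (0.95\<^sup>2 * (C * W))"
    using s1 by (simp add: sphere_density_def s_def[symmetric] q_def C_def W_def power_mult_distrib power_divide)
  also have "\<dots> \<le> q * (CC * W')"
  proof (rule mult_left_mono)
    have "0.95\<^sup>2 * (C * W) \<le> (0.98 * C) * (0.98 * W)" using CW by (simp add: power2_eq_square mult_right_mono)
    also have "\<dots> \<le> CC * W'" using C W CW by (intro mult_mono) auto
    finally show "0.95\<^sup>2 * (C * W) \<le> CC * W'" .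
  qed (rule CW)
  also have "q * (CC * W') = sphere_density m l \<mu> z * sphere_density (n - m) l (\<lambda>i. 1 - \<mu> i) z"
  proof -
    have "sphere_density m l \<mu> z = (1 / sqrt (2 * pi)) ^ l * chi_const m / chi_const (m - l) *
        (\<Prod>i<l. 1 / sqrt (\<mu> i)) * (1 - a) powr (real (m - l) / 2 - 1)"
      using a1 by (simp add: sphere_density_def a_def[symmetric])
    moreover have "sphere_density (n - m) l (\<lambda>i. 1 - \<mu> i) z = (1 / sqrt (2 * pi)) ^ l * chi_const (n - m) / chi_const (n - m - l) *
        (\<Prod>i<l. 1 / sqrt (1 - \<mu> i)) * (1 - b) powr (real (n - m - l) / 2 - 1)"
      using b1 by (simp add: sphere_density_def b_def[symmetric])
    ultimately show ?thesis
      by (simp only: q_def CC_def W'_def power2_eq_square times_divide_eq_left times_divide_eq_right mult_ac divide_divide_eq_left)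
  qed
  finally show ?thesis by (simp add: m_def)
qed

subsection \<open>Sections of sets depending on few directions\<close>

lemma ge_exp_imp_inverse_sqrt_le: "exp L \<le> y \<Longrightarrow> 1 / sqrt y \<le> exp (- L / 2)"
proof -
  assume y: "exp L \<le> y"
  have "(exp (L / 2))\<^sup>2 = exp L" by (simp flip: exp_double)
  then have "exp (L / 2) = sqrt (exp L)" by (metis exp_ge_zero real_sqrt_unique)
  also have "\<dots> \<le> sqrt y" using y by simp
  finally have "1 / sqrt y \<le> 1 / exp (L / 2)" by (intro divide_left_mono) (auto intro: mult_pos_pos less_le_trans[OF exp_gt_zero])
  then show ?thesis by (simp add: exp_minus inverse_eq_divide)
qed

text \<open>Chernoff with parameter 1/4: each of the l directions costs a factor of at most exp
  (1/2), while each of the other coordinates, at least n / 2 in number, gains exp (- \<tau> /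
  8).\<close>

lemma gauss_on_few_directions_tail:
  assumes f: "orthonormal_family l f" "f ` {..<l} \<subseteq> Euclid n" and l: "2 * l \<le> n" and \<tau>: "0 < \<tau>" "\<tau> \<le> 1"
  shows "measure (gauss_on (Euclid n)) {x. \<tau> * (norm x)\<^sup>2 \<le> (\<Sum>i<l. (x \<bullet> f i)\<^sup>2)} \<le> exp (l - \<tau> * n / 16)"
proof -
  obtain d e where de: "l \<le> d" "orthonormal_basis (Euclid n) d e" and ef: "\<And>i. i < l \<Longrightarrow> e i = f i"
    using orthonormal_family_extend[OF subspace_Euclid subset_refl f] by blast
  have "d = n" using orthonormal_basis_dim[OF de(2)] by (simp add: dim_Euclid)
  with de have e: "orthonormal_basis (Euclid n) n e" and ln: "l \<le> n" by auto
  note F = orthonormal_basis_family[OF e]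
  interpret prob_space "gaussian_prod {..<n}" by (rule prob_space_gaussian_prod)
  define a where "a i = (if i < l then (1 - \<tau>) / 4 else - \<tau> / 4)" for i
  let ?A = "{x. \<tau> * (norm x)\<^sup>2 \<le> (\<Sum>i<l. (x \<bullet> f i)\<^sup>2)}"
  have A: "?A \<in> sets borel" by measurable
  have "measure (gauss_on (Euclid n)) ?A
     = measure (gaussian_prod {..<n}) (lincomb n e -` ?A \<inter> space (gaussian_prod {..<n}))"
    unfolding gauss_on_eq[OF e] using A by (intro measure_distr) auto
  also have "\<dots> \<le> measure (gaussian_prod {..<n}) {x \<in> space (gaussian_prod {..<n}). 0 \<le> (\<Sum>i\<in>{..<n}. a i * (x i)\<^sup>2)}"
  proof (rule finite_measure_mono)
    show "lincomb n e -` ?A \<inter> space (gaussian_prod {..<n})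
      \<subseteq> {x \<in> space (gaussian_prod {..<n}). 0 \<le> (\<Sum>i\<in>{..<n}. a i * (x i)\<^sup>2)}"
    proof safe
      fix x assume "\<tau> * (norm (lincomb n e x))\<^sup>2 \<le> (\<Sum>i<l. (lincomb n e x \<bullet> f i)\<^sup>2)"
      moreover have "(\<Sum>i<l. (lincomb n e x \<bullet> f i)\<^sup>2) = (\<Sum>i<l. (x i)\<^sup>2)"
        using ln by (intro sum.cong) (auto simp: ef[symmetric] inner_lincomb[OF F])
      ultimately have "0 \<le> (1/4) * ((\<Sum>i<l. (x i)\<^sup>2) - \<tau> * (\<Sum>i<n. (x i)\<^sup>2))"
        by (simp add: norm_lincomb_sq[OF F])
      also have "(\<Sum>i<l. (x i)\<^sup>2) = (\<Sum>i<n. if i < l then (x i)\<^sup>2 else 0)"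
        using ln by (intro sum.mono_neutral_cong_left) auto
      also have "(1/4) * ((\<Sum>i<n. if i < l then (x i)\<^sup>2 else 0) - \<tau> * (\<Sum>i<n. (x i)\<^sup>2)) = (\<Sum>i<n. a i * (x i)\<^sup>2)"
        unfolding sum_distrib_left sum_subtractf[symmetric]
        by (intro sum.cong) (auto simp: a_def field_simps)
      finally show "0 \<le> (\<Sum>i\<in>{..<n}. a i * (x i)\<^sup>2)" .
    qed
  qed measurable
  also have "\<dots> \<le> (\<Prod>i\<in>{..<n}. 1 / sqrt (1 - 2 * a i))"
    using \<tau> by (intro gaussian_chernoff) (auto simp: a_def)
  also have "\<dots> \<le> (\<Prod>i\<in>{..<n}. exp (if i < l then 1 / 2 else - \<tau> / 8))"
  proof (rule prod_mono, rule conjI)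
    fix i
    show "0 \<le> 1 / sqrt (1 - 2 * a i)" using \<tau> by (auto simp: a_def)
    show "1 / sqrt (1 - 2 * a i) \<le> exp (if i < l then 1 / 2 else - \<tau> / 8)"
    proof (cases "i < l")
      case True
      have "exp (-1) \<le> (1/2 :: real)" using exp_ge_add_one_self[of 1] by (simp add: exp_minus field_simps)
      also have "1/2 \<le> 1 - 2 * a i" using True \<tau> by (simp add: a_def field_simps)
      finally show ?thesis using ge_exp_imp_inverse_sqrt_le[of "-1" "1 - 2 * a i"] True by simp
    next
      case False
      have "\<tau> / 4 \<le> ln (1 + \<tau> / 2)" using ln_one_plus_ge_half[of "\<tau> / 2"] \<tau> by simp
      then have "exp (\<tau> / 4) \<le> exp (ln (1 + \<tau> / 2))" by simp
      also have "\<dots> = 1 - 2 * a i" using False \<tau> by (simp add: a_def)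
      finally show ?thesis using ge_exp_imp_inverse_sqrt_le[of "\<tau> / 4" "1 - 2 * a i"] False by simp
    qed
  qed
  also have "\<dots> = exp (\<Sum>i<n. if i < l then 1 / 2 else - \<tau> / 8)" by (simp add: exp_sum)
  also have "(\<Sum>i<n. if i < l then 1 / 2 else - \<tau> / 8) = real l / 2 - \<tau> * (real n - real l) / 8"
  proof -
    have "(\<Sum>i<n. if i < l then 1 / 2 else - \<tau> / 8) = (\<Sum>i\<in>{..<l} \<union> {l..<n}. if i < l then 1 / 2 else - \<tau> / 8)"
      using ln by (intro sum.cong) auto
    also have "\<dots> = (\<Sum>i<l. 1 / 2) + (\<Sum>i\<in>{l..<n}. - \<tau> / 8)"
      by (subst sum.union_disjoint) auto
    finally show ?thesis using ln by (simp add: of_nat_diff algebra_simps)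
  qed
  also have "exp (real l / 2 - \<tau> * (real n - real l) / 8) \<le> exp (l - \<tau> * n / 16)"
  proof -
    have "\<tau> * (real n / 2) \<le> \<tau> * (real n - real l)" using l \<tau> by (intro mult_left_mono) auto
    then show ?thesis by simp
  qed
  finally show ?thesis .
qed

text \<open>The hypothesis on f says that on V the coordinates along f are dilated coordinates along
  an orthonormal basis of V. This form serves H, its complement and the whole space alike, with
  \<mu>, 1 - \<mu> and 1.\<close>

lemma sphere_section_density:
  assumes e: "orthonormal_basis V d e" and V: "V \<subseteq> Euclid n" and l: "l < d"
    and \<mu>: "\<And>i. i < l \<Longrightarrow> 0 < \<mu> i"
    and ef: "\<And>x i. x \<in> V \<Longrightarrow> i < l \<Longrightarrow> x \<bullet> f i = sqrt (\<mu> i) * (x \<bullet> e i)"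
    and B: "B \<in> sets (lebesgue_prod {..<l})" and A: "A \<in> sets (sphere_borel (Euclid n))"
    and AB: "A = {x \<in> sphere 0 1 \<inter> Euclid n. (\<lambda>i\<in>{..<l}. x \<bullet> f i) \<in> B}"
  shows "ennreal (measure (haar_sphere V) (A \<inter> V))
    = (\<integral>\<^sup>+z. indicator B z * ennreal (sphere_density d l \<mu> z) \<partial>lebesgue_prod {..<l})"
proof -
  have d: "d > 0" using l by simp
  interpret prob_space "gauss_on V" by (rule prob_space_gauss_on)
  have AV: "A \<inter> V \<in> sets (sphere_borel V)"
  proof -
    have "sphere 0 1 \<inter> Euclid n \<in> sets borel" by (rule sphere_Int_borel[OF orthonormal_basis_unit])
    then have "A \<in> sets borel" using A by (auto simp: sphere_borel_def sets_restrict_space_iff)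
    then have "A \<inter> V \<in> sets borel" using borel_orthonormal_basis[OF e] by auto
    then show ?thesis
      using sphere_Int_borel[OF e] AB by (auto simp: sphere_borel_def sets_restrict_space_iff)
  qed
  let ?X = "{x. (\<lambda>i\<in>{..<l}. sqrt (\<mu> i) * (x \<bullet> e i) / norm x) \<in> B}"
  have X: "?X \<in> sets borel"
  proof -
    have m: "(\<lambda>x. \<lambda>i\<in>{..<l}. sqrt (\<mu> i) * (x \<bullet> e i) / norm x) \<in> measurable borel (lebesgue_prod {..<l})"
      by measurable
    show ?thesis using measurable_sets[OF m B] by (simp add: vimage_def)
  qed
  have "measure (haar_sphere V) (A \<inter> V) = measure (gauss_on V) {x. x /\<^sub>R norm x \<in> A \<inter> V}"
    by (rule measure_haar_sphere[OF e d V AV])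
  also have "\<dots> = measure (gauss_on V) ?X"
  proof (rule measure_eq_AE)
    have "AE x in gauss_on V. x \<in> V \<and> x \<noteq> 0"
      using AE_gauss_on_mem[OF e] AE_gauss_on_nonzero[OF e d] by auto
    then show "AE x in gauss_on V. (x \<in> {x. x /\<^sub>R norm x \<in> A \<inter> V}) = (x \<in> ?X)"
    proof eventually_elim
      fix x assume x: "x \<in> V \<and> x \<noteq> 0"
      then have y: "x /\<^sub>R norm x \<in> V" using subspace_scale[OF orthonormal_basis_subspace[OF e]] by simp
      have "(\<lambda>i\<in>{..<l}. (x /\<^sub>R norm x) \<bullet> f i) = (\<lambda>i\<in>{..<l}. sqrt (\<mu> i) * (x \<bullet> e i) / norm x)"
        using x ef by (intro restrict_ext) (simp add: divide_inverse mult_ac)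
      then show "(x \<in> {x. x /\<^sub>R norm x \<in> A \<inter> V}) = (x \<in> ?X)"
        using x y V by (auto simp: AB)
    qed
    have "A \<inter> V \<in> sets borel"
      using AV sphere_Int_borel[OF e] by (auto simp: sphere_borel_def sets_restrict_space_iff)
    then show "{x. x /\<^sub>R norm x \<in> A \<inter> V} \<in> sets (gauss_on V)" by measurable
    show "?X \<in> sets (gauss_on V)" using X by simp
  qed
  finally show ?thesis
    using gauss_on_sphere_density[OF e l \<mu> B] by (simp add: emeasure_eq_measure)
qed

text \<open>Since the projection P satisfies \<open>P x \<bullet> P y = P x \<bullet> y\<close>,
  diagonality makes the vectors P (f i) orthogonal with squared norms \<mu> i. Normalised, they
  extend to a basis of H, and x in H sees f i only through P (f i).\<close>

lemma diagonal_section_basis: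
  assumes H: "H \<in> grassmannian n d" and f: "orthonormal_family l f"
    and diag: "\<And>i j. i < l \<Longrightarrow> j < l \<Longrightarrow> i \<noteq> j \<Longrightarrow> orth_proj H (f i) \<bullet> f j = 0"
    and \<mu>: "\<And>i. i < l \<Longrightarrow> \<mu> i = orth_proj H (f i) \<bullet> f i" "\<And>i. i < l \<Longrightarrow> 0 < \<mu> i"
  shows "\<exists>e. orthonormal_basis H d e \<and> (\<forall>x\<in>H. \<forall>i<l. x \<bullet> f i = sqrt (\<mu> i) * (x \<bullet> e i))"
proof -
  let ?P = "orth_proj H"
  have PP: "?P x \<bullet> ?P y = ?P x \<bullet> y" for x y
    using orth_proj_grassmannian(5)[OF H, of y x] by (simp add: inner_diff_left inner_diff_right inner_commute)
  define e0 where "e0 i = ?P (f i) /\<^sub>R sqrt (\<mu> i)" for i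
  have sH: "subspace H" "H \<subseteq> Euclid n" using H by (auto simp: grassmannian_def)
  have "orthonormal_family l e0"
    unfolding orthonormal_family_def
  proof (intro allI impI)
    fix i j assume ij: "i < l" "j < l"
    have "e0 i \<bullet> e0 j = (?P (f i) \<bullet> f j) / (sqrt (\<mu> i) * sqrt (\<mu> j))"
      by (simp add: e0_def PP divide_inverse)
    then show "e0 i \<bullet> e0 j = (if i = j then 1 else 0)"
      using ij diag[of i j] \<mu>(1)[of i] \<mu>(2)[of i] by auto
  qed
  moreover have "e0 ` {..<l} \<subseteq> H"
    using orth_proj_grassmannian(2)[OF H] subspace_scale[OF sH(1)] by (auto simp: e0_def)
  ultimately obtain d' e where e: "orthonormal_basis H d' e" "\<And>i. i < l \<Longrightarrow> e i = e0 i"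
    using orthonormal_family_extend[OF sH, of l e0] by blast
  have "d' = d" using orthonormal_basis_dim[OF e(1)] H by (simp add: grassmannian_def)
  moreover have "x \<bullet> f i = sqrt (\<mu> i) * (x \<bullet> e i)" if x: "x \<in> H" and i: "i < l" for x i
  proof -
    obtain b where b: "orthonormal_basis H d b" using grassmannian_basis[OF H] by blast
    have "?P x = x" unfolding orth_proj_eq[OF b] by (rule orthonormal_basis_expand[OF b x])
    then have "x \<bullet> f i = x \<bullet> ?P (f i)" using orth_proj_grassmannian(4)[OF H, of x "f i"] by simp
    also have "\<dots> = sqrt (\<mu> i) * (x \<bullet> e i)" using e(2)[OF i] \<mu>(2)[OF i] by (simp add: e0_def)
    finally show ?thesis .
  qed
  ultimately show ?thesis using e(1) by blast
qed

text \<open>For positive a and b, \<open>2 * sqrt (a * b)\<close> is the minimum of c a + b / c over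
  c > 0. This form of Cauchy-Schwarz needs only linear inequalities between integrals.\<close>

lemma le_sqrt_mult_if_weighted_am:
  fixes a b Y :: real
  assumes ab: "0 \<le> a" "0 \<le> b" and Y: "\<And>c. c > 0 \<Longrightarrow> 2 * Y \<le> c * a + b / c"
  shows "Y \<le> sqrt (a * b)"
proof -
  consider "Y \<le> 0" | "Y > 0" "a = 0" | "Y > 0" "b = 0" | "a > 0" "b > 0" using ab by linarith
  then show ?thesis
  proof cases
    case 1
    then show ?thesis using ab by (simp add: order_trans[OF _ real_sqrt_ge_zero])
  next
    case 2
    \<comment> \<open>With a = 0 this weight is so large that 2 Y <= Y, impossible for Y > 0; the
      case b = 0 uses a small weight in the same way.\<close>
    have "2 * Y \<le> b / ((b + 1) / Y)" using Y[of "(b + 1) / Y"] 2 ab by simp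
    also have "\<dots> = Y * (b / (b + 1))" by simp
    also have "\<dots> \<le> Y * 1" using 2 ab by (intro mult_left_mono) (auto simp: divide_le_eq)
    finally show ?thesis using 2 by simp
  next
    case 3
    have "2 * Y \<le> (Y / (a + 1)) * a" using Y[of "Y / (a + 1)"] 3 ab by simp
    also have "\<dots> = Y * (a / (a + 1))" by simp
    also have "\<dots> \<le> Y * 1" using 3 ab by (intro mult_left_mono) (auto simp: divide_le_eq)
    finally show ?thesis using 3 by simp
  next
    case 4
    define c where "c = sqrt b / sqrt a"
    have sab: "sqrt a > 0" "sqrt b > 0" using 4 by auto
    have "c * a = sqrt a * sqrt b" using sab 4 by (simp add: c_def field_simps)
    moreover have "b / c = sqrt a * sqrt b" using sab 4 by (simp add: c_def field_simps)
    ultimately show ?thesis using Y[of c] sab by (simp add: c_def real_sqrt_mult)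
  qed
qed

text \<open>The geometric mean of the two section densities dominates the full density up to a factor
  close to one, so the Cauchy--Schwarz inequality gives the lower bound.\<close>

lemma good_section_bound:
  fixes n l :: nat
  assumes n: "10 ^ 8 \<le> sqrt n" and l: "l \<le> sqrt n / 10 ^ 6"
    and F: "orthonormal_basis F l f0" "F \<subseteq> Euclid n"
    and A: "A \<in> sets (sphere_borel (Euclid n))"
    and AB: "\<And>f. orthonormal_basis F l f \<Longrightarrow>
      \<exists>B \<in> sets (lebesgue_prod {..<l}). A = {x \<in> sphere 0 1 \<inter> Euclid n. (\<lambda>i\<in>{..<l}. x \<bullet> f i) \<in> B}"
    and \<sigma>: "exp (- (1 / 10 ^ 6) * sqrt n) \<le> measure (haar_sphere (Euclid n)) A"
    and H: "H \<in> grassmannian n (n div 2)"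
    and good: "\<And>y. y \<in> F \<Longrightarrow> norm y = 1 \<Longrightarrow> \<bar>(norm (orth_proj H y))\<^sup>2 - 1 / 2\<bar> \<le> \<delta>"
    and \<delta>: "\<delta>\<^sup>2 = 16 / sqrt n" "0 \<le> \<delta>"
  shows "0.9 * measure (haar_sphere (Euclid n)) A \<le>
    sqrt (measure (haar_sphere H) (A \<inter> H) *
      measure (haar_sphere (orthogonal_comp H \<inter> Euclid n)) (A \<inter> (orthogonal_comp H \<inter> Euclid n)))"
proof -
  define r where "r = sqrt (real n)"
  have rb: "100000000 \<le> r" using n by (simp add: r_def)
  have rr: "r * r = n" by (simp add: r_def)
  have lr: "1000000 * real l \<le> r" using l by (simp add: r_def)
  have "100000000 * r \<le> r * r" using rb by (intro mult_right_mono) auto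
  then have n8: "100000000 * r \<le> n" using rr by simp
  define m where "m = n div 2"
  have nm: "real n \<le> 2 * real m + 1" unfolding m_def by linarith
  have lm: "l + 2 \<le> m" using n8 lr nm rb by linarith
  have mn: "2 * m \<le> n" by (simp add: m_def)
  have H: "H \<in> grassmannian n m" using H by (simp add: m_def)
  have \<delta>4: "\<delta> \<le> 1 / 4"
  proof (rule power2_le_imp_le)
    have "16 / r \<le> 16 / 100000000" using rb by (intro divide_left_mono) auto
    then show "\<delta>\<^sup>2 \<le> (1/4)\<^sup>2" unfolding \<delta> r_def[symmetric] by (simp add: power2_eq_square)
  qed simp
  obtain f where f: "orthonormal_basis F l f"
    and diag: "\<And>i j. i < l \<Longrightarrow> j < l \<Longrightarrow> i \<noteq> j \<Longrightarrow> orth_proj H (f i) \<bullet> f j = 0"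
    using diagonal_basis_exists[OF H F] by blast
  note Of = orthonormal_basis_family[OF f]
  have fF: "f i \<in> F" if "i < l" for i by (rule orthonormal_basis_mem[OF f that])
  have fE: "f i \<in> Euclid n" if "i < l" for i using fF[OF that] F(2) by auto
  obtain B where B: "B \<in> sets (lebesgue_prod {..<l})" "A = {x \<in> sphere 0 1 \<inter> Euclid n. (\<lambda>i\<in>{..<l}. x \<bullet> f i) \<in> B}"
    using AB[OF f] by blast
  define \<mu> where "\<mu> i = orth_proj H (f i) \<bullet> f i" for i
  have \<mu>: "\<bar>\<mu> i - 1 / 2\<bar> \<le> \<delta>" if "i < l" for i
  proof -
    have "\<mu> i = (norm (orth_proj H (f i)))\<^sup>2"
      using orth_proj_grassmannian(5)[OF H, of "f i" "f i"]
      by (simp add: \<mu>_def power2_norm_eq_inner inner_diff_left inner_diff_right inner_commute)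
    moreover have "norm (f i) = 1" using orthonormal_familyD[OF Of that that] by (simp add: norm_eq_1)
    ultimately show ?thesis using good[OF fF[OF that]] by simp
  qed
  have \<mu>': "0 < \<mu> i" "0 < 1 - \<mu> i" if "i < l" for i using \<mu>[OF that] \<delta>4 by (auto simp: abs_le_iff)
  obtain c where c: "orthonormal_basis (Euclid n) n c" "orthonormal_basis H m c" "m \<le> n"
    using grassmannian_basis[OF H] by blast
  let ?H' = "orthogonal_comp H \<inter> Euclid n"
  have H': "?H' \<in> grassmannian n (n - m)" by (rule grassmannianI[OF orthonormal_basis_complement[OF c]]) auto
  \<comment> \<open>On \<open>Euclid n\<close> the projection onto the complement is the identity
    minus that onto H, so the same f diagonalises both.\<close>
  have P': "orth_proj ?H' (f i) \<bullet> f j = (if i = j then 1 - \<mu> i else 0)" if "i < l" "j < l" for i j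
    using orth_proj_complement[OF c fE[OF that(1)]] orthonormal_familyD[OF Of that] diag[OF that]
    by (simp add: inner_diff_left \<mu>_def)
  obtain e where e: "orthonormal_basis H m e" "\<And>x i. x \<in> H \<Longrightarrow> i < l \<Longrightarrow> x \<bullet> f i = sqrt (\<mu> i) * (x \<bullet> e i)"
    using diagonal_section_basis[OF H Of diag, of \<mu>] \<mu>'(1) by (auto simp: \<mu>_def)
  have "\<exists>e. orthonormal_basis ?H' (n - m) e \<and> (\<forall>x\<in>?H'. \<forall>i<l. x \<bullet> f i = sqrt (1 - \<mu> i) * (x \<bullet> e i))"
    by (rule diagonal_section_basis[OF H' Of]) (use P' \<mu>' in auto)
  then obtain e' where e': "orthonormal_basis ?H' (n - m) e'" "\<And>x i. x \<in> ?H' \<Longrightarrow> i < l \<Longrightarrow> x \<bullet> f i = sqrt (1 - \<mu> i) * (x \<bullet> e' i)"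
    by blast
  \<comment> \<open>For the whole sphere f itself extends to an orthonormal basis, and all weights
    are 1.\<close>
  obtain d e'' where "l \<le> d" "orthonormal_basis (Euclid n) d e''" "\<And>i. i < l \<Longrightarrow> e'' i = f i"
    using orthonormal_family_extend[OF subspace_Euclid subset_refl Of, of n] fE by blast
  then have e'': "orthonormal_basis (Euclid n) n e''" "\<And>i. i < l \<Longrightarrow> e'' i = f i"
    using orthonormal_basis_dim[of "Euclid n" d e''] by (auto simp: dim_Euclid)
  define a where "a = measure (haar_sphere H) (A \<inter> H)"
  define b where "b = measure (haar_sphere ?H') (A \<inter> ?H')"
  define s where "s = measure (haar_sphere (Euclid n)) A"
  let ?p = "sphere_density m l \<mu>" and ?q = "sphere_density (n - m) l (\<lambda>i. 1 - \<mu> i)" and ?r = "sphere_density n l (\<lambda>_. 1)"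
  have ha: "ennreal a = (\<integral>\<^sup>+z. indicator B z * ennreal (?p z) \<partial>lebesgue_prod {..<l})"
    unfolding a_def using c(2) H lm
    by (intro sphere_section_density[OF e(1) _ _ _ e(2) B(1) A B(2)] \<mu>') (auto simp: grassmannian_def)
  have hb: "ennreal b = (\<integral>\<^sup>+z. indicator B z * ennreal (?q z) \<partial>lebesgue_prod {..<l})"
    unfolding b_def using lm mn
    by (intro sphere_section_density[OF e'(1) _ _ _ e'(2) B(1) A B(2)] \<mu>') auto
  have AE': "A \<inter> Euclid n = A" using B(2) by auto
  have hs: "ennreal s = (\<integral>\<^sup>+z. indicator B z * ennreal (?r z) \<partial>lebesgue_prod {..<l})"
    unfolding s_def using lm mn e''(2)
    by (subst AE'[symmetric], intro sphere_section_density[OF e''(1) _ _ _ _ B(1) A B(2)]) auto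
  define \<tau> where "\<tau> = 1 / (10 ^ 4 * r)"
  have \<tau>: "0 < \<tau>" "\<tau> \<le> 1"
  proof -
    show "0 < \<tau>" unfolding \<tau>_def by (intro divide_pos_pos mult_pos_pos) (use rb in auto)
    have "1 * 1 \<le> 10 ^ 4 * r" using rb by (intro mult_mono) auto
    then show "\<tau> \<le> 1" unfolding \<tau>_def by (subst divide_le_eq) auto
  qed
  define S where "S = {z \<in> space (lebesgue_prod {..<l}). (\<Sum>i<l. (z i)\<^sup>2) \<le> \<tau>}"
  define L where "L = {z \<in> space (lebesgue_prod {..<l}). \<tau> < (\<Sum>i<l. (z i)\<^sup>2)}"
  have [measurable]: "S \<in> sets (lebesgue_prod {..<l})" "L \<in> sets (lebesgue_prod {..<l})"
    "B \<in> sets (lebesgue_prod {..<l})" using B(1) by (auto simp: S_def L_def)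
  have pos: "0 \<le> ?p z" "0 \<le> ?q z" "0 \<le> ?r z" for z
    using lm mn \<mu>' by (auto intro!: sphere_density_nonneg)
  define Y where "Y = enn2real (\<integral>\<^sup>+z. indicator (B \<inter> S) z * ennreal (?r z) \<partial>lebesgue_prod {..<l})"
  have Yfin: "(\<integral>\<^sup>+z. indicator (B \<inter> S) z * ennreal (?r z) \<partial>lebesgue_prod {..<l}) \<le> ennreal s"
    unfolding hs by (intro nn_integral_mono) (auto split: split_indicator)
  then have Y: "(\<integral>\<^sup>+z. indicator (B \<inter> S) z * ennreal (?r z) \<partial>lebesgue_prod {..<l}) = ennreal Y"
    unfolding Y_def by (metis ennreal_enn2real ennreal_less_top order_le_less_trans)
  have Y0: "0 \<le> Y" by (simp add: Y_def)
  have tail: "(\<integral>\<^sup>+z. indicator L z * ennreal (?r z) \<partial>lebesgue_prod {..<l}) \<le> ennreal (exp (l - \<tau> * n / 16))"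
  proof -
    interpret G: prob_space "gauss_on (Euclid n)" by (rule prob_space_gauss_on)
    let ?X = "{x. (\<lambda>i\<in>{..<l}. sqrt 1 * (x \<bullet> e'' i) / norm x) \<in> L}"
    have "(\<integral>\<^sup>+z. indicator L z * ennreal (?r z) \<partial>lebesgue_prod {..<l}) = emeasure (gauss_on (Euclid n)) ?X"
      using lm mn by (subst gauss_on_sphere_density[OF e''(1)]) auto
    also have "\<dots> \<le> emeasure (gauss_on (Euclid n)) {x. \<tau> * (norm x)\<^sup>2 \<le> (\<Sum>i<l. (x \<bullet> f i)\<^sup>2)}"
    proof (rule emeasure_mono, safe)
      fix x assume "(\<lambda>i\<in>{..<l}. sqrt 1 * (x \<bullet> e'' i) / norm x) \<in> L"
      then have h: "\<tau> < (\<Sum>i<l. (x \<bullet> f i / norm x)\<^sup>2)" using e''(2) by (simp add: L_def)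
      then have "norm x \<noteq> 0" using \<tau> by (cases "x = 0") auto
      then have "0 < (norm x)\<^sup>2" by simp
      have "(\<Sum>i<l. (x \<bullet> f i / norm x)\<^sup>2) = (\<Sum>i<l. (x \<bullet> f i)\<^sup>2) / (norm x)\<^sup>2"
        by (simp add: power_divide sum_divide_distrib)
      then show "\<tau> * (norm x)\<^sup>2 \<le> (\<Sum>i<l. (x \<bullet> f i)\<^sup>2)"
        using h \<open>0 < (norm x)\<^sup>2\<close> by (simp add: pos_less_divide_eq)
    qed measurable
    also have "\<dots> \<le> ennreal (exp (l - \<tau> * n / 16))"
      unfolding G.emeasure_eq_measure using fE lm mn \<tau>
      by (intro ennreal_leI gauss_on_few_directions_tail[OF Of]) auto
    finally show ?thesis .
  qed
  \<comment> \<open>Here \<open>\<tau> * n / 16\<close> is r / 160000, while l and the exponent in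
    the lower bound on s are at most r / 10^6 each. As r is at least 10^8, the surplus exceeds 6,
    and exp 6 >= 2^6 > 50.\<close>
  have small: "exp (l - \<tau> * n / 16) \<le> 0.02 * s"
  proof -
    have "\<tau> * n = r / 10000" unfolding \<tau>_def rr[symmetric] using rb by simp
    then have "l - \<tau> * n / 16 \<le> - 6 + - (1 / 10 ^ 6) * r"
      using lr rb by simp
    then have "exp (l - \<tau> * n / 16) \<le> exp (- 6) * exp (- (1 / 10 ^ 6) * r)"
      unfolding exp_add[symmetric] exp_le_cancel_iff .
    also have "\<dots> \<le> 0.02 * s"
    proof (rule mult_mono)
      have "(2::real) ^ 6 \<le> exp 1 ^ 6"
        using exp_ge_add_one_self[of "1::real"] by (intro power_mono) auto
      also have "exp 1 ^ 6 = exp (6::real)" using exp_of_nat_mult[of 6 "1::real"] by simp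
      finally have "50 \<le> exp (6::real)" by simp
      then show "exp (- 6) \<le> (0.02::real)" by (simp add: exp_minus field_simps)
      show "exp (- (1 / 10 ^ 6) * r) \<le> s" using \<sigma> by (simp add: r_def s_def)
    qed auto
    finally show ?thesis .
  qed
  have "ennreal s \<le> (\<integral>\<^sup>+z. indicator (B \<inter> S) z * ennreal (?r z) + indicator L z * ennreal (?r z) \<partial>lebesgue_prod {..<l})"
    unfolding hs by (intro nn_integral_mono) (auto simp: S_def L_def not_le split: split_indicator)
  also have "\<dots> = ennreal Y + (\<integral>\<^sup>+z. indicator L z * ennreal (?r z) \<partial>lebesgue_prod {..<l})"
    unfolding Y[symmetric] by (rule nn_integral_add) measurable
  also have "\<dots> \<le> ennreal Y + ennreal (0.02 * s)"
    using tail small by (intro add_left_mono order_trans[OF tail] ennreal_leI)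
  also have "\<dots> = ennreal (Y + 0.02 * s)" using Y0 by (subst ennreal_plus) (auto simp: s_def)
  finally have sY: "s \<le> Y + 0.02 * s" using Y0 by (subst (asm) ennreal_le_iff) (auto simp: s_def)
  have "0.95 * Y \<le> sqrt (a * b)"
  proof (rule le_sqrt_mult_if_weighted_am)
    show "0 \<le> a" "0 \<le> b" by (simp_all add: a_def b_def)
    fix c :: real assume c: "c > 0"
    \<comment> \<open>The weighted arithmetic-geometric mean inequality makes the pointwise
      comparison linear in the densities, so that it can be integrated.\<close>
    have pt: "2 * (0.95 * ?r z) \<le> c * ?p z + ?q z / c" if z: "z \<in> S" for z
    proof -
      have "(\<Sum>i<l. (z i)\<^sup>2) \<le> 1 / (10 ^ 4 * sqrt n)" using z by (simp add: S_def \<tau>_def r_def)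
      from sphere_density_comparison[where \<mu>=\<mu>, OF n l \<mu> \<delta> this]
      have "(0.95 * ?r z)\<^sup>2 \<le> ?p z * ?q z" by (simp add: m_def)
      also have "\<dots> = (c * ?p z) * (?q z / c)" using c by simp
      also have "\<dots> \<le> ((c * ?p z + ?q z / c) / 2)\<^sup>2"
        using zero_le_power2[of "c * ?p z - ?q z / c"] unfolding power2_eq_square by (simp add: algebra_simps)
      finally have "0.95 * ?r z \<le> (c * ?p z + ?q z / c) / 2"
        by (rule power2_le_imp_le) (use pos c in simp)
      then show ?thesis by simp
    qed
    have "ennreal (2 * (0.95 * Y)) = ennreal (2 * 0.95) * ennreal Y" by (simp add: ennreal_mult'[symmetric])
    also have "\<dots> = (\<integral>\<^sup>+z. ennreal (2 * 0.95) * (indicator (B \<inter> S) z * ennreal (?r z)) \<partial>lebesgue_prod {..<l})"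
      unfolding Y[symmetric] by (rule nn_integral_cmult[symmetric]) measurable
    also have "\<dots> \<le> (\<integral>\<^sup>+z. ennreal c * (indicator B z * ennreal (?p z)) + ennreal (1 / c) * (indicator B z * ennreal (?q z)) \<partial>lebesgue_prod {..<l})"
    proof (rule nn_integral_mono)
      fix z
      show "ennreal (2 * 0.95) * (indicator (B \<inter> S) z * ennreal (?r z))
        \<le> ennreal c * (indicator B z * ennreal (?p z)) + ennreal (1 / c) * (indicator B z * ennreal (?q z))"
      proof (cases "z \<in> B \<inter> S")
        case True
        have "ennreal (2 * 0.95) * ennreal (?r z) = ennreal (2 * (0.95 * ?r z))"
          using pos by (simp add: ennreal_mult'[symmetric])
        also have "\<dots> \<le> ennreal (c * ?p z + (1 / c) * ?q z)" using pt[of z] True by (intro ennreal_leI) simp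
        also have "\<dots> = ennreal c * ennreal (?p z) + ennreal (1 / c) * ennreal (?q z)"
          using pos c by (simp add: ennreal_plus ennreal_mult'[symmetric])
        finally show ?thesis using True by simp
      qed simp
    qed
    also have "\<dots> = ennreal c * ennreal a + ennreal (1 / c) * ennreal b"
      unfolding ha hb by (subst nn_integral_add, measurable) (subst (1 2) nn_integral_cmult, measurable)
    also have "\<dots> = ennreal (c * a + b / c)"
      using c by (simp add: ennreal_plus ennreal_mult'[symmetric] a_def b_def)
    finally show "2 * (0.95 * Y) \<le> c * a + b / c"
      using c by (subst (asm) ennreal_le_iff) (auto simp: a_def b_def)
  qed
  \<comment> \<open>Y >= 0.98 s, and 0.95 times 0.98 is 0.931.\<close>
  moreover have "0.9 * s \<le> 0.95 * Y" using sY Y0 by simp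
  ultimately show ?thesis unfolding s_def a_def b_def by linarith
qed

text \<open>The numbers <x, v j> are linear functions of the coordinates of x in any orthonormal
  basis f of the span of the directions. The given directions can therefore be traded for the basis
  that diagonalises H, at the price of a set B that depends on H.\<close>

lemma depends_on_directions_coordinates:
  assumes v: "\<And>j. j < k \<Longrightarrow> v j \<in> Euclid n" and I: "I \<in> sets (restrict_space borel (Euclid k))"
    and A: "A = {x \<in> sphere 0 1 \<inter> Euclid n. (\<Sum>j<k. (x \<bullet> v j) *\<^sub>R unit_fseq j) \<in> I}"
    and f: "orthonormal_basis (span (v ` {..<k})) l f"
  shows "\<exists>B \<in> sets (lebesgue_prod {..<l}). A = {x \<in> sphere 0 1 \<inter> Euclid n. (\<lambda>i\<in>{..<l}. x \<bullet> f i) \<in> B}"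
proof -
  define \<Psi> where "\<Psi> z = (\<Sum>j<k. (\<Sum>i<l. z i * (f i \<bullet> v j)) *\<^sub>R unit_fseq j)" for z
  have \<Psi>m: "\<Psi> \<in> borel_measurable (lebesgue_prod {..<l})" unfolding \<Psi>_def by measurable
  have IB: "I \<in> sets borel"
    using I borel_orthonormal_basis(2)[OF orthonormal_basis_unit[of k]] by (auto simp: sets_restrict_space_iff)
  have eq: "\<Psi> (\<lambda>i\<in>{..<l}. x \<bullet> f i) = (\<Sum>j<k. (x \<bullet> v j) *\<^sub>R unit_fseq j)" for x
    unfolding \<Psi>_def
  proof (intro sum.cong refl arg_cong2[where f=scaleR])
    fix j assume "j \<in> {..<k}"
    then have "v j \<in> span (v ` {..<k})" by (intro span_base) auto
    from orthonormal_basis_parseval[OF f this, of x]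
    show "(\<Sum>i<l. (\<lambda>i\<in>{..<l}. x \<bullet> f i) i * (f i \<bullet> v j)) = x \<bullet> v j"
      by (simp add: inner_commute mult.commute)
  qed
  have "(\<lambda>i\<in>{..<l}. x \<bullet> f i) \<in> space (lebesgue_prod {..<l})" for x by (simp add: space_PiM)
  then have "A = {x \<in> sphere 0 1 \<inter> Euclid n. (\<lambda>i\<in>{..<l}. x \<bullet> f i) \<in> \<Psi> -` I \<inter> space (lebesgue_prod {..<l})}"
    unfolding A by (simp add: eq)
  then show ?thesis using measurable_sets[OF \<Psi>m IB] by blast
qed

section \<open>Measurability of the event in the random subspace\<close>

lemma measure_haar_sphere_section:
  assumes H: "H \<in> grassmannian n d" and d: "d > 0" and A: "A \<in> sets (sphere_borel (Euclid n))"
  shows "measure (haar_sphere H) (A \<inter> H)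
    = measure (gauss_on (Euclid n)) {x. orth_proj H x /\<^sub>R norm (orth_proj H x) \<in> A}"
proof -
  obtain b where b: "orthonormal_basis (Euclid n) n b" "orthonormal_basis H d b" "d \<le> n"
    using grassmannian_basis[OF H] by blast
  have HE: "H \<subseteq> Euclid n" and sH: "subspace H" using H by (auto simp: grassmannian_def)
  have AB: "A \<in> sets borel" "A \<subseteq> sphere 0 1"
    using A sphere_Int_borel[OF b(1)] by (auto simp: sphere_borel_def sets_restrict_space_iff)
  have HB: "H \<in> sets borel" by (rule borel_orthonormal_basis[OF b(2)])
  have AH: "A \<inter> H \<in> sets (sphere_borel H)"
    using AB HB sphere_Int_borel[OF b(2)] by (auto simp: sphere_borel_def sets_restrict_space_iff)
  note [measurable] = orth_proj_borel_measurable[OF b(2)]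
  have X: "{x. x /\<^sub>R norm x \<in> A \<inter> H} \<in> sets borel" using AB HB by measurable
  have "measure (haar_sphere H) (A \<inter> H) = measure (gauss_on H) {x. x /\<^sub>R norm x \<in> A \<inter> H}"
    by (rule measure_haar_sphere[OF b(2) d HE AH])
  also have "\<dots> = measure (distr (gauss_on (Euclid n)) borel (orth_proj H)) {x. x /\<^sub>R norm x \<in> A \<inter> H}"
    by (simp add: gauss_on_proj[OF b])
  also have "\<dots> = measure (gauss_on (Euclid n)) (orth_proj H -` {x. x /\<^sub>R norm x \<in> A \<inter> H} \<inter> space (gauss_on (Euclid n)))"
    using X by (intro measure_distr) auto
  also have "orth_proj H -` {x. x /\<^sub>R norm x \<in> A \<inter> H} \<inter> space (gauss_on (Euclid n))
    = {x. orth_proj H x /\<^sub>R norm (orth_proj H x) \<in> A}"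
    using orth_proj_grassmannian(2)[OF H] subspace_scale[OF sH] by auto
  finally show ?thesis .
qed

text \<open>With all sections expressed through a single Gaussian vector in \<open>Euclid n\<close>,
  the function is the measure of the H-section of one jointly measurable set, hence measurable by
  the Fubini theory.\<close>

lemma haar_sphere_section_measurable:
  assumes d: "d > 0" and A: "A \<in> sets (sphere_borel (Euclid n))"
  shows "(\<lambda>H. measure (haar_sphere H) (A \<inter> H)) \<in> borel_measurable (grassmannian_borel n d)"
proof -
  define G where "G = gauss_on (Euclid n)"
  have sG [measurable_cong]: "sets G = sets borel" and spG: "space G = UNIV" by (simp_all add: G_def)
  interpret G: prob_space G unfolding G_def by (rule prob_space_gauss_on)
  let ?M = "grassmannian_borel n d"
  let ?P = "?M \<Otimes>\<^sub>M G"
  have AB [measurable]: "A \<in> sets borel"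
    using A sphere_Int_borel[OF orthonormal_basis_unit] by (auto simp: sphere_borel_def sets_restrict_space_iff)
  have sndm [measurable]: "snd \<in> borel_measurable ?P"
    using measurable_snd[of ?M G] by (simp add: measurable_cong_sets[OF refl sG])
  have [measurable]: "(\<lambda>p. orth_proj (fst p) (unit_fseq i)) \<in> borel_measurable ?P" for i
    by (rule measurable_compose[OF measurable_fst orth_proj_unit_measurable])
  define pr where "pr p = (\<Sum>i<n. coord (snd p) i *\<^sub>R orth_proj (fst p) (unit_fseq i))" for p
  have [measurable]: "pr \<in> borel_measurable ?P" unfolding pr_def by measurable
  define Q where "Q = {p \<in> space ?P. pr p /\<^sub>R norm (pr p) \<in> A}"
  have Q: "Q \<in> sets ?P" unfolding Q_def by measurable
  have "(\<lambda>H. enn2real (emeasure G (Pair H -` Q))) \<in> borel_measurable ?M"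
    using G.measurable_emeasure_Pair[OF Q] by measurable
  then show ?thesis
  proof (rule measurable_cong[THEN iffD1, rotated])
    fix H assume "H \<in> space ?M"
    then have H: "H \<in> grassmannian n d" by simp
    obtain b where b: "orthonormal_basis H d b" using grassmannian_basis[OF H] by blast
    note [measurable] = orth_proj_borel_measurable[OF b]
    have "enn2real (emeasure G (Pair H -` Q)) = measure G (Pair H -` Q)" by (simp add: measure_def)
    also have "\<dots> = measure G {x. orth_proj H x /\<^sub>R norm (orth_proj H x) \<in> A}"
    proof (rule measure_eq_AE)
      show "AE x in G. (x \<in> Pair H -` Q) = (x \<in> {x. orth_proj H x /\<^sub>R norm (orth_proj H x) \<in> A})"
        using AE_gauss_on_mem[OF orthonormal_basis_unit[of n]] unfolding G_def[symmetric]
      proof eventually_elim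
        fix x assume "x \<in> Euclid n"
        then have "pr (H, x) = orth_proj H x" using orth_proj_expand[OF H] by (simp add: pr_def)
        then show "(x \<in> Pair H -` Q) = (x \<in> {x. orth_proj H x /\<^sub>R norm (orth_proj H x) \<in> A})"
          using H by (simp add: Q_def space_pair_measure spG)
      qed
      show "Pair H -` Q \<in> sets G" by (rule sets_Pair1[OF Q])
      show "{x. orth_proj H x /\<^sub>R norm (orth_proj H x) \<in> A} \<in> sets G" unfolding sG by measurable
    qed
    also have "\<dots> = measure (haar_sphere H) (A \<inter> H)"
      unfolding G_def by (rule measure_haar_sphere_section[OF H d A, symmetric])
    finally show "enn2real (emeasure G (Pair H -` Q)) = measure (haar_sphere H) (A \<inter> H)" .
  qed
qed

lemma orthogonal_complement_measurable:
  "(\<lambda>H. orthogonal_comp H \<inter> Euclid n) \<in> measurable (grassmannian_borel n k) (grassmannian_borel n (n - k))"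
proof (rule measurable_grassmannianI)
  fix H assume "H \<in> space (grassmannian_borel n k)"
  then obtain b where b: "orthonormal_basis (Euclid n) n b" "orthonormal_basis H k b" "k \<le> n"
    using grassmannian_basis by fastforce
  show "orthogonal_comp H \<inter> Euclid n \<in> grassmannian n (n - k)"
    by (rule grassmannianI[OF orthonormal_basis_complement[OF b]]) auto
next
  fix i assume i: "i < n"
  have "(\<lambda>H. unit_fseq i - orth_proj H (unit_fseq i)) \<in> borel_measurable (grassmannian_borel n k)" by measurable
  then show "(\<lambda>H. orth_proj (orthogonal_comp H \<inter> Euclid n) (unit_fseq i)) \<in> borel_measurable (grassmannian_borel n k)"
  proof (rule measurable_cong[THEN iffD1, rotated])
    fix H assume "H \<in> space (grassmannian_borel n k)"
    then obtain b where b: "orthonormal_basis (Euclid n) n b" "orthonormal_basis H k b" "k \<le> n"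
      using grassmannian_basis by fastforce
    show "unit_fseq i - orth_proj H (unit_fseq i) = orth_proj (orthogonal_comp H \<inter> Euclid n) (unit_fseq i)"
      by (rule orth_proj_complement[OF b unit_fseq_Euclid[OF i], symmetric])
  qed
qed

text \<open>\<open>measure\<close> vanishes outside the sigma-algebra, so a lower bound for this
  event requires its measurability. From n >= 2 both H and its complement have positive
  dimension.\<close>

lemma section_event_sets:
  assumes n: "n \<ge> 2" and A: "A \<in> sets (sphere_borel (Euclid n))"
  shows "{H \<in> grassmannian n (n div 2).
    sqrt (measure (haar_sphere H) (A \<inter> H) *
      measure (haar_sphere (orthogonal_comp H \<inter> Euclid n)) (A \<inter> (orthogonal_comp H \<inter> Euclid n))) \<ge> c}
    \<in> sets (grassmannian_borel n (n div 2))"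
proof -
  have [measurable]: "(\<lambda>H. measure (haar_sphere H) (A \<inter> H)) \<in> borel_measurable (grassmannian_borel n (n div 2))"
    using n by (intro haar_sphere_section_measurable A) auto
  have "(\<lambda>H. measure (haar_sphere H) (A \<inter> H)) \<in> borel_measurable (grassmannian_borel n (n - n div 2))"
    using n by (intro haar_sphere_section_measurable A) auto
  from measurable_compose[OF orthogonal_complement_measurable this]
  have [measurable]: "(\<lambda>H. measure (haar_sphere (orthogonal_comp H \<inter> Euclid n)) (A \<inter> (orthogonal_comp H \<inter> Euclid n)))
    \<in> borel_measurable (grassmannian_borel n (n div 2))" .
  have "{H \<in> space (grassmannian_borel n (n div 2)).
    sqrt (measure (haar_sphere H) (A \<inter> H) *
      measure (haar_sphere (orthogonal_comp H \<inter> Euclid n)) (A \<inter> (orthogonal_comp H \<inter> Euclid n))) \<ge> c}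
    \<in> sets (grassmannian_borel n (n div 2))" by measurable
  then show ?thesis by simp
qed

lemma section_probability_bound:
  fixes n k :: nat
  assumes n: "10 ^ 8 \<le> sqrt n" and k: "k \<le> sqrt n / 10 ^ 6"
    and A: "A \<in> sets (sphere_borel (Euclid n))" and dep: "depends_on_directions n k A"
    and \<sigma>: "exp (- (1 / 10 ^ 6) * sqrt n) \<le> measure (haar_sphere (Euclid n)) A"
  shows "1 - 4 * exp (- sqrt n) \<le> measure (haar_grassmannian n (n div 2))
    {H \<in> grassmannian n (n div 2).
      sqrt (measure (haar_sphere H) (A \<inter> H) *
        measure (haar_sphere (orthogonal_comp H \<inter> Euclid n)) (A \<inter> (orthogonal_comp H \<inter> Euclid n)))
      \<ge> 0.9 * measure (haar_sphere (Euclid n)) A}"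
    (is "_ \<le> measure ?M ?E")
proof -
  define r where "r = sqrt (real n)"
  have rb: "100000000 \<le> r" using n by (simp add: r_def)
  have rr: "r * r = n" by (simp add: r_def)
  have "1 * r \<le> r * r" using rb by (intro mult_right_mono) auto
  then have n2: "n \<ge> 2" using rr rb by simp
  obtain v I where v: "\<And>j. j < k \<Longrightarrow> v j \<in> Euclid n" and I: "I \<in> sets (restrict_space borel (Euclid k))"
    and AI: "A = {x \<in> sphere 0 1 \<inter> Euclid n. (\<Sum>j<k. (x \<bullet> v j) *\<^sub>R unit_fseq j) \<in> I}"
    using dep unfolding depends_on_directions_def by blast
  define F where "F = span (v ` {..<k})"
  have "span (v ` {..<k}) \<subseteq> Euclid n"
    by (rule span_minimal[OF _ subspace_Euclid]) (use v in auto)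
  then have F: "subspace F" "F \<subseteq> Euclid n" by (simp_all add: F_def)
  define l where "l = dim F"
  obtain f where f: "orthonormal_basis F l f" using orthonormal_basis_exists[OF F] by (auto simp: l_def)
  have "l \<le> card (v ` {..<k})" unfolding l_def F_def dim_span by (intro dim_le_card') simp
  also have "\<dots> \<le> k" using card_image_le[of "{..<k}" v] by simp
  finally have lk: "l \<le> k" .
  then have l: "l \<le> sqrt n / 10 ^ 6" using k by simp
  then have lr: "1000000 * real l \<le> r" by (simp add: r_def)
  \<comment> \<open>Then t^2 n / 2 = 2 sqrt n: one sqrt n absorbs the net size exp (66 l), the other
    is the exponent claimed. With \<delta> = 2 t this gives \<delta>^2 = 16 / sqrt n.\<close>
  define t where "t = 2 / sqrt r"
  have r0: "r > 0" using rb by simp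
  have t2: "t\<^sup>2 = 4 / r" using r0 by (simp add: t_def power_divide)
  have t0: "0 < t" using r0 by (simp add: t_def)
  have t4: "t \<le> 1 / 4"
  proof (rule power2_le_imp_le)
    have "4 / r \<le> 4 / 100000000" using rb by (intro divide_left_mono) auto
    then show "t\<^sup>2 \<le> (1 / 4)\<^sup>2" unfolding t2 by (simp add: power2_eq_square)
  qed simp
  obtain G where G: "G \<in> sets ?M" "1 - 4 * exp (66 * real l - t\<^sup>2 * n / 2) \<le> measure ?M G"
    "\<And>H. H \<in> G \<Longrightarrow> H \<in> grassmannian n (n div 2)"
    "\<And>H y. H \<in> G \<Longrightarrow> y \<in> F \<Longrightarrow> norm y = 1 \<Longrightarrow> \<bar>(norm (orth_proj H y))\<^sup>2 - 1 / 2\<bar> \<le> 2 * t"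
    using measure_good_subspaces[OF f F(2) t0 t4] by blast
  have M: "invariant_grassmannian_measure n (n div 2) ?M" by (rule haar_grassmannian_invariant) simp
  then interpret prob_space ?M by (simp add: invariant_grassmannian_measure_def)
  have sM: "sets ?M = sets (grassmannian_borel n (n div 2))" using M by (simp add: invariant_grassmannian_measure_def)
  have "t\<^sup>2 * n / 2 = 2 * r" unfolding t2 rr[symmetric] using r0 by simp
  then have "66 * real l - t\<^sup>2 * n / 2 \<le> - r" using lr rb by simp
  then have "1 - 4 * exp (- r) \<le> 1 - 4 * exp (66 * real l - t\<^sup>2 * n / 2)" by simp
  also have "\<dots> \<le> measure ?M G" by (rule G(2))
  also have "\<dots> \<le> measure ?M ?E"
  proof (rule finite_measure_mono)
    show "?E \<in> sets ?M" unfolding sM by (rule section_event_sets[OF n2 A])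
    show "G \<subseteq> ?E"
    proof
      fix H assume HG: "H \<in> G"
      have "0.9 * measure (haar_sphere (Euclid n)) A \<le> sqrt (measure (haar_sphere H) (A \<inter> H) *
        measure (haar_sphere (orthogonal_comp H \<inter> Euclid n)) (A \<inter> (orthogonal_comp H \<inter> Euclid n)))"
      proof (rule good_section_bound[OF n l f F(2) A _ \<sigma> G(3)[OF HG], where \<delta>="2 * t"])
        show "\<exists>B \<in> sets (lebesgue_prod {..<l}). A = {x \<in> sphere 0 1 \<inter> Euclid n. (\<lambda>i\<in>{..<l}. x \<bullet> f i) \<in> B}"
          if "orthonormal_basis F l f" for f
          by (rule depends_on_directions_coordinates[OF v I AI that[unfolded F_def]])
        show "(2 * t)\<^sup>2 = 16 / sqrt n" by (simp add: power_mult_distrib t2 r_def)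
      qed (use G(4)[OF HG] t0 in auto)
      then show "H \<in> ?E" using G(3)[OF HG] by simp
    qed
  qed
  finally show ?thesis by (simp add: r_def)
qed

theorem mainTheorem2:
  shows "\<exists>\<alpha>1 \<alpha>2 \<alpha>3 :: real. \<alpha>1 > 0 \<and> \<alpha>2 > 0 \<and> \<alpha>3 > 0 \<and>
    (\<forall>(n::nat) A. n \<ge> 2 \<longrightarrow>
       A \<in> sets (sphere_borel (Euclid n)) \<longrightarrow>
       (\<exists>k::nat. real k \<le> \<alpha>1 * sqrt (real n) \<and> depends_on_directions n k A) \<longrightarrow>
       measure (haar_sphere (Euclid n)) A \<ge> exp (- \<alpha>2 * sqrt (real n)) \<longrightarrow>
       measure (haar_grassmannian n (n div 2))
         {H \<in> grassmannian n (n div 2).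
            sqrt (measure (haar_sphere H) (A \<inter> H) *
                  measure (haar_sphere (orthogonal_comp H \<inter> Euclid n))
                    (A \<inter> (orthogonal_comp H \<inter> Euclid n)))
            \<ge> 0.9 * measure (haar_sphere (Euclid n)) A}
       \<ge> 1 - \<alpha>3 * exp (- sqrt (real n)))"
proof (rule exI[of _ "1 / 10 ^ 6"], rule exI[of _ "1 / 10 ^ 6"], rule exI[of _ "4 + exp (10 ^ 8)"],
    intro conjI allI impI)
  fix n :: nat and A :: "fseq set"
  assume A: "A \<in> sets (sphere_borel (Euclid n))"
    and dep: "\<exists>k::nat. real k \<le> 1 / 10 ^ 6 * sqrt (real n) \<and> depends_on_directions n k A"
    and \<sigma>: "exp (- (1 / 10 ^ 6) * sqrt (real n)) \<le> measure (haar_sphere (Euclid n)) A"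
  let ?m = "measure (haar_grassmannian n (n div 2))
         {H \<in> grassmannian n (n div 2).
            sqrt (measure (haar_sphere H) (A \<inter> H) *
                  measure (haar_sphere (orthogonal_comp H \<inter> Euclid n))
                    (A \<inter> (orthogonal_comp H \<inter> Euclid n)))
            \<ge> 0.9 * measure (haar_sphere (Euclid n)) A}"
  show "1 - (4 + exp (10 ^ 8)) * exp (- sqrt (real n)) \<le> ?m"
  proof (cases "10 ^ 8 \<le> sqrt (real n)")
    case True
    obtain k where "real k \<le> sqrt (real n) / 10 ^ 6" "depends_on_directions n k A" using dep by auto
    from section_probability_bound[OF True this(1) A this(2) \<sigma>]
    have "1 - 4 * exp (- sqrt (real n)) \<le> ?m" .
    moreover have "4 * exp (- sqrt (real n)) \<le> (4 + exp (10 ^ 8)) * exp (- sqrt (real n))"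
      by (intro mult_right_mono) auto
    ultimately show ?thesis by linarith
  next
    case False
    \<comment> \<open>For small n the constant \<alpha>3 makes the claimed lower bound at most 0;
      this is the origin of its summand exp (10^8).\<close>
    then have "1 \<le> exp (10 ^ 8 + - sqrt (real n))" by simp
    also have "\<dots> = exp (10 ^ 8) * exp (- sqrt (real n))" by (rule exp_add)
    also have "\<dots> \<le> (4 + exp (10 ^ 8)) * exp (- sqrt (real n))" by (intro mult_right_mono) auto
    finally show ?thesis using measure_nonneg[of "haar_grassmannian n (n div 2)"] by (smt (verit))
  qed
qed (auto intro: add_pos_pos)

end
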